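(* There is an algorithm that, given any presentation $P=\langle g_1,\dots,g_n; r_1,\dots,r_m\rangle$, constructs the model simplicial complex $K=K(P)$ realized in $\mathbb{R}^4$. Moreover, the run-time of the algorithm (and hence the size of $K$) is of the order of the unary size of $P$.
   Context: A (finite) presentation $P=\langle g_1,\dots,g_n; r_1,\dots,r_m\rangle$ has generators $g_i$ and relations $r_j$, which are words in the $g_i$ and their inverses; the group $G(P)$ is the quotient of the free group on $g_1,\dots,g_n$ by the smallest normal subgroup containing the elements represented by the words $r_j$. It is assumed that a given presentation always has at least $n$ relations (free groups can be presented with $n$ copies of the symbol denoting the empty word as relations). Write $r_j=g'_1\cdots g'_{k_j}$, where each $g'_l$ is $g_i$ or $g_i^{-1}$ for some $i$. The unary size of $P$ is $s(P)=n+\sum_{j=1}^m k_j$. (Encoding the presentation needs an additional multiplicative factor $\log n$ for addressing the generators; this factor is suppressed throughout.) The model simplicial complex $K(P)$ is a simplicial $2$-complex with fundamental group isomorphic to $G(P)$, built from $P$ as follows. Take a wedge $W$ of $n$ simplicial circles, one for each generator, each with $c$ edges. For each relation $r_j$, attach to $W$ an annulus consisting of $ck_j$ rectangles along its lower boundary, the lower edge of each rectangle being identified with an edge of $W$, so that the attaching map of the lower boundary represents $r_j$ in $\pi_1(W)$ based at the wedge point; then attach a disk to the upper boundary of the annulus by a degree $1$ map. The size of a complex is its number of simplices. A simplicial complex is realized in $\mathbb{R}^4$ if it is simplex-wise linearly embedded in $\mathbb{R}^4$.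
   Formalization: An empty relation is counted as having length 1 (with k_j=0, arbitrarily many empty relations would not change s(P), and the bound fails); its annulus and disk form a 2-sphere at the wedge point; for n=m=0, where s(P)=0, the upper bounds use 1 instead. *)

theory Defs
  imports "HOL-Analysis.Analysis"
begin

section \<open>Presentations\<close>

text \<open>The generators of a presentation are numbered \<open>0, \<dots>, n - 1\<close>.\<close>

datatype letter = Gen nat | Inv nat

fun gen_of :: "letter \<Rightarrow> nat" where
  "gen_of (Gen i) = i"
| "gen_of (Inv i) = i"

record pres =
  ngens :: nat
  rels :: "letter list list"

definition presentation :: "pres \<Rightarrow> bool" where
  "presentation P \<longleftrightarrow>
     (\<forall>r\<in>set (rels P). \<forall>g\<in>set r. gen_of g < ngens P) \<and> ngens P \<le> length (rels P)"

text \<open>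
  The empty relation is written with a symbol of its own, so it has length 1.  If it had length 0,
  a presentation with one generator and \<open>m\<close> empty relations would have size 1 for every \<open>m\<close>,
  and no algorithm could even read it within time linear in its size.
\<close>

definition rel_length :: "letter list \<Rightarrow> nat" where
  "rel_length r = max 1 (length r)"

definition unary_size :: "pres \<Rightarrow> nat" where
  "unary_size P = ngens P + (\<Sum>r\<leftarrow>rels P. rel_length r)"


section \<open>The model complex\<close>

text \<open>
  A simplicial complex is given by its set of simplices, and a simplex by its nonempty finite set
  of vertices.
\<close>

definition generated_complex :: "'v set set \<Rightarrow> 'v set set" where
  "generated_complex F = {\<sigma>. \<sigma> \<noteq> {} \<and> (\<exists>\<tau>\<in>F. \<sigma> \<subseteq> \<tau>)}"

text \<open>
  \<open>Base\<close> is the wedge point, \<open>Circ i l\<close> with \<open>0 < l < c\<close> is the \<open>l\<close>-th further vertex of the \<open>i\<close>-th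
  circle, \<open>Upper j l\<close> is the \<open>l\<close>-th vertex of the upper boundary of the annulus of the \<open>j\<close>-th
  relation, and \<open>Apex j\<close> is the cone point of the disk attached to that boundary.
\<close>

datatype vertex = Base | Circ nat nat | Upper nat nat | Apex nat

definition circ :: "nat \<Rightarrow> nat \<Rightarrow> nat \<Rightarrow> vertex" where
  "circ c i l = (if l mod c = 0 then Base else Circ i l)"

fun letter_vertex :: "nat \<Rightarrow> letter \<Rightarrow> nat \<Rightarrow> vertex" where
  "letter_vertex c (Gen i) l = circ c i l"
| "letter_vertex c (Inv i) l = circ c i (c - l)"

text \<open>
  The lower boundary of the annulus of \<open>r\<close> is attached along the closed edge path in the wedge that
  runs once around a circle, forwards or backwards, for each letter of \<open>r\<close>; \<open>lower_vertex c r l\<close> is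
  its \<open>l\<close>-th vertex, for \<open>l \<le> c * rel_length r\<close>.  It is the constant path at the wedge point if \<open>r\<close>
  is empty.  In that case the rectangles degenerate to triangles, and the annulus and its disk
  form a 2-sphere that meets the wedge in the wedge point.
\<close>

definition lower_vertex :: "nat \<Rightarrow> letter list \<Rightarrow> nat \<Rightarrow> vertex" where
  "lower_vertex c r l =
     (if r = [] \<or> l mod c = 0 then Base else letter_vertex c (r ! (l div c)) (l mod c))"

text \<open>
  Each rectangle of the annulus is cut into two triangles by a diagonal.  The disk is the cone on
  the upper boundary, attached by the identity.
\<close>

definition relation_triangles :: "nat \<Rightarrow> nat \<Rightarrow> letter list \<Rightarrow> vertex set set" where
  "relation_triangles c j r =
     (let N = c * rel_length r in
      \<Union>l<N. {{lower_vertex c r l, lower_vertex c r (l + 1), Upper j l},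
             {lower_vertex c r (l + 1), Upper j l, Upper j ((l + 1) mod N)},
             {Upper j l, Upper j ((l + 1) mod N), Apex j}})"

definition model_complex :: "nat \<Rightarrow> pres \<Rightarrow> vertex set set" where
  "model_complex c P =
     generated_complex
       ({{Base}} \<union>
        (\<Union>i<ngens P. \<Union>l<c. {{circ c i l, circ c i (l + 1)}}) \<union>
        (\<Union>j<length (rels P). relation_triangles c j (rels P ! j)))"


section \<open>Simplex-wise linear embeddings\<close>

text \<open>
  Points of the geometric realization of a finite complex are given by their barycentric
  coordinates.  The topology is that of pointwise convergence, which for a finite complex is the
  usual one.
\<close>

definition geom_real :: "'v set set \<Rightarrow> ('v \<Rightarrow> real) set" where
  "geom_real K = {\<alpha>. (\<forall>v. 0 \<le> \<alpha> v) \<and> {v. \<alpha> v \<noteq> 0} \<in> K \<and> (\<Sum>v\<in>\<Union>K. \<alpha> v) = 1}"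

definition linear_extension ::
    "'v set set \<Rightarrow> ('v \<Rightarrow> 'b::real_vector) \<Rightarrow> ('v \<Rightarrow> real) \<Rightarrow> 'b" where
  "linear_extension K p \<alpha> = (\<Sum>v\<in>\<Union>K. \<alpha> v *\<^sub>R p v)"

definition linearly_embeds :: "'v set set \<Rightarrow> ('v \<Rightarrow> 'b::euclidean_space) \<Rightarrow> bool" where
  "linearly_embeds K p \<longleftrightarrow>
     embedding_map (top_of_set (geom_real K)) euclidean (linear_extension K p)"

definition complex_isomorphic :: "'v set set \<Rightarrow> 'w set set \<Rightarrow> bool" where
  "complex_isomorphic K L \<longleftrightarrow> (\<exists>\<phi>. bij_betw \<phi> (\<Union>K) (\<Union>L) \<and> L = (`) \<phi> ` K)"


section \<open>Random access machines\<close>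

text \<open>
  The machine has registers, a random access memory, and a write-only output tape.  Every
  instruction and every test takes one unit of time, and every number put in a register must have
  absolute value at most the word bound \<open>w\<close>; an execution that exceeds it gets stuck.  There is no
  multiplication.
\<close>

datatype prog =
    Const nat int
  | Add nat nat nat
  | Sub nat nat nat
  | Load nat nat
  | Store nat nat
  | Write nat
  | Seq prog prog
  | IfPos nat prog prog
  | WhilePos nat prog

record ram =
  reg :: "nat \<Rightarrow> int"
  mem :: "int \<Rightarrow> int"
  tape :: "int list"

definition set_reg :: "nat \<Rightarrow> int \<Rightarrow> ram \<Rightarrow> ram" where
  "set_reg x v s = s\<lparr>reg := (reg s)(x := v)\<rparr>"

text \<open>
  \<open>exec w p s t s'\<close>: with word bound \<open>w\<close>, the program \<open>p\<close> started in state \<open>s\<close> halts after exactly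
  \<open>t\<close> steps in state \<open>s'\<close>.
\<close>

inductive exec :: "int \<Rightarrow> prog \<Rightarrow> ram \<Rightarrow> nat \<Rightarrow> ram \<Rightarrow> bool" for w :: int where
  Const: "\<bar>k\<bar> \<le> w \<Longrightarrow> exec w (Const x k) s 1 (set_reg x k s)"
| Add: "\<bar>reg s y + reg s z\<bar> \<le> w \<Longrightarrow> exec w (Add x y z) s 1 (set_reg x (reg s y + reg s z) s)"
| Sub: "\<bar>reg s y - reg s z\<bar> \<le> w \<Longrightarrow> exec w (Sub x y z) s 1 (set_reg x (reg s y - reg s z) s)"
| Load: "\<bar>mem s (reg s y)\<bar> \<le> w \<Longrightarrow> exec w (Load x y) s 1 (set_reg x (mem s (reg s y)) s)"
| Store: "exec w (Store x y) s 1 (s\<lparr>mem := (mem s)(reg s x := reg s y)\<rparr>)"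
| Write: "exec w (Write x) s 1 (s\<lparr>tape := tape s @ [reg s x]\<rparr>)"
| Seq: "\<lbrakk>exec w p s t s'; exec w q s' t' s''\<rbrakk> \<Longrightarrow> exec w (Seq p q) s (t + t') s''"
| IfTrue: "\<lbrakk>reg s x > 0; exec w p s t s'\<rbrakk> \<Longrightarrow> exec w (IfPos x p q) s (t + 1) s'"
| IfFalse: "\<lbrakk>\<not> reg s x > 0; exec w q s t s'\<rbrakk> \<Longrightarrow> exec w (IfPos x p q) s (t + 1) s'"
| WhileFalse: "\<not> reg s x > 0 \<Longrightarrow> exec w (WhilePos x p) s 1 s"
| WhileTrue: "\<lbrakk>reg s x > 0; exec w p s t s'; exec w (WhilePos x p) s' t' s''\<rbrakk>
    \<Longrightarrow> exec w (WhilePos x p) s (t + t' + 1) s''"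

inductive_cases ConstE: "exec w (Const x k) s t s'"
inductive_cases AddE: "exec w (Add x y z) s t s'"
inductive_cases SubE: "exec w (Sub x y z) s t s'"
inductive_cases LoadE: "exec w (Load x y) s t s'"
inductive_cases StoreE: "exec w (Store x y) s t s'"
inductive_cases WriteE: "exec w (Write x) s t s'"
inductive_cases SeqE: "exec w (Seq p q) s t s'"
inductive_cases IfE: "exec w (IfPos x p q) s t s'"
inductive_cases WhileE: "exec w (WhilePos x p) s t s'"

lemma exec_deterministic:
  assumes "exec w p s t s'" and "exec w p s t' s''"
  shows "t = t' \<and> s' = s''"
  using assms
proof (induction arbitrary: t' s'' rule: exec.induct)
  case (Const k x s)
  then show ?case by (auto elim: ConstE)
next
  case (Add s y z x)
  from Add.prems show ?case by (rule AddE) simp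
next
  case (Sub s y z x)
  from Sub.prems show ?case by (rule SubE) simp
next
  case (Load s y x)
  from Load.prems show ?case by (rule LoadE) simp
next
  case (Store s x y)
  from Store.prems show ?case by (rule StoreE) simp
next
  case (Write s x)
  from Write.prems show ?case by (rule WriteE) simp
next
  case (Seq p s t s' q t1 s1)
  from Seq.prems obtain u v r where e: "exec w p s u r" "exec w q r v s''" "t' = u + v"
    by (rule SeqE)
  from Seq.IH(1)[OF e(1)] have "t = u" and r: "r = s'" by simp_all
  with Seq.IH(2)[OF e(2)[unfolded r]] e(3) show ?case by simp
next
  case (IfTrue s x p t s' q)
  from IfTrue.prems IfTrue.hyps obtain u where "exec w p s u s''" "t' = u + 1"
    by (auto elim!: IfE)
  with IfTrue.IH show ?case by simp
next
  case (IfFalse s x q t s' p)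
  from IfFalse.prems IfFalse.hyps obtain u where "exec w q s u s''" "t' = u + 1"
    by (auto elim!: IfE)
  with IfFalse.IH show ?case by simp
next
  case (WhileFalse s x p)
  from WhileFalse.prems show ?case
    by (rule WhileE) (simp_all add: WhileFalse.hyps)
next
  case (WhileTrue s x p t s' t1 s1)
  from WhileTrue.prems WhileTrue.hyps obtain u r v
    where e: "exec w p s u r" "exec w (WhilePos x p) r v s''" "t' = u + v + 1"
    by (auto elim!: WhileE[of w x p s])
  from WhileTrue.IH(1)[OF e(1)] have "t = u" and r: "r = s'" by simp_all
  with WhileTrue.IH(2)[OF e(2)[unfolded r]] e(3) show ?case by simp
qed


section \<open>Input and output\<close>

fun letter_code :: "letter \<Rightarrow> int" where
  "letter_code (Gen i) = int (i + 1)"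
| "letter_code (Inv i) = - int (i + 1)"

definition presentation_code :: "pres \<Rightarrow> int list" where
  "presentation_code P =
     [int (ngens P), int (length (rels P))] @
     concat (map (\<lambda>r. int (length r) # map letter_code r) (rels P))"

definition initial_ram :: "int list \<Rightarrow> ram" where
  "initial_ram xs =
     \<lparr>reg = (\<lambda>_. 0),
      mem = (\<lambda>a. if 0 \<le> a \<and> a < int (length xs) then xs ! nat a else 0),
      tape = []\<rparr>"

text \<open>
  The output is a list of points of \<open>\<int>\<^sup>4\<close>, followed by a list of simplices, each of which is
  given by the list of the indices of its vertices in the list of points.  A leading \<open>0\<close> announces
  a point, and a leading \<open>k > 0\<close> announces a simplex with \<open>k\<close> vertices.
\<close>

type_synonym point = "int \<times> int \<times> int \<times> int"

definition output_code :: "point list \<Rightarrow> nat list list \<Rightarrow> int list" where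
  "output_code ps ss =
     concat (map (\<lambda>(x1, x2, x3, x4). [0, x1, x2, x3, x4]) ps) @
     concat (map (\<lambda>\<sigma>. int (length \<sigma>) # map int \<sigma>) ss)"

fun point_vector :: "point \<Rightarrow> real ^ 4" where
  "point_vector (x1, x2, x3, x4) =
     vector [of_int x1, of_int x2, of_int x3, of_int x4]"

definition realizes :: "point list \<Rightarrow> nat list list \<Rightarrow> 'v set set \<Rightarrow> bool" where
  "realizes ps ss K \<longleftrightarrow>
     (let L = set ` set ss in
      (\<forall>\<sigma>\<in>set ss. distinct \<sigma>) \<and> \<Union>L = {..<length ps} \<and>
      complex_isomorphic K L \<and>
      linearly_embeds L (\<lambda>v. point_vector (ps ! v)))"

end

theory Submission
  imports Defs
begin

text \<open>
  Number the vertices, the vertices of the annulus and disk of one relation being consecutive and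
  starting with the apex, and use the number \<open>v\<close> of a vertex as a coordinate: the wedge point is
  the origin, the other vertices of the wedge are \<open>(v, -1, 0, 0)\<close>, an upper vertex is
  \<open>(x, 0, v, 1)\<close> with \<open>x = 0\<close> for the first and last vertex of its cycle and \<open>x = 1\<close> otherwise,
  and an apex is \<open>(0, 1, v, 1)\<close>.

  For a point of the realization, the second and fourth coordinates give the total weights of the
  apices, of the upper vertices and of the wedge vertices, since a simplex with an apex does not
  meet the wedge.  If the fourth coordinate \<open>t\<close> is positive, the third one divided by \<open>t\<close> tells
  which relation the point belongs to.  The upper vertices of a simplex have consecutive
  numbers, so their weights can be read off from the total weight and the centre of mass, except
  for the edge that closes the cycle; that edge is recognized by the first coordinate because the
  only wedge vertex joined to it is the origin.  Likewise the wedge vertices of a simplex other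
  than the wedge point have consecutive numbers.

  All coordinates are of linear size, and the machine produces them by counting.
\<close>

section \<open>Linear embeddings of finite complexes\<close>

text \<open>The obstacle is the edge that closes an upper cycle. Weights on two consecutive labels
  are fixed by their total and centre of mass, but weights on \<open>a j + 1\<close> and
  \<open>a j + N j\<close> can have the same total and centre as weights in the middle of the cycle.
  Three coordinates are already spent, so the first one must both expose the closing edge and carry
  the moment of the wedge weights. These tasks do not collide: if the wedge weight away from the
  origin is zero, which the second coordinate shows, the first one is just the weight of the inner
  upper vertices.

  The opposite signs in the second coordinate let it carry two totals at once, of which at most one
  is nonzero. The origin adds nothing to any coordinate, so the weight of the wedge point is found
  last, as the remainder to 1. Compactness then reduces the embedding to this injectivity.

  On the machine side, words of linear size and the lack of multiplication are the constraints:
  products with the fixed \<open>c\<close> become \<open>c\<close>-fold additions, laid out when the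
  program is built. Lower bounds for time and size come from the number of vertices alone.\<close>

lemma compact_geom_real:
  assumes fin: "finite K" "\<And>\<sigma>. \<sigma> \<in> K \<Longrightarrow> finite \<sigma>"
    and down: "\<And>\<sigma> \<tau>. \<sigma> \<in> K \<Longrightarrow> \<tau> \<subseteq> \<sigma> \<Longrightarrow> \<tau> \<noteq> {} \<Longrightarrow> \<tau> \<in> K"
  shows "compact (geom_real K)"
proof -
  let ?V = "\<Union>K"
  have finV: "finite ?V" using fin by auto
  define cube :: "('a \<Rightarrow> real) set" where "cube = PiE UNIV (\<lambda>v. {0..1})"
  define face where "face \<sigma> = {\<alpha>::'a \<Rightarrow> real. \<forall>v. v \<notin> \<sigma> \<longrightarrow> \<alpha> v = 0}" for \<sigma>
  define unit where "unit = {\<alpha>::'a \<Rightarrow> real. sum \<alpha> ?V = 1}"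
  have "compactin (product_topology (\<lambda>_::'a. euclidean :: real topology) UNIV) cube"
    unfolding cube_def compactin_PiE by auto
  then have cube: "compact cube"
    by (simp add: euclidean_product_topology)
  have cl: "closed {\<alpha>::'a \<Rightarrow> real. \<alpha> v = 0}" for v
    by (intro closed_Collect_eq) auto
  have clf: "closed (face \<sigma>)" for \<sigma>
  proof -
    have "face \<sigma> = (\<Inter>v\<in>-\<sigma>. {\<alpha>. \<alpha> v = 0})"
      by (auto simp: face_def)
    then show ?thesis using cl by auto
  qed
  have clu: "closed unit"
    unfolding unit_def by (intro closed_Collect_eq continuous_on_sum) auto
  \<comment> \<open>The support of a point in \<open>face \<sigma>\<close> may be smaller than
    \<open>\<sigma>\<close>; since the weights sum to 1 it is nonempty, so \<open>down\<close> puts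
    it into \<open>K\<close>. This presents the realization as a finite union of closed subsets of a
    compact cube.\<close>
  have "geom_real K = (\<Union>\<sigma>\<in>K. cube \<inter> (face \<sigma> \<inter> unit))" (is "?L = ?R")
  proof
    show "?L \<subseteq> ?R"
    proof
      fix \<alpha> assume a: "\<alpha> \<in> ?L"
      then have nn: "\<forall>v. 0 \<le> \<alpha> v" and K: "{v. \<alpha> v \<noteq> 0} \<in> K" and s: "sum \<alpha> ?V = 1"
        by (auto simp: geom_real_def)
      have "\<alpha> v \<le> 1" for v
      proof (cases "v \<in> ?V")
        case True
        then show ?thesis using member_le_sum[of v ?V \<alpha>] nn s finV by auto
      next
        case False
        then show ?thesis using K by fastforce
      qed
      then have "\<alpha> \<in> cube" using nn by (auto simp: cube_def)
      moreover have "\<alpha> \<in> face {v. \<alpha> v \<noteq> 0}" by (auto simp: face_def)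
      ultimately show "\<alpha> \<in> ?R" using K s by (auto simp: unit_def)
    qed
    show "?R \<subseteq> ?L"
    proof
      fix \<alpha> assume "\<alpha> \<in> ?R"
      then obtain \<sigma> where \<sigma>: "\<sigma> \<in> K" "\<alpha> \<in> cube" "\<alpha> \<in> face \<sigma>" "\<alpha> \<in> unit" by auto
      have "{v. \<alpha> v \<noteq> 0} \<subseteq> \<sigma>" using \<sigma>(3) by (auto simp: face_def)
      moreover have "{v. \<alpha> v \<noteq> 0} \<noteq> {}"
        using \<sigma>(4) unfolding unit_def by (metis (mono_tags, lifting) emptyE mem_Collect_eq sum.neutral zero_neq_one)
      ultimately have "{v. \<alpha> v \<noteq> 0} \<in> K" using down \<sigma>(1) by blast
      then show "\<alpha> \<in> ?L"
        using \<sigma> by (auto simp: geom_real_def unit_def cube_def)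
    qed
  qed
  also have "compact \<dots>"
    using fin cube clf clu by (intro compact_UN compact_Int_closed closed_Int) auto
  finally show ?thesis .
qed

text \<open>A continuous injection of a compact space into a Hausdorff space is an embedding, so
  only injectivity remains to be checked.\<close>

lemma linearly_embedsI:
  fixes p :: "'v \<Rightarrow> 'b::euclidean_space"
  assumes fin: "finite K" "\<And>\<sigma>. \<sigma> \<in> K \<Longrightarrow> finite \<sigma>"
    and down: "\<And>\<sigma> \<tau>. \<sigma> \<in> K \<Longrightarrow> \<tau> \<subseteq> \<sigma> \<Longrightarrow> \<tau> \<noteq> {} \<Longrightarrow> \<tau> \<in> K"
    and inj: "inj_on (linear_extension K p) (geom_real K)"
  shows "linearly_embeds K p"
  unfolding linearly_embeds_def
proof (rule continuous_imp_embedding_map)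
  have "continuous_on UNIV (\<lambda>\<alpha>::'v \<Rightarrow> real. \<Sum>v\<in>\<Union>K. \<alpha> v *\<^sub>R p v)"
    by (intro continuous_intros) auto
  then have "continuous_on (geom_real K) (linear_extension K p)"
    unfolding linear_extension_def by (rule continuous_on_subset) auto
  then show "continuous_map (top_of_set (geom_real K)) euclidean (linear_extension K p)"
    by simp
  show "compact_space (top_of_set (geom_real K))"
    using compact_geom_real[OF fin down] by (simp add: compact_space_subtopology)
qed (use inj in auto)

lemma vector_4:
  "(vector [x, y, z, t] :: ('a::zero)^4) $ 1 = x"
  "(vector [x, y, z, t] :: ('a::zero)^4) $ 2 = y"
  "(vector [x, y, z, t] :: ('a::zero)^4) $ 3 = z"
  "(vector [x, y, z, t] :: ('a::zero)^4) $ 4 = t"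
  unfolding vector_def by simp_all

section \<open>Weights on two labels, recovered from total and first moment\<close>

lemma sum_two_points:
  fixes f h :: "nat \<Rightarrow> real"
  assumes "finite V" "{v. f v \<noteq> 0} \<subseteq> V" "{v. f v \<noteq> 0} \<subseteq> {p, q}" "p \<noteq> q"
  shows "(\<Sum>v\<in>V. h v * f v) = h p * f p + h q * f q"
proof -
  have "(\<Sum>v\<in>V. h v * f v) = (\<Sum>v\<in>V \<union> {p, q}. h v * f v)"
    using assms by (intro sum.mono_neutral_left) auto
  also have "\<dots> = (\<Sum>v\<in>{p, q}. h v * f v)"
    using assms by (intro sum.mono_neutral_right) auto
  finally show ?thesis using assms(4) by simp
qed

text \<open>Two linear equations in two unknown weights; the determinant is the difference of the
  labels \<open>p\<close> and \<open>q\<close>.\<close>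

lemma two_points_determined:
  fixes f g :: "nat \<Rightarrow> real"
  assumes V: "finite V" and f: "{v. f v \<noteq> 0} \<subseteq> V" "{v. f v \<noteq> 0} \<subseteq> {p, q}"
    and g: "{v. g v \<noteq> 0} \<subseteq> V" "{v. g v \<noteq> 0} \<subseteq> {p, q}" and "p \<noteq> q"
    and s: "sum f V = sum g V" and mom: "(\<Sum>v\<in>V. real v * f v) = (\<Sum>v\<in>V. real v * g v)"
  shows "f = g"
proof
  fix v
  have s': "f p + f q = g p + g q"
    using s sum_two_points[OF V f \<open>p \<noteq> q\<close>, of "\<lambda>_. 1"] sum_two_points[OF V g \<open>p \<noteq> q\<close>, of "\<lambda>_. 1"]
    by simp
  have m': "real p * f p + real q * f q = real p * g p + real q * g q"
    using mom sum_two_points[OF V f \<open>p \<noteq> q\<close>, of real] sum_two_points[OF V g \<open>p \<noteq> q\<close>, of real]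
    by simp
  have "(real p - real q) * (f p - g p) = (real p * f p + real q * f q) - (real p * g p + real q * g q)
      - real q * ((f p + f q) - (g p + g q))"
    by (simp add: algebra_simps)
  also have "\<dots> = 0" using s' m' by simp
  finally have "f p = g p" using \<open>p \<noteq> q\<close> by simp
  moreover from this have "f q = g q" using s' by simp
  moreover have "f v = 0" "g v = 0" if "v \<notin> {p, q}" using that f(2) g(2) by auto
  ultimately show "f v = g v" by (cases "v \<in> {p, q}") auto
qed

text \<open>If \<open>p < q\<close>, the centre of mass of \<open>f\<close> is at most
  \<open>p + 1\<close> and that of \<open>g\<close> at least \<open>q\<close>. As the centres agree,
  all weight sits on one common vertex or there is none. Nonnegativity keeps each centre between its
  two labels.\<close>

lemma consecutive_points_determined:
  fixes f g :: "nat \<Rightarrow> real"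
  assumes V: "finite V" and f: "{v. f v \<noteq> 0} \<subseteq> V" "{v. f v \<noteq> 0} \<subseteq> {p, p + 1}"
    and g: "{v. g v \<noteq> 0} \<subseteq> V" "{v. g v \<noteq> 0} \<subseteq> {q, q + 1}"
    and nn: "\<And>v. 0 \<le> f v" "\<And>v. 0 \<le> g v"
    and s: "sum f V = sum g V" and mom: "(\<Sum>v\<in>V. real v * f v) = (\<Sum>v\<in>V. real v * g v)"
  shows "f = g"
proof -
  have *: "f = g" if V: "finite V" and f: "{v. f v \<noteq> 0} \<subseteq> V" "{v. f v \<noteq> 0} \<subseteq> {p, p + 1}"
    and g: "{v. g v \<noteq> 0} \<subseteq> V" "{v. g v \<noteq> 0} \<subseteq> {q, q + 1}"
    and nn: "\<And>v. 0 \<le> f v" "\<And>v. 0 \<le> g v"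
    and s: "sum f V = sum g V" and mom: "(\<Sum>v\<in>V. real v * f v) = (\<Sum>v\<in>V. real v * g v)"
    and "p < q" for f g :: "nat \<Rightarrow> real" and p q
  proof -
    have s': "f p + f (p+1) = g q + g (q+1)"
      using s sum_two_points[OF V f, of "\<lambda>_. 1"] sum_two_points[OF V g, of "\<lambda>_. 1"] by simp
    have m': "real p * f p + real (p+1) * f (p+1) = real q * g q + real (q+1) * g (q+1)"
      using mom sum_two_points[OF V f, of real] sum_two_points[OF V g, of real] by simp
    \<comment> \<open>With common total \<open>T\<close>, the moment of \<open>f\<close> is
      \<open>(p + 1) * T - f p\<close> and that of \<open>g\<close> is
      \<open>q * T + g (q + 1)\<close>. Equating them makes a sum of three nonnegative terms
      vanish.\<close>
    have *: "(real q - real (p+1)) * (f p + f (p+1)) + f p + g (q+1) = 0"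
    proof -
      have "real q * (f p + f (p+1)) = real q * (g q + g (q+1))" using s' by simp
      then show ?thesis using m' s'
        unfolding of_nat_add of_nat_1 left_diff_distrib right_diff_distrib distrib_left distrib_right
        by linarith
    qed
    have "0 \<le> (real q - real (p+1)) * (f p + f (p+1))"
      using \<open>p < q\<close> nn by (intro mult_nonneg_nonneg) auto
    with * nn have z: "f p = 0" "g (q+1) = 0" "(real q - real (p+1)) * (f p + f (p+1)) = 0"
      using add_nonneg_eq_0_iff by (smt (verit))+
    show ?thesis
    proof (cases "q = p + 1")
      case True
      have "f q = g q" using z s' True by simp
      moreover have "f v = 0" "g v = 0" if "v \<noteq> q" for v
        using that z f(2) g(2) True by auto
      ultimately show ?thesis by (metis ext)
    next
      case False
      then have "f p + f (p+1) = 0" using z(3) \<open>p < q\<close> by auto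
      then have zz: "f p = 0" "f (p+1) = 0" "g q = 0" "g (q+1) = 0"
        using s' nn z by auto
      have "f v = 0" for v using f(2) zz by auto
      moreover have "g v = 0" for v using g(2) zz by auto
      ultimately show ?thesis by auto
    qed
  qed
  consider "p < q" | "q < p" | "p = q" by linarith
  then show ?thesis
  proof cases
    case 1 then show ?thesis using *[OF V f g nn s mom] by blast
  next
    case 2 then show ?thesis using *[OF V g f nn(2,1) s[symmetric] mom[symmetric]] by blast
  next
    case 3
    then show ?thesis using two_points_determined[OF V f g(1) _ _ s mom] g(2) by simp
  qed
qed


section \<open>Injectivity of the coordinates for an abstract numbering\<close>

text \<open>The embedding depends only on the arithmetic of the numbering: labels below
  \<open>D\<close> form the wedge, and block \<open>j\<close> runs from its apex \<open>a j\<close>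
  through its cycle up to \<open>a j + N j\<close>. With \<open>m\<close> blocks, \<open>a m\<close>
  is the number of vertices.\<close>

locale layout =
  fixes m D :: nat and a N :: "nat \<Rightarrow> nat"
  assumes D_pos: "0 < D" and N_ge_3: "\<And>j. 3 \<le> N j"
    and a_0: "a 0 = D" and a_Suc: "\<And>j. a (Suc j) = a j + N j + 1"
begin

definition apex :: "nat \<Rightarrow> bool" where
  "apex v \<longleftrightarrow> (\<exists>j<m. v = a j)"

definition rim_end :: "nat \<Rightarrow> bool" where
  "rim_end v \<longleftrightarrow> (\<exists>j<m. v = a j + 1 \<or> v = a j + N j)"

definition pt :: "nat \<Rightarrow> point" where
  "pt v = (if v < D then (int v, if v = 0 then 0 else -1, 0, 0)
           else (if apex v \<or> rim_end v then 0 else 1, if apex v then 1 else 0, int v, 1))"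

lemma a_less: "j < j' \<Longrightarrow> a j + N j < a j'"
proof (induction j')
  case (Suc j')
  then show ?case by (cases "j = j'") (auto simp: a_Suc)
qed simp

lemma a_le: "j \<le> j' \<Longrightarrow> a j \<le> a j'"
  using a_less[of j j'] by (cases "j = j'") auto

lemma D_le_a: "D \<le> a j"
  using a_le[of 0 j] by (simp add: a_0)

lemma interval_unique:
  assumes "a i \<le> v" "v \<le> a i + N i" "a j \<le> v" "v \<le> a j + N j"
  shows "i = j"
  using assms a_less[of i j] a_less[of j i] by (cases i j rule: linorder_cases) auto

lemma apex_ge: "apex v \<Longrightarrow> D \<le> v"
  using D_le_a by (auto simp: apex_def)

lemma apex_in_interval:
  assumes "apex v" "a j \<le> v" "v \<le> a j + N j"
  shows "v = a j"
proof -
  from assms obtain i where i: "v = a i" by (auto simp: apex_def)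
  then have "i = j" using interval_unique[of i v j] assms by auto
  with i show ?thesis by simp
qed

lemma rim_end_in_interval:
  assumes "rim_end v" and v: "a j \<le> v" "v \<le> a j + N j"
  shows "v = a j + 1 \<or> v = a j + N j"
proof -
  from assms obtain i where i: "v = a i + 1 \<or> v = a i + N i" by (auto simp: rim_end_def)
  then have "i = j" using interval_unique[of i v j] v N_ge_3[of i] by auto
  with i show ?thesis by simp
qed

text \<open>A superset of the simplices, closed under passing to faces.  The triangle \<open>closing\<close> is the last
  one of an annulus; it is the reason for the exceptional first coordinate.\<close>

inductive simplex_shape :: "nat set \<Rightarrow> bool" where
  wedge: "\<sigma> \<inter> {0<..<D} \<subseteq> {k, k + 1} \<Longrightarrow> \<sigma> \<subseteq> {..<D} \<Longrightarrow> simplex_shape \<sigma>"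
| path: "\<sigma> \<inter> {0<..<D} \<subseteq> {k, k + 1} \<Longrightarrow> j < m \<Longrightarrow> a j < q \<Longrightarrow> q + 1 \<le> a j + N j \<Longrightarrow>
    \<sigma> \<inter> {D..} \<subseteq> {q, q + 1} \<Longrightarrow> simplex_shape \<sigma>"
| closing: "j < m \<Longrightarrow> \<sigma> \<subseteq> {0, a j + 1, a j + N j} \<Longrightarrow> simplex_shape \<sigma>"
| disk: "j < m \<Longrightarrow> a j < q \<Longrightarrow> q + 1 \<le> a j + N j \<Longrightarrow> \<sigma> \<subseteq> {a j, q, q + 1} \<Longrightarrow> simplex_shape \<sigma>"
| closing_disk: "j < m \<Longrightarrow> \<sigma> \<subseteq> {a j, a j + 1, a j + N j} \<Longrightarrow> simplex_shape \<sigma>"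

text \<open>In order, the facts that let the coordinates be decoded: apices and wedge can share one
  signed coordinate; all weight off the wedge lies in one block; wedge labels are consecutive; upper
  labels are consecutive too, or else lie among the two ends of a cycle with no wedge vertex but the
  base point present.\<close>

lemma simplex_shapeD:
  assumes "simplex_shape \<sigma>"
  shows "(\<forall>v\<in>\<sigma>. \<not> apex v) \<or> \<sigma> \<inter> {0<..<D} = {}"
    and "\<sigma> \<subseteq> {..<D} \<or> (\<exists>j<m. \<sigma> \<inter> {D..} \<subseteq> {a j..a j + N j})"
    and "\<exists>k. \<sigma> \<inter> {0<..<D} \<subseteq> {k, k + 1}"
    and "(\<exists>q. {v\<in>\<sigma>. D \<le> v \<and> \<not> apex v} \<subseteq> {q, q + 1}) \<or>
         \<sigma> \<inter> {0<..<D} = {} \<and> (\<forall>v\<in>\<sigma>. D \<le> v \<longrightarrow> apex v \<or> rim_end v)"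
proof -
  from assms have "((\<forall>v\<in>\<sigma>. \<not> apex v) \<or> \<sigma> \<inter> {0<..<D} = {}) \<and>
    (\<sigma> \<subseteq> {..<D} \<or> (\<exists>j<m. \<sigma> \<inter> {D..} \<subseteq> {a j..a j + N j})) \<and>
    (\<exists>k. \<sigma> \<inter> {0<..<D} \<subseteq> {k, k + 1}) \<and>
    ((\<exists>q. {v\<in>\<sigma>. D \<le> v \<and> \<not> apex v} \<subseteq> {q, q + 1}) \<or>
         \<sigma> \<inter> {0<..<D} = {} \<and> (\<forall>v\<in>\<sigma>. D \<le> v \<longrightarrow> apex v \<or> rim_end v))"
  proof cases
    case (wedge k)
    have n: "\<not> apex v" if "v \<in> \<sigma>" for v using that wedge(2) apex_ge by fastforce
    \<comment> \<open>The set is empty, so any pair of consecutive labels will do.\<close>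
    have e: "{v \<in> \<sigma>. D \<le> v \<and> \<not> apex v} \<subseteq> {0, 0 + 1}" using wedge(2) by auto
    have c1: "(\<forall>v\<in>\<sigma>. \<not> apex v) \<or> \<sigma> \<inter> {0<..<D} = {}" and c3: "\<exists>k. \<sigma> \<inter> {0<..<D} \<subseteq> {k, k + 1}"
      using n wedge(1) by blast+
    have c2: "\<sigma> \<subseteq> {..<D} \<or> (\<exists>j<m. \<sigma> \<inter> {D..} \<subseteq> {a j..a j + N j})"
      using wedge(2) by (intro disjI1)
    have c4: "(\<exists>q. {v\<in>\<sigma>. D \<le> v \<and> \<not> apex v} \<subseteq> {q, q + 1}) \<or>
         \<sigma> \<inter> {0<..<D} = {} \<and> (\<forall>v\<in>\<sigma>. D \<le> v \<longrightarrow> apex v \<or> rim_end v)"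
      using e by (intro disjI1 exI)
    show ?thesis by (intro conjI c1 c2 c3 c4)
  next
    case 2: (path k j q)
    have n: "\<not> apex v" if "v \<in> \<sigma>" for v
    proof
      assume v: "apex v"
      with 2(5) that apex_ge[OF v] have "v \<in> {q, q + 1}" by auto
      then have "v = a j" using 2(3,4) by (intro apex_in_interval[OF v]) auto
      then show False using \<open>v \<in> {q, q + 1}\<close> 2(3) by auto
    qed
    have i: "\<sigma> \<inter> {D..} \<subseteq> {a j..a j + N j}" using 2(3,4,5) by auto
    have e: "{v \<in> \<sigma>. D \<le> v \<and> \<not> apex v} \<subseteq> {q, q + 1}" using 2(5) by auto
    have c1: "(\<forall>v\<in>\<sigma>. \<not> apex v) \<or> \<sigma> \<inter> {0<..<D} = {}" and c3: "\<exists>k. \<sigma> \<inter> {0<..<D} \<subseteq> {k, k + 1}"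
      using n 2(1) by blast+
    have c2: "\<sigma> \<subseteq> {..<D} \<or> (\<exists>j<m. \<sigma> \<inter> {D..} \<subseteq> {a j..a j + N j})"
      using i 2(2) by (intro disjI2 exI conjI)
    have c4: "(\<exists>q. {v\<in>\<sigma>. D \<le> v \<and> \<not> apex v} \<subseteq> {q, q + 1}) \<or>
         \<sigma> \<inter> {0<..<D} = {} \<and> (\<forall>v\<in>\<sigma>. D \<le> v \<longrightarrow> apex v \<or> rim_end v)"
      using e by (intro disjI1 exI)
    show ?thesis by (intro conjI c1 c2 c3 c4)
  next
    case 3: (closing j)
    have e: "\<sigma> \<inter> {0<..<D} = {}" using 3 D_le_a[of j] by auto
    have i: "\<sigma> \<inter> {D..} \<subseteq> {a j..a j + N j}" using 3 D_pos N_ge_3[of j] by auto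
    have r: "D \<le> v \<longrightarrow> apex v \<or> rim_end v" if "v \<in> \<sigma>" for v
      using 3 D_pos that by (auto simp: rim_end_def)
    have c1: "(\<forall>v\<in>\<sigma>. \<not> apex v) \<or> \<sigma> \<inter> {0<..<D} = {}" and c3: "\<exists>k. \<sigma> \<inter> {0<..<D} \<subseteq> {k, k + 1}"
      using e by simp_all
    have c2: "\<sigma> \<subseteq> {..<D} \<or> (\<exists>j<m. \<sigma> \<inter> {D..} \<subseteq> {a j..a j + N j})"
      using i 3(1) by (intro disjI2 exI conjI)
    have c4: "(\<exists>q. {v\<in>\<sigma>. D \<le> v \<and> \<not> apex v} \<subseteq> {q, q + 1}) \<or>
         \<sigma> \<inter> {0<..<D} = {} \<and> (\<forall>v\<in>\<sigma>. D \<le> v \<longrightarrow> apex v \<or> rim_end v)"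
      using e r by (intro disjI2 conjI ballI)
    show ?thesis by (intro conjI c1 c2 c3 c4)
  next
    case 4: (disk j q)
    have v: "a j \<le> v \<and> v \<le> a j + N j" if "v \<in> \<sigma>" for v
    proof -
      have "v = a j \<or> v = q \<or> v = q + 1" using 4(4) that by blast
      then show ?thesis using 4(2,3) by linarith
    qed
    have e: "\<sigma> \<inter> {0<..<D} = {}" using v D_le_a[of j] by (meson disjoint_iff greaterThanLessThan_iff le_trans not_le)
    have i: "\<sigma> \<inter> {D..} \<subseteq> {a j..a j + N j}" using v by auto
    have "{v \<in> \<sigma>. D \<le> v \<and> \<not> apex v} \<subseteq> {q, q + 1}" using 4 by (auto simp: apex_def)
    note f = this
    have c1: "(\<forall>v\<in>\<sigma>. \<not> apex v) \<or> \<sigma> \<inter> {0<..<D} = {}" and c3: "\<exists>k. \<sigma> \<inter> {0<..<D} \<subseteq> {k, k + 1}"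
      using e by simp_all
    have c2: "\<sigma> \<subseteq> {..<D} \<or> (\<exists>j<m. \<sigma> \<inter> {D..} \<subseteq> {a j..a j + N j})"
      using i 4(1) by (intro disjI2 exI conjI)
    have c4: "(\<exists>q. {v\<in>\<sigma>. D \<le> v \<and> \<not> apex v} \<subseteq> {q, q + 1}) \<or>
         \<sigma> \<inter> {0<..<D} = {} \<and> (\<forall>v\<in>\<sigma>. D \<le> v \<longrightarrow> apex v \<or> rim_end v)"
      using f by (intro disjI1 exI)
    show ?thesis by (intro conjI c1 c2 c3 c4)
  next
    case 5: (closing_disk j)
    have v: "a j \<le> v \<and> v \<le> a j + N j" if "v \<in> \<sigma>" for v
    proof -
      have "v = a j \<or> v = a j + 1 \<or> v = a j + N j" using 5(2) that by blast
      then show ?thesis using N_ge_3[of j] by linarith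
    qed
    have e: "\<sigma> \<inter> {0<..<D} = {}" using v D_le_a[of j] by (meson disjoint_iff greaterThanLessThan_iff le_trans not_le)
    have i: "\<sigma> \<inter> {D..} \<subseteq> {a j..a j + N j}" using v by auto
    have r: "D \<le> v \<longrightarrow> apex v \<or> rim_end v" if "v \<in> \<sigma>" for v
      using 5 D_pos that by (auto simp: rim_end_def apex_def)
    have c1: "(\<forall>v\<in>\<sigma>. \<not> apex v) \<or> \<sigma> \<inter> {0<..<D} = {}" and c3: "\<exists>k. \<sigma> \<inter> {0<..<D} \<subseteq> {k, k + 1}"
      using e by simp_all
    have c2: "\<sigma> \<subseteq> {..<D} \<or> (\<exists>j<m. \<sigma> \<inter> {D..} \<subseteq> {a j..a j + N j})"
      using i 5(1) by (intro disjI2 exI conjI)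
    have c4: "(\<exists>q. {v\<in>\<sigma>. D \<le> v \<and> \<not> apex v} \<subseteq> {q, q + 1}) \<or>
         \<sigma> \<inter> {0<..<D} = {} \<and> (\<forall>v\<in>\<sigma>. D \<le> v \<longrightarrow> apex v \<or> rim_end v)"
      using e r by (intro disjI2 conjI ballI)
    show ?thesis by (intro conjI c1 c2 c3 c4)
  qed
  note c = this
  show "(\<forall>v\<in>\<sigma>. \<not> apex v) \<or> \<sigma> \<inter> {0<..<D} = {}"
    and "\<sigma> \<subseteq> {..<D} \<or> (\<exists>j<m. \<sigma> \<inter> {D..} \<subseteq> {a j..a j + N j})"
    and "\<exists>k. \<sigma> \<inter> {0<..<D} \<subseteq> {k, k + 1}"
    and "(\<exists>q. {v\<in>\<sigma>. D \<le> v \<and> \<not> apex v} \<subseteq> {q, q + 1}) \<or>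
         \<sigma> \<inter> {0<..<D} = {} \<and> (\<forall>v\<in>\<sigma>. D \<le> v \<longrightarrow> apex v \<or> rim_end v)"
    by (rule c[THEN conjunct1] c[THEN conjunct2, THEN conjunct1] c[THEN conjunct2, THEN conjunct2, THEN conjunct1]
        c[THEN conjunct2, THEN conjunct2, THEN conjunct2])+
qed

lemma linear_extension_components:
  fixes \<alpha> :: "nat \<Rightarrow> real"
  assumes "\<Union>L = {..<V}"
  defines "x \<equiv> linear_extension L (\<lambda>v. point_vector (pt v)) \<alpha>"
  shows "x $ 1 = (\<Sum>v<V. \<alpha> v * (if v < D then real v else if apex v \<or> rim_end v then 0 else 1))"
    and "x $ 2 = (\<Sum>v<V. \<alpha> v * (if v < D then (if v = 0 then 0 else -1) else if apex v then 1 else 0))"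
    and "x $ 3 = (\<Sum>v<V. \<alpha> v * (if v < D then 0 else real v))"
    and "x $ 4 = (\<Sum>v<V. \<alpha> v * (if v < D then 0 else 1))"
  unfolding x_def linear_extension_def assms(1)
  by (auto simp: pt_def vector_4 intro!: sum.cong)

text \<open>\<open>ca\<close>, \<open>ua\<close> and \<open>pa\<close> are the parts of a weight on
  the wedge without its base point, on the upper vertices and on the apices. They are recovered in
  the order \<open>pa\<close>, \<open>ua\<close>, \<open>ca\<close>: the third coordinate yields the
  moment of \<open>ua\<close> once that of \<open>pa\<close> is subtracted, and the first yields the
  moment of \<open>ca\<close> once \<open>inner\<close>, a function of \<open>ua\<close>, is
  subtracted.\<close>

lemma inj_linear_extension:
  assumes L: "\<Union>L = {..<V}" and shape: "\<And>\<sigma>. \<sigma> \<in> L \<Longrightarrow> simplex_shape \<sigma>"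
  shows "inj_on (linear_extension L (\<lambda>v. point_vector (pt v))) (geom_real L)"
proof (rule inj_onI)
  fix \<alpha> \<beta> :: "nat \<Rightarrow> real"
  assume \<alpha>: "\<alpha> \<in> geom_real L" and \<beta>: "\<beta> \<in> geom_real L"
    and eq: "linear_extension L (\<lambda>v. point_vector (pt v)) \<alpha> = linear_extension L (\<lambda>v. point_vector (pt v)) \<beta>"
  have apex_not_less: "\<not> v < D" if "apex v" for v
    using apex_ge[OF that] by simp
  have apex_not_0: "\<not> apex 0"
    using apex_not_less[of 0] D_pos by blast
  note comp = linear_extension_components[OF L]
  define ca where "ca \<gamma> v = (if 0 < v \<and> v < D then \<gamma> v else 0)" for \<gamma> :: "nat \<Rightarrow> real" and v
  define pa where "pa \<gamma> v = (if apex v then \<gamma> v else 0)" for \<gamma> :: "nat \<Rightarrow> real" and v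
  define ua where "ua \<gamma> v = (if D \<le> v \<and> \<not> apex v then \<gamma> v else 0)" for \<gamma> :: "nat \<Rightarrow> real" and v
  define inner where "inner \<gamma> = (\<Sum>v<V. ua \<gamma> v * (if rim_end v then 0 else 1))" for \<gamma>
  have nn: "0 \<le> \<gamma> v" if "\<gamma> \<in> geom_real L" for \<gamma> v
    using that by (auto simp: geom_real_def)
  then have nn_parts: "0 \<le> ca \<gamma> v" "0 \<le> pa \<gamma> v" "0 \<le> ua \<gamma> v" if "\<gamma> \<in> geom_real L" for \<gamma> v
    using that by (auto simp: ca_def pa_def ua_def)
  have supp: "{v. \<gamma> v \<noteq> 0} \<in> L" if "\<gamma> \<in> geom_real L" for \<gamma>
    using that by (auto simp: geom_real_def)
  have inV: "{v. \<gamma> v \<noteq> 0} \<subseteq> {..<V}" if "\<gamma> \<in> geom_real L" for \<gamma>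
    using supp[OF that] L by auto
  have inV_parts: "{v. ca \<gamma> v \<noteq> 0} \<subseteq> {..<V}" "{v. ua \<gamma> v \<noteq> 0} \<subseteq> {..<V}" "{v. pa \<gamma> v \<noteq> 0} \<subseteq> {..<V}"
    if "\<gamma> \<in> geom_real L" for \<gamma>
    using inV[OF that] by (auto simp: ca_def pa_def ua_def)
  have one: "sum \<gamma> {..<V} = 1" if "\<gamma> \<in> geom_real L" for \<gamma>
    using that L by (auto simp: geom_real_def)
  note sd = simplex_shapeD[OF shape[OF supp]]
  have "(\<Sum>v<V. \<gamma> v * (if v < D then 0 else 1)) = sum (ua \<gamma>) {..<V} + sum (pa \<gamma>) {..<V}" for \<gamma>
    unfolding sum.distrib[symmetric]
    by (rule sum.cong) (auto simp: ua_def pa_def apex_not_less apex_not_0)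
  then have T: "sum (ua \<alpha>) {..<V} + sum (pa \<alpha>) {..<V} = sum (ua \<beta>) {..<V} + sum (pa \<beta>) {..<V}"
    using comp(4) eq by metis
  have "(\<Sum>v<V. \<gamma> v * (if v < D then (if v = 0 then 0 else -1) else if apex v then 1 else 0))
      = sum (pa \<gamma>) {..<V} - sum (ca \<gamma>) {..<V}" for \<gamma>
    unfolding sum_subtractf[symmetric]
    by (rule sum.cong) (auto simp: ca_def pa_def apex_not_less apex_not_0)
  then have Z: "sum (pa \<alpha>) {..<V} - sum (ca \<alpha>) {..<V} = sum (pa \<beta>) {..<V} - sum (ca \<beta>) {..<V}"
    using comp(2) eq by metis
  have "(\<Sum>v<V. \<gamma> v * (if v < D then real v else if apex v \<or> rim_end v then 0 else 1))
      = (\<Sum>v<V. real v * ca \<gamma> v) + inner \<gamma>" for \<gamma>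
    unfolding inner_def sum.distrib[symmetric]
    by (rule sum.cong) (auto simp: ca_def ua_def)
  then have X: "(\<Sum>v<V. real v * ca \<alpha> v) + inner \<alpha> = (\<Sum>v<V. real v * ca \<beta> v) + inner \<beta>"
    using comp(1) eq by metis
  have Ysum: "(\<Sum>v<V. \<gamma> v * (if v < D then 0 else real v))
      = (\<Sum>v<V. real v * ua \<gamma> v) + (\<Sum>v<V. real v * pa \<gamma> v)" for \<gamma>
    unfolding sum.distrib[symmetric]
    by (rule sum.cong) (auto simp: ua_def pa_def apex_not_less apex_not_0)
  have Y0: "(\<Sum>v<V. \<alpha> v * (if v < D then 0 else real v)) = (\<Sum>v<V. \<beta> v * (if v < D then 0 else real v))"
    using comp(3) eq by metis
  then have Y: "(\<Sum>v<V. real v * ua \<alpha> v) + (\<Sum>v<V. real v * pa \<alpha> v)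
      = (\<Sum>v<V. real v * ua \<beta> v) + (\<Sum>v<V. real v * pa \<beta> v)"
    using Ysum by metis
  have T0: "(\<Sum>v<V. \<alpha> v * (if v < D then 0 else 1)) = (\<Sum>v<V. \<beta> v * (if v < D then 0 else (1::real)))"
    using comp(4) eq by metis
  have sums_nn: "0 \<le> sum (ca \<gamma>) {..<V}" "0 \<le> sum (pa \<gamma>) {..<V}" "0 \<le> sum (ua \<gamma>) {..<V}"
    if "\<gamma> \<in> geom_real L" for \<gamma>
    using nn_parts[OF that] by (auto intro: sum_nonneg)
  have excl: "sum (pa \<gamma>) {..<V} = 0 \<or> sum (ca \<gamma>) {..<V} = 0" if "\<gamma> \<in> geom_real L" for \<gamma>
    using sd(1)[OF that]
  proof
    assume "\<forall>v\<in>{v. \<gamma> v \<noteq> 0}. \<not> apex v"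
    then have "pa \<gamma> v = 0" for v by (auto simp: pa_def)
    then show ?thesis by simp
  next
    assume "{v. \<gamma> v \<noteq> 0} \<inter> {0<..<D} = {}"
    then have "ca \<gamma> v = 0" for v by (auto simp: ca_def)
    then show ?thesis by simp
  qed
  \<comment> \<open>By \<open>excl\<close>, the apex total and the wedge total are the positive and
    the negative part of the second coordinate.\<close>
  have C: "sum (ca \<alpha>) {..<V} = sum (ca \<beta>) {..<V}" and P: "sum (pa \<alpha>) {..<V} = sum (pa \<beta>) {..<V}"
    using excl[OF \<alpha>] excl[OF \<beta>] Z sums_nn[OF \<alpha>] sums_nn[OF \<beta>] by auto
  with T have U: "sum (ua \<alpha>) {..<V} = sum (ua \<beta>) {..<V}" by simp
  have zero: "f v = 0" if "sum f {..<V} = 0" "\<And>v. 0 \<le> f v" "{v. f v \<noteq> 0} \<subseteq> {..<V}"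
    for f :: "nat \<Rightarrow> real" and v
    using that sum_nonneg_eq_0_iff[of "{..<V}" f] by auto
  have ca_unique: "ca \<alpha> = ca \<beta>" if "(\<Sum>v<V. real v * ca \<alpha> v) = (\<Sum>v<V. real v * ca \<beta> v)"
  proof -
    obtain k l where "{v. \<alpha> v \<noteq> 0} \<inter> {0<..<D} \<subseteq> {k, k + 1}" "{v. \<beta> v \<noteq> 0} \<inter> {0<..<D} \<subseteq> {l, l + 1}"
      using sd(3)[OF \<alpha>] sd(3)[OF \<beta>] by blast
    then have "{v. ca \<alpha> v \<noteq> 0} \<subseteq> {k, k + 1}" "{v. ca \<beta> v \<noteq> 0} \<subseteq> {l, l + 1}"
      by (auto simp: ca_def)
    then show ?thesis
      using consecutive_points_determined[OF _ inV_parts(1)[OF \<alpha>] _ inV_parts(1)[OF \<beta>] _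
          nn_parts(1)[OF \<alpha>] nn_parts(1)[OF \<beta>] C that] by blast
  qed
  have ua_unique: "ua \<alpha> = ua \<beta>"
    if "{v. ua \<alpha> v \<noteq> 0} \<subseteq> {k, k + 1}" "{v. ua \<beta> v \<noteq> 0} \<subseteq> {l, l + 1}"
      and "(\<Sum>v<V. real v * ua \<alpha> v) = (\<Sum>v<V. real v * ua \<beta> v)" for k l
    using consecutive_points_determined[OF _ inV_parts(2)[OF \<alpha>] that(1) inV_parts(2)[OF \<beta>] that(2)
          nn_parts(3)[OF \<alpha>] nn_parts(3)[OF \<beta>] U that(3)] by blast
  have "ca \<alpha> = ca \<beta> \<and> ua \<alpha> = ua \<beta> \<and> pa \<alpha> = pa \<beta>"
  proof (cases "sum (ua \<alpha>) {..<V} + sum (pa \<alpha>) {..<V} = 0")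
    case True
    then have "sum (ua \<alpha>) {..<V} = 0" "sum (pa \<alpha>) {..<V} = 0" using sums_nn[OF \<alpha>] by auto
    then have "ua \<alpha> v = 0" "ua \<beta> v = 0" "pa \<alpha> v = 0" "pa \<beta> v = 0" for v
      using zero nn_parts inV_parts \<alpha> \<beta> U P by metis+
    then have z: "ua \<alpha> = ua \<beta>" "pa \<alpha> = pa \<beta>" by auto
    then have "ca \<alpha> = ca \<beta>" using X by (intro ca_unique) (simp add: inner_def)
    with z show ?thesis by simp
  next
    case False
    let ?W = "sum (ua \<alpha>) {..<V} + sum (pa \<alpha>) {..<V}"
    have W_pos: "0 < ?W" using False sums_nn[OF \<alpha>] by linarith
    have W_eq: "(\<Sum>v<V. \<gamma> v * (if v < D then 0 else 1)) = ?W" if "\<gamma> = \<alpha> \<or> \<gamma> = \<beta>" for \<gamma>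
      using that T0 \<open>\<And>\<gamma>. (\<Sum>v<V. \<gamma> v * (if v < D then 0 else 1)) = sum (ua \<gamma>) {..<V} + sum (pa \<gamma>) {..<V}\<close>
      by metis
    have ex_j: "\<exists>j. {v. \<gamma> v \<noteq> 0} \<inter> {D..} \<subseteq> {a j..a j + N j}" if "\<gamma> = \<alpha> \<or> \<gamma> = \<beta>" for \<gamma>
    proof (rule ccontr)
      assume "\<not> ?thesis"
      then have "{v. \<gamma> v \<noteq> 0} \<subseteq> {..<D}" using sd(2)[of \<gamma>] that \<alpha> \<beta> by blast
      then have "(\<Sum>v<V. \<gamma> v * (if v < D then 0 else 1)) = 0" by (intro sum.neutral) auto
      then show False using W_eq[OF that] W_pos by simp
    qed
    \<comment> \<open>The third coordinate divided by the fourth is a weighted mean of labels of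
      block \<open>j\<close>, hence lies within that block. Since blocks are disjoint intervals, it
      identifies \<open>j\<close>.\<close>
    have mom: "real (a j) * ?W \<le> (\<Sum>v<V. \<gamma> v * (if v < D then 0 else real v))"
      "(\<Sum>v<V. \<gamma> v * (if v < D then 0 else real v)) \<le> real (a j + N j) * ?W"
      if "\<gamma> = \<alpha> \<or> \<gamma> = \<beta>" "{v. \<gamma> v \<noteq> 0} \<inter> {D..} \<subseteq> {a j..a j + N j}" for \<gamma> j
    proof -
      have b: "\<gamma> v = 0 \<or> v < D \<or> (a j \<le> v \<and> v \<le> a j + N j)" for v using that(2) by fastforce
      have g0: "0 \<le> \<gamma> v" for v using that(1) nn \<alpha> \<beta> by blast
      have "real (a j) * (\<gamma> v * (if v < D then 0 else 1)) \<le> \<gamma> v * (if v < D then 0 else real v)"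
        "\<gamma> v * (if v < D then 0 else real v) \<le> real (a j + N j) * (\<gamma> v * (if v < D then 0 else 1))" for v
      proof -
        consider "\<gamma> v = 0" | "v < D" | "\<not> v < D" "a j \<le> v" "v \<le> a j + N j" using b[of v] by blast
        then have "real (a j) * (\<gamma> v * (if v < D then 0 else 1)) \<le> \<gamma> v * (if v < D then 0 else real v) \<and>
          \<gamma> v * (if v < D then 0 else real v) \<le> real (a j + N j) * (\<gamma> v * (if v < D then 0 else 1))"
        proof cases
          case 3
          then show ?thesis
            using mult_right_mono[OF _ g0[of v], of "real (a j)" "real v"]
              mult_right_mono[OF _ g0[of v], of "real v" "real (a j + N j)"]
            by (simp only: if_False mult_1_right mult.commute[of "\<gamma> v"] of_nat_le_iff)
        qed auto
        then show "real (a j) * (\<gamma> v * (if v < D then 0 else 1)) \<le> \<gamma> v * (if v < D then 0 else real v)"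
          "\<gamma> v * (if v < D then 0 else real v) \<le> real (a j + N j) * (\<gamma> v * (if v < D then 0 else 1))"
          by blast+
      qed
      then show "real (a j) * ?W \<le> (\<Sum>v<V. \<gamma> v * (if v < D then 0 else real v))"
        "(\<Sum>v<V. \<gamma> v * (if v < D then 0 else real v)) \<le> real (a j + N j) * ?W"
        unfolding W_eq[OF that(1), symmetric] sum_distrib_left by (auto intro!: sum_mono)
    qed
    obtain j where j: "{v. \<alpha> v \<noteq> 0} \<inter> {D..} \<subseteq> {a j..a j + N j}"
      using ex_j[OF disjI1[OF refl]] ..
    obtain i where i: "{v. \<beta> v \<noteq> 0} \<inter> {D..} \<subseteq> {a i..a i + N i}"
      using ex_j[OF disjI2[OF refl]] ..
    have le: "k \<le> l" if "real (a k) * ?W \<le> real (a l + N l) * ?W" for k l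
    proof (rule ccontr)
      assume "\<not> ?thesis"
      then have "a l + N l < a k" using a_less by simp
      then have "real (a l + N l) * ?W < real (a k) * ?W"
        using W_pos by (intro mult_strict_right_mono) linarith+
      with that show False by simp
    qed
    have "j \<le> i" "i \<le> j"
      using mom[OF disjI1[OF refl] j] mom[OF disjI2[OF refl] i] Y0 by (intro le, linarith)+
    then have ij: "i = j" by simp
    \<comment> \<open>A block contains a single apex, so the total apex weight determines
      \<open>pa\<close>.\<close>
    have pa0: "pa \<gamma> v = (if v = a j then sum (pa \<gamma>) {..<V} else 0)"
      if "\<gamma> \<in> geom_real L" "{v. \<gamma> v \<noteq> 0} \<inter> {D..} \<subseteq> {a j..a j + N j}" for \<gamma> v
    proof -
      have z: "pa \<gamma> v = 0" if "v \<noteq> a j" for v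
      proof (rule ccontr)
        assume "pa \<gamma> v \<noteq> 0"
        then have ap: "apex v" "\<gamma> v \<noteq> 0" by (auto simp: pa_def split: if_splits)
        with apex_ge have "v \<in> {v. \<gamma> v \<noteq> 0} \<inter> {D..}" by auto
        with \<open>{v. \<gamma> v \<noteq> 0} \<inter> {D..} \<subseteq> {a j..a j + N j}\<close> have "a j \<le> v \<and> v \<le> a j + N j" by auto
        with apex_in_interval ap that show False by blast
      qed
      have "sum (pa \<gamma>) {..<V} = sum (pa \<gamma>) ({..<V} \<union> {a j})"
        using inV_parts(3)[OF that(1)] by (intro sum.mono_neutral_left) auto
      also have "\<dots> = sum (pa \<gamma>) {a j}"
        using z by (intro sum.mono_neutral_right) auto
      finally show ?thesis using z by simp
    qed
    have pa: "pa \<alpha> = pa \<beta>"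
      using pa0[OF \<alpha> j] pa0[OF \<beta> i[unfolded ij]] P by (intro ext) simp
    with Y have MU: "(\<Sum>v<V. real v * ua \<alpha> v) = (\<Sum>v<V. real v * ua \<beta> v)" by simp
    have ua_cases: "(\<exists>q. {v. ua \<gamma> v \<noteq> 0} \<subseteq> {q, q + 1}) \<or> sum (ca \<gamma>) {..<V} = 0 \<and> inner \<gamma> = 0"
      if "\<gamma> \<in> geom_real L" for \<gamma>
      using sd(4)[OF that]
    proof
      assume "\<exists>q. {v \<in> {v. \<gamma> v \<noteq> 0}. D \<le> v \<and> \<not> apex v} \<subseteq> {q, q + 1}"
      then obtain q where "{v \<in> {v. \<gamma> v \<noteq> 0}. D \<le> v \<and> \<not> apex v} \<subseteq> {q, q + 1}" ..
      then have "{v. ua \<gamma> v \<noteq> 0} \<subseteq> {q, q + 1}" by (auto simp: ua_def)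
      then show ?thesis by blast
    next
      assume as: "{v. \<gamma> v \<noteq> 0} \<inter> {0<..<D} = {} \<and> (\<forall>v\<in>{v. \<gamma> v \<noteq> 0}. D \<le> v \<longrightarrow> apex v \<or> rim_end v)"
      then have "ca \<gamma> v = 0" "ua \<gamma> v * (if rim_end v then 0 else 1) = 0" for v
        by (auto simp: ca_def ua_def)
      note z = this
      show ?thesis unfolding inner_def by (intro disjI2 conjI sum.neutral ballI z)
    qed
    \<comment> \<open>The case condition can be read from the coordinates: the wedge total is known,
      and when it vanishes the first coordinate equals \<open>inner\<close>. Hence both points fall
      into the same case, and either each has two consecutive upper labels or both live on the two
      ends of the cycle.\<close>
    have ua: "ua \<alpha> = ua \<beta>"
    proof (cases "sum (ca \<alpha>) {..<V} = 0 \<and> inner \<alpha> = 0")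
      case False
      have "inner \<alpha> = inner \<beta>" if "sum (ca \<alpha>) {..<V} = 0"
      proof -
        have "ca \<alpha> v = 0" "ca \<beta> v = 0" for v
          using zero nn_parts(1) inV_parts(1) \<alpha> \<beta> C that by metis+
        then show ?thesis using X by simp
      qed
      with False C have "\<not> (sum (ca \<beta>) {..<V} = 0 \<and> inner \<beta> = 0)" by auto
      with False ua_cases[OF \<alpha>] ua_cases[OF \<beta>] show ?thesis using ua_unique MU by blast
    next
      case True
      then have "ca \<alpha> v = 0" "ca \<beta> v = 0" for v
        using zero nn_parts(1) inV_parts(1) \<alpha> \<beta> C by metis+
      with X True have inner: "inner \<gamma> = 0" if "\<gamma> = \<alpha> \<or> \<gamma> = \<beta>" for \<gamma> using that by auto
      have "{v. ua \<gamma> v \<noteq> 0} \<subseteq> {a j + 1, a j + N j}"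
        if g: "\<gamma> = \<alpha> \<or> \<gamma> = \<beta>" "{v. \<gamma> v \<noteq> 0} \<inter> {D..} \<subseteq> {a j..a j + N j}" for \<gamma>
      proof
        fix v assume "v \<in> {v. ua \<gamma> v \<noteq> 0}"
        then have v: "ua \<gamma> v \<noteq> 0" "D \<le> v" "\<gamma> v \<noteq> 0" by (auto simp: ua_def split: if_splits)
        have "ua \<gamma> v * (if rim_end v then 0 else 1) = 0"
        proof (rule zero)
          show "(\<Sum>v<V. ua \<gamma> v * (if rim_end v then 0 else 1)) = 0" using inner[OF g(1)] inner_def by simp
          show "0 \<le> ua \<gamma> v * (if rim_end v then 0 else 1)" for v using g(1) nn_parts(3) \<alpha> \<beta> by auto
          show "{v. ua \<gamma> v * (if rim_end v then 0 else 1) \<noteq> 0} \<subseteq> {..<V}"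
            using g(1) inV_parts(2) \<alpha> \<beta> by auto
        qed
        then have "rim_end v" using v by (auto split: if_splits)
        moreover have "a j \<le> v \<and> v \<le> a j + N j" using v g(2) by auto
        ultimately show "v \<in> {a j + 1, a j + N j}" using rim_end_in_interval by auto
      qed
      then have "{v. ua \<alpha> v \<noteq> 0} \<subseteq> {a j + 1, a j + N j}" "{v. ua \<beta> v \<noteq> 0} \<subseteq> {a j + 1, a j + N j}"
        using j i ij by blast+
      moreover have "a j + 1 \<noteq> a j + N j" using N_ge_3[of j] by simp
      ultimately show ?thesis
        using two_points_determined[OF _ inV_parts(2)[OF \<alpha>] _ inV_parts(2)[OF \<beta>] _ _ U MU] by blast
    qed
    then have "ca \<alpha> = ca \<beta>" using X by (intro ca_unique) (simp add: inner_def)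
    with ua pa show ?thesis by simp
  qed
  then have parts: "ca \<alpha> = ca \<beta>" "ua \<alpha> = ua \<beta>" "pa \<alpha> = pa \<beta>" by auto
  have pos: "\<alpha> v = \<beta> v" if "v \<noteq> 0" for v
  proof -
    have "\<gamma> v = ca \<gamma> v + ua \<gamma> v + pa \<gamma> v" for \<gamma> :: "nat \<Rightarrow> real"
      using that apex_ge[of v] by (auto simp: ca_def ua_def pa_def)
    then show ?thesis using parts by metis
  qed
  \<comment> \<open>No coordinate sees the weight of the origin; it is what the other weights leave
    of the total 1.\<close>
  have "\<alpha> 0 = \<beta> 0"
  proof (cases "0 < V")
    case True
    then have "sum \<gamma> {..<V} = \<gamma> 0 + sum \<gamma> ({..<V} - {0})" for \<gamma> :: "nat \<Rightarrow> real"
      by (intro sum.remove) auto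
    moreover have "sum \<alpha> ({..<V} - {0}) = sum \<beta> ({..<V} - {0})"
      using pos by (intro sum.cong) auto
    ultimately show ?thesis using one[OF \<alpha>] one[OF \<beta>] by (metis add_right_imp_eq)
  next
    case False
    then show ?thesis using one[OF \<alpha>] by simp
  qed
  with pos show "\<alpha> = \<beta>" by (metis ext)
qed

end

section \<open>Weakest preconditions\<close>

text \<open>Total correctness with a clock: the postcondition receives the exact number of steps, so
  times compose by shifting its argument, as in \<open>wp_Seq\<close>.\<close>

definition wp :: "int \<Rightarrow> prog \<Rightarrow> (nat \<Rightarrow> ram \<Rightarrow> bool) \<Rightarrow> ram \<Rightarrow> bool" where
  "wp w p Q s \<longleftrightarrow> (\<exists>t s'. exec w p s t s' \<and> Q t s')"

lemma wp_mono: "wp w p Q s \<Longrightarrow> (\<And>t s'. Q t s' \<Longrightarrow> R t s') \<Longrightarrow> wp w p R s"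
  unfolding wp_def by blast

lemma wp_Const [simp]: "wp w (Const x k) Q s \<longleftrightarrow> \<bar>k\<bar> \<le> w \<and> Q 1 (set_reg x k s)"
  unfolding wp_def by (auto intro: exec.Const[simplified] elim!: ConstE)

lemma wp_Add [simp]:
  "wp w (Add x y z) Q s \<longleftrightarrow> \<bar>reg s y + reg s z\<bar> \<le> w \<and> Q 1 (set_reg x (reg s y + reg s z) s)"
  unfolding wp_def by (auto intro: exec.Add[simplified] elim!: AddE)

lemma wp_Sub [simp]:
  "wp w (Sub x y z) Q s \<longleftrightarrow> \<bar>reg s y - reg s z\<bar> \<le> w \<and> Q 1 (set_reg x (reg s y - reg s z) s)"
  unfolding wp_def by (auto intro: exec.Sub[simplified] elim!: SubE)

lemma wp_Load [simp]:
  "wp w (Load x y) Q s \<longleftrightarrow> \<bar>mem s (reg s y)\<bar> \<le> w \<and> Q 1 (set_reg x (mem s (reg s y)) s)"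
  unfolding wp_def by (auto intro: exec.Load[simplified] elim!: LoadE)

lemma wp_Write [simp]: "wp w (Write x) Q s \<longleftrightarrow> Q 1 (s\<lparr>tape := tape s @ [reg s x]\<rparr>)"
  unfolding wp_def by (auto intro: exec.Write[simplified] elim!: WriteE)

lemma wp_Seq [simp]:
  "wp w (Seq p q) Q s \<longleftrightarrow> wp w p (\<lambda>t s'. wp w q (\<lambda>t'. Q (t + t')) s') s"
  unfolding wp_def by (blast intro: exec.Seq elim!: SeqE)

lemma wp_IfPos [simp]:
  "wp w (IfPos x p q) Q s \<longleftrightarrow>
     (reg s x > 0 \<longrightarrow> wp w p (\<lambda>t. Q (t + 1)) s) \<and>
     (\<not> reg s x > 0 \<longrightarrow> wp w q (\<lambda>t. Q (t + 1)) s)"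
  unfolding wp_def
  by (cases "reg s x > 0") (auto intro: exec.IfTrue[simplified] exec.IfFalse[simplified] elim!: IfE)

text \<open>\<open>I l\<close> holds after \<open>l\<close> rounds and \<open>k\<close> is their
  exact number, which also proves termination. Every round pays 1 for its test, and the last 1 is
  the test that fails.\<close>

lemma wp_WhilePos:
  assumes "I 0 s"
    and "\<And>l s. l < k \<Longrightarrow> I l s \<Longrightarrow> reg s x > 0 \<and> wp w p (\<lambda>t s'. t \<le> T l \<and> I (Suc l) s') s"
    and "\<And>s. I k s \<Longrightarrow> \<not> reg s x > 0"
    and "\<And>t s'. t \<le> (\<Sum>l<k. T l + 1) + 1 \<Longrightarrow> I k s' \<Longrightarrow> Q t s'"
  shows "wp w (WhilePos x p) Q s"
proof -
  have "\<exists>t s'. exec w (WhilePos x p) s t s' \<and> t \<le> (\<Sum>l\<in>{j..<k}. T l + 1) + 1 \<and> I k s'"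
    if "j \<le> k" "I j s" for j s
    using that
  proof (induction arbitrary: s rule: inc_induct)
    case base
    then show ?case using exec.WhileFalse[OF assms(3)[OF base]] by fastforce
  next
    case (step l)
    obtain t s' where e: "exec w p s t s'" "t \<le> T l" "I (Suc l) s'" and x: "reg s x > 0"
      using assms(2)[OF step.hyps(2) step.prems] by (auto simp: wp_def)
    obtain t' s'' where e': "exec w (WhilePos x p) s' t' s''" "I k s''"
      and t': "t' \<le> (\<Sum>l\<in>{Suc l..<k}. T l + 1) + 1"
      using step.IH[OF e(3)] by blast
    have "t + t' + 1 \<le> (\<Sum>l\<in>{l..<k}. T l + 1) + 1"
      using e(2) t' step.hyps(2) by (simp add: sum.atLeast_Suc_lessThan)
    with exec.WhileTrue[OF x e(1) e'(1)] e'(2) show ?case by blast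
  qed
  from this[of 0 s] assms(1,4) show ?thesis
    unfolding wp_def by (metis atLeast0LessThan zero_le)
qed

text \<open>The language has no idle instruction; clearing register 19 takes its place.\<close>

fun blk :: "prog list \<Rightarrow> prog" where
  "blk [] = Const 19 0"
| "blk [p] = p"
| "blk (p # q # ps) = Seq p (blk (q # ps))"

lemma wp_blk_Cons:
  "wp w p (\<lambda>t s'. wp w (blk (q # ps)) (\<lambda>t'. Q (t + t')) s') s \<Longrightarrow> wp w (blk (p # q # ps)) Q s"
  by simp

lemma wp_blk_single: "wp w p Q s \<Longrightarrow> wp w (blk [p]) Q s"
  by simp

text \<open>Repetition fixed when the program is built, with a body that may depend on the round. It
  stands in for multiplication by constants such as \<open>c\<close> and takes no counter at run
  time.\<close>

primrec unroll :: "(nat \<Rightarrow> prog) \<Rightarrow> nat \<Rightarrow> prog" where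
  "unroll f 0 = Const 19 0"
| "unroll f (Suc k) = Seq (unroll f k) (f k)"

text \<open>The unrolled code starts by clearing register 19. This is the extra step in the time
  bound, and the reason why \<open>I 0\<close> is required of the state after it.\<close>

lemma wp_unroll:
  assumes "0 \<le> w" "I 0 (set_reg 19 0 s)"
    and "\<And>l s. l < k \<Longrightarrow> I l s \<Longrightarrow> wp w (f l) (\<lambda>t s'. t \<le> T \<and> I (Suc l) s') s"
    and "\<And>t s'. t \<le> k * T + 1 \<Longrightarrow> I k s' \<Longrightarrow> Q t s'"
  shows "wp w (unroll f k) Q s"
proof -
  have "wp w (unroll f j) (\<lambda>t s'. t \<le> j * T + 1 \<and> I j s') s" if "j \<le> k" for j
    using that
  proof (induction j)
    case 0
    then show ?case using assms(1,2) by simp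
  next
    case (Suc j)
    then have "wp w (unroll f j) (\<lambda>t s'. t \<le> j * T + 1 \<and> I j s') s" by simp
    then show ?case
      unfolding unroll.simps wp_Seq
    proof (rule wp_mono)
      fix t s' assume "t \<le> j * T + 1 \<and> I j s'"
      then show "wp w (f j) (\<lambda>t' s'. t + t' \<le> Suc j * T + 1 \<and> I (Suc j) s') s'"
        using assms(3)[of j s'] Suc.prems by (auto elim!: wp_mono)
    qed
  qed
  from this[of k] show ?thesis using assms(4) by (auto elim: wp_mono)
qed

text \<open>A step writes at most one number; the lower bound on the running time rests on
  this.\<close>

lemma tape_length_le_time: "exec w p s t s' \<Longrightarrow> length (tape s') \<le> length (tape s) + t"
  by (induction rule: exec.induct) (auto simp: set_reg_def)

lemma reg_set_reg [simp]: "reg (set_reg x v s) = (reg s)(x := v)"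
  and mem_set_reg [simp]: "mem (set_reg x v s) = mem s"
  and tape_set_reg [simp]: "tape (set_reg x v s) = tape s"
  by (simp_all add: set_reg_def)

section \<open>Output of a cell together with its faces\<close>

text \<open>Each cell is output with all its faces, even those shared with other cells:
  \<open>realizes\<close> regards only the set of vertex sets, so repetitions do no harm and nothing
  has to be looked up.\<close>

definition faces :: "'a list \<Rightarrow> 'a list list" where
  "faces xs = filter (\<lambda>ys. ys \<noteq> []) (subseqs xs)"

definition cells_code :: "int list list \<Rightarrow> int list" where
  "cells_code gs = concat (map (\<lambda>\<sigma>. int (length \<sigma>) # \<sigma>) (concat (map faces gs)))"

lemma cells_code_append: "cells_code (gs @ hs) = cells_code gs @ cells_code hs"
  by (simp add: cells_code_def)

lemma cells_code_Nil [simp]: "cells_code [] = []"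
  by (simp add: cells_code_def)

text \<open>Register 0 carries the length marks, so it cannot hold a vertex. A face with
  \<open>k\<close> vertices takes \<open>k + 2\<close> steps, which makes 3, 10 and 26 steps for
  cells with one, two and three vertices. The last face is a single vertex, which leaves 1 in
  register 0.\<close>

definition emit :: "nat list \<Rightarrow> prog" where
  "emit xs = blk (map (\<lambda>ys. blk (Const 0 (int (length ys)) # Write 0 # map Write ys)) (faces xs))"

lemma wp_emit1:
  assumes "3 \<le> w" "x \<noteq> 0"
    and "\<And>s'. reg s' = (reg s)(0 := 1) \<Longrightarrow> mem s' = mem s \<Longrightarrow>
       tape s' = tape s @ cells_code [[reg s x]] \<Longrightarrow> Q 3 s'"
  shows "wp w (emit [x]) Q s"
proof -
  have "wp w (emit [x]) (\<lambda>t s'. t = 3 \<and> reg s' = (reg s)(0 := 1) \<and> mem s' = mem s \<and>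
       tape s' = tape s @ cells_code [[reg s x]]) s"
    using assms(1,2) by (simp add: emit_def faces_def cells_code_def)
  then show ?thesis using assms(3) by (auto elim: wp_mono)
qed

lemma wp_emit2:
  assumes "3 \<le> w" "x \<noteq> 0" "y \<noteq> 0"
    and "\<And>s'. reg s' = (reg s)(0 := 1) \<Longrightarrow> mem s' = mem s \<Longrightarrow>
       tape s' = tape s @ cells_code [[reg s x, reg s y]] \<Longrightarrow> Q 10 s'"
  shows "wp w (emit [x, y]) Q s"
proof -
  have "wp w (emit [x, y]) (\<lambda>t s'. t = 10 \<and> reg s' = (reg s)(0 := 1) \<and> mem s' = mem s \<and>
       tape s' = tape s @ cells_code [[reg s x, reg s y]]) s"
    using assms(1-3) by (simp add: emit_def faces_def cells_code_def)
  then show ?thesis using assms(4) by (auto elim: wp_mono)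
qed

lemma wp_emit3:
  assumes "3 \<le> w" "x \<noteq> 0" "y \<noteq> 0" "z \<noteq> 0"
    and "\<And>s'. reg s' = (reg s)(0 := 1) \<Longrightarrow> mem s' = mem s \<Longrightarrow>
       tape s' = tape s @ cells_code [[reg s x, reg s y, reg s z]] \<Longrightarrow> Q 26 s'"
  shows "wp w (emit [x, y, z]) Q s"
proof -
  have "wp w (emit [x, y, z]) (\<lambda>t s'. t = 26 \<and> reg s' = (reg s)(0 := 1) \<and> mem s' = mem s \<and>
       tape s' = tape s @ cells_code [[reg s x, reg s y, reg s z]]) s"
    using assms(1-4) by (simp add: emit_def faces_def cells_code_def)
  then show ?thesis using assms(5) by (auto elim: wp_mono)
qed

section \<open>The algorithm\<close>

text \<open>Registers 1, 2 and 18 hold the constants 0, 1 and -1, registers 3 and 4 the numbers of generators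
  and relations; 5 is the number of the current vertex, 6 counts circles or relations, 7 points
  to the input, 8 is the length of the current relation, and 19 is never read.\<close>

definition write_point :: "nat \<Rightarrow> nat \<Rightarrow> nat \<Rightarrow> nat \<Rightarrow> prog" where
  "write_point x y z t = blk [Write 1, Write x, Write y, Write z, Write t, Add 5 5 2]"

text \<open>Registers start at 0, so register 1 already contains the address of the first input
  cell; register 2, just set to 1, gives the address of the second.\<close>

definition init_prog :: prog where
  "init_prog = blk [Const 2 1, Const 18 (-1), Load 3 1, Load 4 2, write_point 1 1 1 1]"

definition circle_points_prog :: "nat \<Rightarrow> prog" where
  "circle_points_prog c = blk [unroll (\<lambda>_. Add 6 6 3) (c - 1),
     WhilePos 6 (blk [write_point 5 18 1 1, Sub 6 6 2])]"

text \<open>Register 9 starts at -2 because the first and the last vertex of the cycle, whose first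
  coordinate is 0, are written outside the loop. The conditional gives an empty relation the length
  1.\<close>

definition relation_points_prog :: "nat \<Rightarrow> prog" where
  "relation_points_prog c = blk [
     blk [Load 8 7, write_point 1 2 5 2, write_point 1 1 5 2,
       IfPos 8 (Add 12 8 1) (Add 12 2 1), Const 9 (-2)],
     unroll (\<lambda>_. Add 9 9 12) c,
     WhilePos 9 (blk [write_point 2 1 5 2, Sub 9 9 2]),
     blk [write_point 1 1 5 2, Add 7 7 8, Add 7 7 2, Sub 6 6 2]]"

definition points_prog :: "nat \<Rightarrow> prog" where
  "points_prog c = blk [init_prog, circle_points_prog c, blk [Const 7 2, Add 6 4 1],
     WhilePos 6 (relation_points_prog c)]"

text \<open>Registers 10 and 11 hold two successive vertices of an edge loop in the wedge that goes around a
  circle once; its vertices other than the base point form the arithmetic progression with first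
  term in register 12 and difference in register 13.\<close>

definition advance :: "nat \<Rightarrow> nat \<Rightarrow> prog" where
  "advance c l = Seq (Add 10 11 1)
     (if Suc l = c then Const 11 0 else if l = 0 then Add 11 12 1 else Add 11 10 13)"

definition circle_prog :: "nat \<Rightarrow> prog" where
  "circle_prog c = blk [Add 12 5 2, unroll (\<lambda>l. blk [advance c l, emit [10, 11]]) c,
     unroll (\<lambda>_. Add 5 5 2) (c - 1), Sub 6 6 2]"

definition wedge_prog :: "nat \<Rightarrow> prog" where
  "wedge_prog c = blk [blk [emit [1], Const 5 0, Const 11 0, Const 13 1, Add 6 3 1],
     WhilePos 6 (circle_prog c)]"

text \<open>Once the offset in its code is removed, a letter leaves \<open>i\<close> or
  \<open>-i\<close> in register 0, and \<open>i * (c - 1)\<close> arises by repeated addition or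
  subtraction. \<open>Gen i\<close> starts at the first inner vertex of its circle and ascends,
  \<open>Inv i\<close> starts at the last one and descends. First term and difference 0 describe the
  constant path of an empty relation.\<close>

definition decode_prog :: "nat \<Rightarrow> prog" where
  "decode_prog c = IfPos 8
     (blk [Load 0 7, Add 7 7 2,
        IfPos 0
          (blk [blk [Sub 0 0 2, Const 12 1, Const 13 1], unroll (\<lambda>_. Add 12 12 0) (c - 1)])
          (blk [blk [Add 0 0 2, Const 12 (int c - 1), Const 13 (-1)], unroll (\<lambda>_. Sub 12 12 0) (c - 1)])])
     (blk [Const 12 0, Const 13 0])"

text \<open>Registers 14, 15 and 16 hold two successive upper vertices and the apex, and 17 the number of
  rectangles left, which tells when the second upper vertex is again the first one of the cycle.\<close>

definition rectangle_prog :: "nat \<Rightarrow> nat \<Rightarrow> prog" where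
  "rectangle_prog c l = blk [advance c l, blk [Sub 17 17 2, IfPos 17 (Add 15 14 2) (Add 15 16 2)],
     IfPos 8 (emit [10, 11, 14]) (Const 19 0), blk [emit [11, 14, 15], emit [14, 15, 16], Add 14 14 2]]"

definition letter_prog :: "nat \<Rightarrow> prog" where
  "letter_prog c = blk [decode_prog c, unroll (rectangle_prog c) c, Sub 9 9 2]"

text \<open>For an empty relation the loop still runs once, with 0 in register 8: no letter is read,
  and the lower path stays at the wedge point for \<open>c\<close> degenerate rectangles.\<close>

definition relation_prog :: "nat \<Rightarrow> prog" where
  "relation_prog c = blk [
     blk [Load 8 7, Add 7 7 2, IfPos 8 (Add 9 8 1) (Add 9 2 1), Const 17 0],
     unroll (\<lambda>_. Add 17 17 9) c, blk [Add 14 16 2, Const 11 0],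
     WhilePos 9 (letter_prog c), blk [Add 16 14 1, Sub 6 6 2]]"

text \<open>In the output all points precede all simplices, so the relations are scanned twice.
  After the wedge, register 5 holds the label of its last vertex, and the next label is the first
  apex.\<close>

definition complex_prog :: "nat \<Rightarrow> prog" where
  "complex_prog c = blk [points_prog c, wedge_prog c, blk [Add 16 5 2, Const 7 2, Add 6 4 1],
     WhilePos 6 (relation_prog c)]"

section \<open>The vertices of the model complex as numbers\<close>

locale pres_layout =
  fixes c :: nat and P :: pres
  assumes c_ge_3: "3 \<le> c" and pres: "presentation P"
begin

definition n where "n = ngens P"
definition m where "m = length (rels P)"
definition r where "r j = rels P ! j"
definition rl where "rl j = rel_length (r j)"
definition N where "N j = c * rl j"
definition K where "K = n * (c - 1)"
definition D where "D = 1 + K"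
definition a where "a j = D + (\<Sum>i<j. N i + 1)"
text \<open>Address of the length entry of relation \<open>j\<close> in the input; the first two
  cells hold the numbers of generators and relations.\<close>

definition ptr where "ptr j = 2 + (\<Sum>i<j. length (r i) + 1)"

lemma rl_pos: "1 \<le> rl j"
  by (simp add: rl_def rel_length_def)

lemma N_ge: "3 \<le> N j"
  using mult_le_mono[OF c_ge_3 rl_pos[of j]] by (simp add: N_def)

sublocale layout m D a N
  by unfold_locales (use N_ge in \<open>auto simp: a_def D_def\<close>)

fun index :: "vertex \<Rightarrow> nat" where
  "index Base = 0"
| "index (Circ i l) = i * (c - 1) + l"
| "index (Apex j) = a j"
| "index (Upper j l) = a j + 1 + l"

lemma ptr_0: "ptr 0 = 2" and ptr_Suc: "ptr (Suc j) = ptr j + length (r j) + 1"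
  by (simp_all add: ptr_def)

lemma ptr_mono: "i \<le> j \<Longrightarrow> ptr i \<le> ptr j"
  by (auto simp: ptr_def intro!: sum_mono2)

lemma size_eq: "unary_size P = n + (\<Sum>j<m. rl j)"
  by (simp add: unary_size_def n_def m_def rl_def r_def sum_list_sum_nth atLeast0LessThan)

definition M :: "int \<Rightarrow> int" where
  "M = mem (initial_ram (presentation_code P))"

lemma nth_concat:
  assumes "j < length xss" "k < length (xss ! j)"
  shows "concat xss ! ((\<Sum>i<j. length (xss ! i)) + k) = xss ! j ! k"
    and "(\<Sum>i<j. length (xss ! i)) + k < length (concat xss)"
  using assms
proof (induction xss arbitrary: j)
  case (Cons xs xss)
  {
    case 1
    show ?case
    proof (cases j)
      case (Suc i)
      then have "(\<Sum>i<j. length ((xs # xss) ! i)) = length xs + (\<Sum>i<i. length (xss ! i))"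
        by (simp add: sum.lessThan_Suc_shift del: sum.lessThan_Suc)
      then show ?thesis using Suc Cons.IH(1)[of i] 1 by (simp add: nth_append add.assoc)
    qed (use 1 in \<open>simp add: nth_append\<close>)
  next
    case 2
    show ?case
    proof (cases j)
      case (Suc i)
      then have "(\<Sum>i<j. length ((xs # xss) ! i)) = length xs + (\<Sum>i<i. length (xss ! i))"
        by (simp add: sum.lessThan_Suc_shift del: sum.lessThan_Suc)
      then show ?thesis using Suc Cons.IH(2)[of i] 2 by simp
    qed (use 2 in simp)
  }
qed simp_all

lemma M_0: "M 0 = int n" and M_1: "M 1 = int m"
  by (simp_all add: M_def initial_ram_def presentation_code_def n_def m_def)

lemma M_row:
  assumes "j < m" "k \<le> length (r j)"
  shows "M (int (ptr j + k)) = (int (length (r j)) # map letter_code (r j)) ! k"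
proof -
  let ?rows = "map (\<lambda>r. int (length r) # map letter_code r) (rels P)"
  have row: "?rows ! i = int (length (r i)) # map letter_code (r i)" if "i < m" for i
    using that by (simp add: m_def r_def)
  have "(\<Sum>i<j. length (?rows ! i)) = (\<Sum>i<j. length (r i) + 1)"
    using row assms(1) by (intro sum.cong) auto
  then have p: "ptr j + k = 2 + ((\<Sum>i<j. length (?rows ! i)) + k)"
    by (simp add: ptr_def)
  have k: "j < length ?rows" "k < length (?rows ! j)"
    using assms row by (auto simp: m_def)
  have code: "presentation_code P = [int (ngens P), int (length (rels P))] @ concat ?rows"
    by (simp only: presentation_code_def)
  have len: "ptr j + k < length (presentation_code P)"
    using nth_concat(2)[OF k] unfolding code p length_append by simp
  then have "M (int (ptr j + k)) = presentation_code P ! (ptr j + k)"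
    by (simp add: M_def initial_ram_def del: of_nat_add)
  also have "\<dots> = concat ?rows ! ((\<Sum>i<j. length (?rows ! i)) + k)"
    unfolding code p by (simp add: nth_append)
  also have "\<dots> = (int (length (r j)) # map letter_code (r j)) ! k"
    using nth_concat(1)[OF k] row[OF assms(1)] by simp
  finally show ?thesis .
qed

lemma M_length: "j < m \<Longrightarrow> M (int (ptr j)) = int (length (r j))"
  using M_row[of j 0] by simp

lemma M_letter: "j < m \<Longrightarrow> k < length (r j) \<Longrightarrow> M (int (ptr j + 1 + k)) = letter_code (r j ! k)"
  using M_row[of j "Suc k"] by simp

lemma letter_bound: "j < m \<Longrightarrow> k < length (r j) \<Longrightarrow> gen_of (r j ! k) < n"
  using pres unfolding presentation_def m_def r_def n_def by (meson nth_mem)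

end

section \<open>Correctness of the first pass\<close>

context layout
begin

definition points_code :: "nat \<Rightarrow> int list" where
  "points_code v = concat (map (\<lambda>(x1, x2, x3, x4). [0, x1, x2, x3, x4]) (map pt [0..<v]))"

lemma points_code_Suc:
  "pt v = (x1, x2, x3, x4) \<Longrightarrow> points_code (Suc v) = points_code v @ [0, x1, x2, x3, x4]"
  by (simp add: points_code_def)

lemma pt_wedge: "0 < v \<Longrightarrow> v < D \<Longrightarrow> pt v = (int v, -1, 0, 0)"
  by (simp add: pt_def)

lemma pt_apex: "j < m \<Longrightarrow> pt (a j) = (0, 1, int (a j), 1)"
  using D_le_a[of j] by (auto simp: pt_def apex_def)

lemma not_apex: "a j < v \<Longrightarrow> v \<le> a j + N j \<Longrightarrow> \<not> apex v"
  using apex_in_interval[of v j] by auto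

lemma pt_rim_end:
  assumes "j < m" "v = a j + 1 \<or> v = a j + N j"
  shows "pt v = (0, 0, int v, 1)"
proof -
  have "rim_end v" using assms by (auto simp: rim_end_def)
  moreover have "\<not> apex v" using assms N_ge_3[of j] by (intro not_apex[of j]) auto
  moreover have "\<not> v < D" using D_le_a[of j] assms by auto
  ultimately show ?thesis by (simp add: pt_def)
qed

lemma pt_inner:
  assumes "j < m" "a j + 1 < v" "v < a j + N j"
  shows "pt v = (1, 0, int v, 1)"
proof -
  have "\<not> rim_end v" using assms rim_end_in_interval[of v j] by auto
  moreover have "\<not> apex v" using assms by (intro not_apex[of j]) auto
  moreover have "\<not> v < D" using D_le_a[of j] assms by auto
  ultimately show ?thesis by (simp add: pt_def)
qed

end

text \<open>Vertex labels and rectangle counters are bounded by \<open>a m\<close>, input addresses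
  and the number of relations by \<open>ptr m\<close>, and the constants of the program by
  \<open>c + 3\<close>; the word bound has to dominate all three.\<close>

locale machine = pres_layout +
  fixes w :: int
  assumes w_a: "int (a m) \<le> w" and w_ptr: "int (ptr m) \<le> w" and w_c: "int c + 3 \<le> w"
begin

definition base :: "ram \<Rightarrow> bool" where
  "base s \<longleftrightarrow> mem s = M \<and> reg s 1 = 0 \<and> reg s 2 = 1 \<and> reg s 18 = - 1 \<and>
     reg s 3 = int n \<and> reg s 4 = int m"

lemma a_le_w: "j \<le> m \<Longrightarrow> x \<le> a j \<Longrightarrow> int x \<le> w"
  using w_a a_le[of j m] by linarith

lemma ptr_le_w: "j \<le> m \<Longrightarrow> x \<le> ptr j \<Longrightarrow> int x \<le> w"
  using w_ptr ptr_mono[of j m] by linarith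

lemma N_lt_a: "j < m \<Longrightarrow> N j < a m"
  using a_less[of j m] by linarith

lemma n_le_K: "n \<le> K"
proof -
  have "n * 1 \<le> n * (c - 1)" using c_ge_3 by (intro mult_le_mono2) simp
  then show ?thesis by (simp add: K_def)
qed

lemma K_lt_w: "int K < w"
  using w_a D_le_a[of m] by (simp add: D_def)

lemma n_le_w: "int n \<le> w"
  using K_lt_w n_le_K by linarith

lemma m_le_ptr: "m \<le> ptr m"
proof -
  have "(\<Sum>i<m. 1) \<le> (\<Sum>i<m. length (r i) + 1)" by (intro sum_mono) simp
  then show ?thesis by (simp add: ptr_def)
qed

lemma m_le_w: "int m \<le> w"
  using w_ptr m_le_ptr by linarith

lemma w_ge_3: "3 \<le> w"
  using w_c by simp

lemma rl_le_N: "rl j \<le> N j"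
  using c_ge_3 by (simp add: N_def)

lemma wp_write_point:
  assumes "reg s 1 = 0" "reg s 2 = 1" "reg s 5 = int v" "tape s = points_code v"
    and "pt v = (reg s x, reg s y, reg s z, reg s t)" "int v + 1 \<le> w"
    and "\<And>s'. reg s' = (reg s)(5 := int (Suc v)) \<Longrightarrow> mem s' = mem s \<Longrightarrow>
      tape s' = points_code (Suc v) \<Longrightarrow> Q 6 s'"
  shows "wp w (write_point x y z t) Q s"
proof -
  have "wp w (write_point x y z t) (\<lambda>t s'. t = 6 \<and> reg s' = (reg s)(5 := int (Suc v)) \<and> mem s' = mem s \<and>
      tape s' = points_code (Suc v)) s"
    using assms(1-6) by (simp add: write_point_def points_code_Suc[OF assms(5)] add.commute)
  then show ?thesis using assms(7) by (auto elim: wp_mono)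
qed

lemma wp_init_prog:
  assumes "\<And>t s. t \<le> 10 \<Longrightarrow> base s \<Longrightarrow> reg s 5 = 1 \<Longrightarrow> reg s 6 = 0 \<Longrightarrow> tape s = points_code 1 \<Longrightarrow> Q t s"
  shows "wp w init_prog Q (initial_ram (presentation_code P))"
proof -
  have "reg (initial_ram (presentation_code P)) x = 0" "tape (initial_ram (presentation_code P)) = []" for x
    by (simp_all add: initial_ram_def)
  moreover have "mem (initial_ram (presentation_code P)) = M" by (simp add: M_def)
  moreover have "pt 0 = (0, 0, 0, 0)" using D_pos by (simp add: pt_def)
  ultimately show ?thesis
    using w_ge_3 n_le_w m_le_w
    by (auto simp: init_prog_def M_0 M_1 base_def points_code_def intro!: wp_write_point[where v = 0] assms)
qed

lemma wp_circle_points_prog: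
  assumes s: "base s" "reg s 5 = 1" "reg s 6 = 0" "tape s = points_code 1"
    and Q: "\<And>t s. t \<le> c + 8 * K + 1 \<Longrightarrow> base s \<Longrightarrow> reg s 5 = int D \<Longrightarrow>
      tape s = points_code D \<Longrightarrow> Q t s"
  shows "wp w (circle_points_prog c) Q s"
  unfolding circle_points_prog_def blk.simps wp_Seq
proof (rule wp_unroll[where T = 1 and
      I = "\<lambda>l s. base s \<and> reg s 5 = 1 \<and> reg s 6 = int (l * n) \<and> tape s = points_code 1"])
  fix l s assume l: "l < c - 1" and s: "base s \<and> reg s 5 = 1 \<and> reg s 6 = int (l * n) \<and> tape s = points_code 1"
  have "Suc l * n \<le> K"
    unfolding K_def using l by (metis Suc_leI mult.commute mult_le_mono2)
  then have "int (Suc l * n) \<le> w" using K_lt_w by linarith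
  then show "wp w (Add 6 6 3) (\<lambda>t s'. t \<le> 1 \<and> base s' \<and> reg s' 5 = 1 \<and> reg s' 6 = int (Suc l * n) \<and>
      tape s' = points_code 1) s"
    using s by (auto simp: base_def algebra_simps)
next
  fix t s assume t: "t \<le> (c - 1) * 1 + 1"
    and s: "base s \<and> reg s 5 = 1 \<and> reg s 6 = int ((c - 1) * n) \<and> tape s = points_code 1"
  show "wp w (WhilePos 6 (Seq (write_point 5 18 1 1) (Sub 6 6 2))) (\<lambda>t'. Q (t + t')) s"
  proof (rule wp_WhilePos[where T = "\<lambda>_. 7" and k = K and I = "\<lambda>l s. base s \<and>
        reg s 5 = int (1 + l) \<and> reg s 6 = int K - int l \<and> tape s = points_code (1 + l)"])
    fix l s assume l: "l < K" and s: "base s \<and>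
        reg s 5 = int (1 + l) \<and> reg s 6 = int K - int l \<and> tape s = points_code (1 + l)"
    have pt: "pt (1 + l) = (int (1 + l), -1, 0, 0)" using l by (intro pt_wedge) (auto simp: D_def)
    have b: "int (1 + l) + 1 \<le> w" "int K \<le> w" using l K_lt_w by linarith+
    show "reg s 6 > 0 \<and> wp w (Seq (write_point 5 18 1 1) (Sub 6 6 2)) (\<lambda>t s'. t \<le> 7 \<and> base s' \<and>
        reg s' 5 = int (1 + Suc l) \<and> reg s' 6 = int K - int (Suc l) \<and>
        tape s' = points_code (1 + Suc l)) s"
      unfolding wp_Seq
      using s l b pt by (auto simp: base_def intro!: wp_write_point[where v = "1 + l"])
  next
    fix t' :: nat and s assume t': "t' \<le> (\<Sum>l<K. 7 + 1) + 1" and s: "base s \<and>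
        reg s 5 = int (1 + K) \<and> reg s 6 = int K - int K \<and>
        tape s = points_code (1 + K)"
    show "Q (t + t') s"
      using s t t' c_ge_3 by (intro Q) (auto simp: D_def)
  qed (use s in \<open>auto simp: K_def mult.commute simp del: of_nat_diff\<close>)
qed (use s w_ge_3 in \<open>auto simp: base_def\<close>)

lemma wp_relation_points_prog:
  assumes j: "j < m" and s: "base s" "reg s 5 = int (a j)" "reg s 6 = int m - int j" "reg s 7 = int (ptr j)"
      "tape s = points_code (a j)"
    and Q: "\<And>t s. t \<le> c + 8 * N j + 20 \<Longrightarrow> base s \<Longrightarrow> reg s 5 = int (a (Suc j)) \<Longrightarrow>
      reg s 6 = int m - int (Suc j) \<Longrightarrow> reg s 7 = int (ptr (Suc j)) \<Longrightarrow>
      tape s = points_code (a (Suc j)) \<Longrightarrow> Q t s"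
  shows "wp w (relation_points_prog c) Q s"
proof -
  have a_w: "int (a j) + int (N j) + 1 \<le> w"
    using a_le_w[of "Suc j" "a (Suc j)"] j by (simp add: a_Suc)
  have ptr_w: "int (ptr j) + int (length (r j)) + 1 \<le> w"
    using ptr_le_w[of "Suc j" "ptr (Suc j)"] j by (simp add: ptr_Suc)
  have N3: "3 \<le> N j" by (rule N_ge)
  have rl_w: "int (rl j) \<le> w" using a_w rl_le_N[of j] by linarith
  have rl: "int (rl j) = (if 0 < length (r j) then int (length (r j)) else 1)"
    by (cases "r j") (simp_all add: rl_def rel_length_def)
  have m_w: "int m \<le> w" by (rule m_le_w)
  define inv where "inv s \<longleftrightarrow> base s \<and> reg s 6 = int m - int j \<and> reg s 7 = int (ptr j) \<and>
    reg s 8 = int (length (r j))" for s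
  define I1 where "I1 l s \<longleftrightarrow> inv s \<and> reg s 5 = int (a j + 2) \<and> tape s = points_code (a j + 2) \<and>
    reg s 12 = int (rl j) \<and> reg s 9 = int (l * rl j) - 2" for l s
  define I2 where "I2 l s \<longleftrightarrow> inv s \<and> reg s 5 = int (a j + 2 + l) \<and> tape s = points_code (a j + 2 + l) \<and>
    reg s 9 = int (N j) - 2 - int l" for l s
  have start: "wp w (blk [Load 8 7, write_point 1 2 5 2, write_point 1 1 5 2,
       IfPos 8 (Add 12 8 1) (Add 12 2 1), Const 9 (-2)]) (\<lambda>t s. t \<le> 16 \<and> I1 0 (set_reg 19 0 s)) s"
  proof -
    have pc: "points_code (Suc (a j)) = points_code (a j) @ [0, 0, 1, int (a j), 1]"
      "points_code (Suc (Suc (a j))) = points_code (a j) @ [0, 0, 1, int (a j), 1] @ [0, 0, 0, int (a j) + 1, 1]"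
      using points_code_Suc[OF pt_apex[OF j]] points_code_Suc[OF pt_rim_end[OF j disjI1[OF refl]]]
      by (simp_all add: add.commute)
    have b: "int (length (r j)) \<le> w" "int (a j) + 2 \<le> w" "2 \<le> w"
      using a_w ptr_w N3 w_ge_3 by linarith+
    show ?thesis
      using s b by (cases "r j = []") (simp_all add: base_def I1_def inv_def rl write_point_def pc M_length[OF j])
  qed
  have first: "wp w (Add 9 9 12) (\<lambda>t s. t \<le> 1 \<and> I1 (Suc l) s) s" if l: "l < c" and I: "I1 l s" for l s
  proof -
    have "Suc l * rl j \<le> N j" using l unfolding N_def by (intro mult_le_mono1) simp
    then have "int (Suc l * rl j) \<le> int (N j)" by linarith
    then have "int (Suc l * rl j) \<le> w" using a_w by linarith
    moreover have "int (Suc l * rl j) = int (l * rl j) + int (rl j)" by (simp add: algebra_simps)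
    moreover have "reg s 9 = int (l * rl j) - 2" "reg s 12 = int (rl j)" using I by (simp_all add: I1_def)
    ultimately have "\<bar>reg s 9 + reg s 12\<bar> \<le> w" using w_ge_3 by linarith
    then show ?thesis using I by (simp add: I1_def inv_def base_def algebra_simps)
  qed
  have loop: "reg s 9 > 0 \<and> wp w (blk [write_point 2 1 5 2, Sub 9 9 2]) (\<lambda>t s. t \<le> 7 \<and> I2 (Suc l) s) s"
    if l: "l < N j - 2" and I: "I2 l s" for l s
  proof -
    have "pt (a j + 2 + l) = (1, 0, int (a j + 2 + l), 1)"
      using l by (intro pt_inner[OF j]) auto
    then show ?thesis
      unfolding blk.simps wp_Seq
      using I l a_w by (auto simp: I2_def inv_def base_def intro!: wp_write_point[where v = "a j + 2 + l"])
  qed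
  have last: "wp w (blk [write_point 1 1 5 2, Add 7 7 8, Add 7 7 2, Sub 6 6 2]) (\<lambda>t s. t \<le> 9 \<and> base s \<and>
      reg s 5 = int (a (Suc j)) \<and> reg s 6 = int m - int (Suc j) \<and> reg s 7 = int (ptr (Suc j)) \<and>
      tape s = points_code (a (Suc j))) s" if I: "I2 (N j - 2) s" for s
  proof -
    have e: "a j + 2 + (N j - 2) = a j + N j" using N3 by simp
    have "inv s \<and> reg s 5 = int (a j + N j) \<and> tape s = points_code (a j + N j)"
      using I unfolding I2_def e by blast
    then show ?thesis
      using pt_rim_end[OF j disjI2[OF refl]] a_w ptr_w m_w j
      by (auto simp: inv_def base_def a_Suc ptr_Suc intro!: wp_write_point[where v = "a j + N j"])
  qed
  have "wp w (relation_points_prog c) (\<lambda>t s. t \<le> 16 + (c + 1) + (8 * (N j - 2) + 1) + 9 \<and> base s \<and>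
      reg s 5 = int (a (Suc j)) \<and> reg s 6 = int m - int (Suc j) \<and> reg s 7 = int (ptr (Suc j)) \<and>
      tape s = points_code (a (Suc j))) s" (is "wp w _ (\<lambda>t s. t \<le> _ \<and> ?R s) s")
    unfolding relation_points_prog_def
  proof (rule wp_blk_Cons, rule wp_mono[OF start], elim conjE, rule wp_blk_Cons)
    fix t :: nat and s assume t: "t \<le> 16" and s: "I1 0 (set_reg 19 0 s)"
    show "wp w (unroll (\<lambda>_. Add 9 9 12) c) (\<lambda>t' s. wp w (blk [WhilePos 9 (blk [write_point 2 1 5 2, Sub 9 9 2]),
         blk [write_point 1 1 5 2, Add 7 7 8, Add 7 7 2, Sub 6 6 2]])
       (\<lambda>t''. (\<lambda>t' s. t + t' \<le> 16 + (c + 1) + (8 * (N j - 2) + 1) + 9 \<and> ?R s) (t' + t'')) s) s"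
    proof (rule wp_unroll[where T = 1 and I = I1], goal_cases)
      case I: (4 t' s)
      show ?case
      proof (rule wp_blk_Cons, rule wp_WhilePos[where T = "\<lambda>_. 7" and k = "N j - 2" and I = I2], goal_cases)
        case 1
        show ?case using I by (simp add: I1_def I2_def inv_def base_def N_def)
      next
        case (2 l s)
        then show ?case using loop by blast
      next
        case (3 s)
        then show ?case using N3 by (simp add: I2_def)
      next
        case (4 t'' s)
        show ?case
          by (rule wp_blk_single, rule wp_mono[OF last[OF 4(2)]]) (use t I(1) 4(1) in auto)
      qed
    qed (use s first w_ge_3 in auto)
  qed
  then show ?thesis
    by (rule wp_mono) (use N3 in \<open>auto intro!: Q\<close>)
qed

lemma wp_points_prog:
  assumes Q: "\<And>t s. t \<le> 14 + c + 8 * K + (\<Sum>j<m. c + 8 * N j + 20 + 1) \<Longrightarrow> base s \<Longrightarrow>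
      tape s = points_code (a m) \<Longrightarrow> Q t s"
  shows "wp w (points_prog c) Q (initial_ram (presentation_code P))"
  unfolding points_prog_def
proof (rule wp_blk_Cons, rule wp_init_prog, rule wp_blk_Cons, rule wp_circle_points_prog)
  fix t t' :: nat and s s' :: ram
  assume t: "t \<le> 10" "t' \<le> c + 8 * K + 1" and s: "base s'" "reg s' 5 = int D" "tape s' = points_code D"
  have start: "wp w (blk [Const 7 2, Add 6 4 1]) (\<lambda>t s. t = 2 \<and> base s \<and> reg s 5 = int (a 0) \<and>
      reg s 6 = int m \<and> reg s 7 = int (ptr 0) \<and> tape s = points_code (a 0)) s'"
    using s w_ge_3 m_le_w by (simp add: base_def a_0 ptr_0)
  show "wp w (blk [blk [Const 7 2, Add 6 4 1], WhilePos 6 (relation_points_prog c)]) (\<lambda>t''. Q (t + (t' + t''))) s'"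
  proof (rule wp_blk_Cons, rule wp_mono[OF start], rule wp_blk_single,
      rule wp_WhilePos[where T = "\<lambda>j. c + 8 * N j + 20" and k = m and
        I = "\<lambda>j s. base s \<and> reg s 5 = int (a j) \<and> reg s 6 = int m - int j \<and>
          reg s 7 = int (ptr j) \<and> tape s = points_code (a j)"], goal_cases)
    case (2 t s j s')
    then show ?case by (auto intro!: wp_relation_points_prog)
  next
    case (4 t'' s t3 s')
    with t show ?case by (intro Q) auto
  qed auto
qed

end

section \<open>Correctness of the second pass\<close>

context pres_layout
begin

definition circle_cells :: "nat \<Rightarrow> nat \<Rightarrow> nat list list" where
  "circle_cells i v = map (\<lambda>l. [index (circ c i l), index (circ c i (Suc l))]) [0..<v]"

definition lower :: "nat \<Rightarrow> nat \<Rightarrow> nat" where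
  "lower j l = index (lower_vertex c (r j) l)"

definition upper :: "nat \<Rightarrow> nat \<Rightarrow> nat" where
  "upper j l = index (Upper j (l mod N j))"

text \<open>For an empty relation the first triangle collapses to an edge from the wedge point to an
  upper vertex, which is a face of the second triangle. As a list it would repeat the label 0, so it
  is omitted.\<close>

definition rectangle :: "nat \<Rightarrow> nat \<Rightarrow> nat list list" where
  "rectangle j l = (if r j = [] then [] else [[lower j l, lower j (Suc l), upper j l]]) @
     [[lower j (Suc l), upper j l, upper j (Suc l)], [upper j l, upper j (Suc l), a j]]"

definition relation_cells :: "nat \<Rightarrow> nat \<Rightarrow> nat list list" where
  "relation_cells j v = concat (map (rectangle j) [0..<v])"

definition wedge_cells :: "nat \<Rightarrow> nat list list" where
  "wedge_cells v = [0] # concat (map (\<lambda>i. circle_cells i c) [0..<v])"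

definition complex_cells :: "nat \<Rightarrow> nat list list" where
  "complex_cells v = wedge_cells n @ concat (map (\<lambda>j. relation_cells j (N j)) [0..<v])"

definition cells :: "nat list list \<Rightarrow> int list" where
  "cells gs = cells_code (map (map int) gs)"

lemma cells_append: "cells (gs @ hs) = cells gs @ cells hs"
  and cells_Nil [simp]: "cells [] = []"
  by (simp_all add: cells_def cells_code_append)

lemma cells_code_nat:
  "cells_code [[int x, int y]] = cells [[x, y]]"
  "cells_code [[int x, int y, int z]] = cells [[x, y, z]]"
  by (simp_all add: cells_def)

lemma circle_cells_simps [simp]:
  "circle_cells i 0 = []"
  "circle_cells i (Suc l) = circle_cells i l @ [[index (circ c i l), index (circ c i (Suc l))]]"
  by (simp_all add: circle_cells_def)

lemma relation_cells_simps [simp]: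
  "relation_cells j 0 = []"
  "relation_cells j (Suc l) = relation_cells j l @ rectangle j l"
  by (simp_all add: relation_cells_def)

text \<open>The labels that \<open>advance\<close> produces along one loop, starting and ending at
  the wedge point 0. Suitable \<open>f\<close> and \<open>d\<close> give the forward, the backward
  and the constant loop.\<close>

definition walk :: "int \<Rightarrow> int \<Rightarrow> nat \<Rightarrow> int" where
  "walk f d l = (if l = 0 \<or> l = c then 0 else f + (int l - 1) * d)"

definition first :: "nat \<Rightarrow> nat \<Rightarrow> int" where
  "first j k = (if r j = [] then 0 else
     case r j ! k of Gen i \<Rightarrow> int (i * (c - 1) + 1) | Inv i \<Rightarrow> int (i * (c - 1) + (c - 1)))"

definition diff :: "nat \<Rightarrow> nat \<Rightarrow> int" where
  "diff j k = (if r j = [] then 0 else case r j ! k of Gen i \<Rightarrow> 1 | Inv i \<Rightarrow> - 1)"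

lemma walk_circle:
  assumes "l \<le> c"
  shows "walk (int (i * (c - 1) + 1)) 1 l = int (index (circ c i l))"
proof -
  have "l mod c = 0 \<longleftrightarrow> l = 0 \<or> l = c" using assms c_ge_3 by (cases "l = c") auto
  then show ?thesis by (simp add: walk_def circ_def)
qed

lemma walk_circle_backwards:
  assumes "l \<le> c"
  shows "walk (int (i * (c - 1) + (c - 1))) (-1) l = int (index (circ c i (c - l)))"
proof -
  have *: "(c - l) mod c = 0 \<longleftrightarrow> l = 0 \<or> l = c" using assms c_ge_3 by (cases "l = 0") auto
  have "int (c - l) = int (c - 1) - (int l - 1)" using assms c_ge_3 by linarith
  with * show ?thesis by (simp add: walk_def circ_def del: of_nat_diff)
qed

text \<open>This ties the machine's arithmetic to the attaching path. Position \<open>l = c\<close>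
  already belongs to the next letter, but every letter starts and ends at the wedge point, so the
  formula still holds there. For an empty relation \<open>k\<close> is 0.\<close>

lemma walk_lower:
  assumes k: "k < rl j" and l: "l \<le> c"
  shows "walk (first j k) (diff j k) l = int (lower j (c * k + l))"
proof (cases "r j = []")
  case True
  then show ?thesis by (simp add: lower_def lower_vertex_def walk_def first_def diff_def)
next
  case False
  show ?thesis
  proof (cases "l = c")
    case True
    then show ?thesis by (simp add: lower_def lower_vertex_def walk_def)
  next
    case lc: False
    have *: "(c * k + l) mod c = l" "(c * k + l) div c = k" using l lc c_ge_3 by auto
    have "int (lower j (c * k + l)) = int (index (letter_vertex c (r j ! k) l))"
    proof (cases "l = 0")
      case True
      have "letter_vertex c (r j ! k) 0 = Base" by (cases "r j ! k") (auto simp: circ_def)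
      then show ?thesis using True False * by (simp add: lower_def lower_vertex_def)
    next
      case l0: False
      then show ?thesis using False * by (simp add: lower_def lower_vertex_def)
    qed
    also have "\<dots> = walk (first j k) (diff j k) l"
      using walk_circle[OF l] walk_circle_backwards[OF l] False
      by (cases "r j ! k") (simp_all add: first_def diff_def del: of_nat_diff)
    finally show ?thesis by simp
  qed
qed

end

context machine
begin

lemma circ_index_le:
  assumes "i < n" "l \<le> c"
  shows "index (circ c i l) \<le> K"
proof (cases "l mod c = 0")
  case False
  then have "l \<noteq> c" by auto
  then have "l \<le> c - 1" using assms(2) by simp
  then have "i * (c - 1) + l \<le> Suc i * (c - 1)" by simp
  also have "\<dots> \<le> n * (c - 1)" using assms by (intro mult_le_mono1) simp
  finally show ?thesis using False by (simp add: circ_def K_def)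
qed (simp add: circ_def)

lemma wp_advance:
  assumes s: "reg s 1 = 0" "reg s 11 = walk f d l" "reg s 12 = f" "reg s 13 = d" "l < c"
    and b: "\<bar>walk f d l\<bar> \<le> w" "\<bar>walk f d (Suc l)\<bar> \<le> w"
    and Q: "\<And>s'. reg s' = (reg s)(10 := walk f d l, 11 := walk f d (Suc l)) \<Longrightarrow> mem s' = mem s \<Longrightarrow>
      tape s' = tape s \<Longrightarrow> Q 2 s'"
  shows "wp w (advance c l) Q s"
proof -
  have "walk f d (Suc l) = (if Suc l = c then 0 else if l = 0 then f else walk f d l + d)"
    using s(5) by (auto simp: walk_def algebra_simps)
  then have "wp w (advance c l) (\<lambda>t s'. t = 2 \<and> reg s' = (reg s)(10 := walk f d l, 11 := walk f d (Suc l)) \<and>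
      mem s' = mem s \<and> tape s' = tape s) s"
    using s b w_ge_3 by (auto simp: advance_def)
  then show ?thesis using Q by (auto elim: wp_mono)
qed

lemma wp_circle_prog:
  assumes i: "i < n" and s: "base s" "reg s 5 = int (i * (c - 1))" "reg s 6 = int n - int i"
      "reg s 11 = 0" "reg s 13 = 1" "tape s = X"
    and Q: "\<And>t s. t \<le> 13 * c + 10 \<Longrightarrow> base s \<Longrightarrow> reg s 5 = int (Suc i * (c - 1)) \<Longrightarrow>
      reg s 6 = int n - int (Suc i) \<Longrightarrow> reg s 11 = 0 \<Longrightarrow> reg s 13 = 1 \<Longrightarrow>
      tape s = X @ cells (circle_cells i c) \<Longrightarrow> Q t s"
  shows "wp w (circle_prog c) Q s"
  unfolding circle_prog_def
proof (rule wp_blk_Cons)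
  let ?f = "int (i * (c - 1) + 1)"
  have ci: "Suc i * (c - 1) \<le> K" unfolding K_def using i by (intro mult_le_mono1) simp
  then have ci_w: "int (Suc i * (c - 1)) \<le> w" using K_lt_w by linarith
  have f_w: "?f \<le> w" using ci K_lt_w by (simp add: del: of_nat_mult of_nat_diff)
  define I where "I l s \<longleftrightarrow> base s \<and> reg s 5 = int (i * (c - 1)) \<and> reg s 6 = int n - int i \<and>
    reg s 11 = walk ?f 1 l \<and> reg s 12 = ?f \<and> reg s 13 = 1 \<and> tape s = X @ cells (circle_cells i l)" for l s
  define J where "J l s \<longleftrightarrow> base s \<and> reg s 5 = int (i * (c - 1)) + int l \<and> reg s 6 = int n - int i \<and>
    reg s 11 = 0 \<and> reg s 13 = 1 \<and> tape s = X @ cells (circle_cells i c)" for l s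
  have start: "wp w (Add 12 5 2) (\<lambda>t s. t = 1 \<and> I 0 (set_reg 19 0 s)) s"
    using s f_w by (simp add: I_def base_def walk_def del: of_nat_mult of_nat_diff)
  have edge: "wp w (blk [advance c l, emit [10, 11]]) (\<lambda>t s. t \<le> 12 \<and> I (Suc l) s) s"
    if l: "l < c" and I: "I l s" for l s
    using l I c_ge_3 w_ge_3 K_lt_w circ_index_le[OF i, of l] circ_index_le[OF i, of "Suc l"]
      walk_circle[of l i] walk_circle[of "Suc l" i]
    by (intro wp_blk_Cons wp_advance wp_blk_single wp_emit2)
      (auto simp: I_def base_def cells_append cells_code_nat)
  show "wp w (Add 12 5 2) (\<lambda>t s. wp w (blk [unroll (\<lambda>l. blk [advance c l, emit [10, 11]]) c,
      unroll (\<lambda>_. Add 5 5 2) (c - 1), Sub 6 6 2]) (\<lambda>t'. Q (t + t')) s) s"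
  proof (rule wp_mono[OF start], rule wp_blk_Cons, elim conjE,
      rule wp_unroll[where I = I and T = 12], goal_cases)
    case (3 t s l s')
    then show ?case using edge by blast
  next
    case I: (4 t s t' s')
    show ?case
    proof (rule wp_blk_Cons, rule wp_unroll[where I = J and T = 1], goal_cases)
      case 1 then show ?case using w_ge_3 by simp
    next
      case 2
      then show ?case using I by (simp add: I_def J_def base_def walk_def)
    next
      case (3 l s)
      have "i * (c - 1) + Suc l \<le> Suc i * (c - 1)" using 3(1) by simp
      then have "int (i * (c - 1) + Suc l) \<le> w" using ci K_lt_w by linarith
      then have "int (i * (c - 1)) + int (Suc l) \<le> w" by (simp only: of_nat_add)
      then show ?case using 3 by (auto simp: J_def base_def simp del: of_nat_mult of_nat_diff)
    next
      case (4 t'' s'')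
      have "int (Suc i * (c - 1)) = int (i * (c - 1)) + int (c - 1)" by simp
      then show ?case
        using 4 I(1,3) i n_le_w unfolding J_def
        by (intro wp_blk_single) (auto simp: base_def simp del: of_nat_mult of_nat_diff mult_Suc intro!: Q)
    qed
  qed (use w_ge_3 in auto)
qed

lemma wp_wedge_prog:
  assumes s: "base s" "tape s = X"
    and Q: "\<And>t s. t \<le> 8 + n * (13 * c + 11) \<Longrightarrow> base s \<Longrightarrow> reg s 5 = int K \<Longrightarrow>
      tape s = X @ cells (wedge_cells n) \<Longrightarrow> Q t s"
  shows "wp w (wedge_prog c) Q s"
  unfolding wedge_prog_def
proof (rule wp_blk_Cons)
  define I where "I i s \<longleftrightarrow> base s \<and> reg s 5 = int (i * (c - 1)) \<and> reg s 6 = int n - int i \<and>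
    reg s 11 = 0 \<and> reg s 13 = 1 \<and> tape s = X @ cells (wedge_cells i)" for i s
  have start: "wp w (blk [emit [1], Const 5 0, Const 11 0, Const 13 1, Add 6 3 1]) (\<lambda>t s. t = 7 \<and> I 0 s) s"
    using s w_ge_3 n_le_w
    by (intro wp_blk_Cons wp_emit1) (auto simp: I_def base_def wedge_cells_def cells_def)
  show "wp w (blk [emit [1], Const 5 0, Const 11 0, Const 13 1, Add 6 3 1])
      (\<lambda>t s. wp w (blk [WhilePos 6 (circle_prog c)]) (\<lambda>t'. Q (t + t')) s) s"
  proof (rule wp_mono[OF start], rule wp_blk_single, elim conjE,
      rule wp_WhilePos[where I = I and T = "\<lambda>_. 13 * c + 10" and k = n], goal_cases)
    case (2 t s i s')
    then show ?case
      by (auto simp: I_def wedge_cells_def cells_append[of "_ # _", simplified] cells_append intro!: wp_circle_prog[of i])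
  next
    case (4 t s t' s')
    then show ?case by (intro Q) (auto simp: I_def K_def algebra_simps)
  qed (auto simp: I_def)
qed

lemma letter_bounds:
  assumes "j < m" "k < rl j"
  shows "l \<le> c \<Longrightarrow> \<bar>walk (first j k) (diff j k) l\<bar> \<le> w"
    and "r j \<noteq> [] \<Longrightarrow> k < length (r j)"
proof -
  show len: "k < length (r j)" if "r j \<noteq> []"
    using assms(2) that by (cases "r j") (auto simp: rl_def rel_length_def)
  assume l: "l \<le> c"
  show "\<bar>walk (first j k) (diff j k) l\<bar> \<le> w"
  proof (cases "r j = []")
    case True
    then show ?thesis using w_ge_3 by (simp add: walk_def first_def diff_def)
  next
    case False
    have i: "gen_of (r j ! k) < n" using letter_bound[OF assms(1) len[OF False]] .
    show ?thesis
    proof (cases "r j ! k")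
      case (Gen i)
      then have "walk (first j k) (diff j k) l = int (index (circ c i l))"
        using False walk_circle[OF l, of i] by (simp add: first_def diff_def)
      moreover have "index (circ c i l) \<le> K" using circ_index_le[of i l] i Gen l by simp
      ultimately show ?thesis using K_lt_w by linarith
    next
      case (Inv i)
      then have "walk (first j k) (diff j k) l = int (index (circ c i (c - l)))"
        using False walk_circle_backwards[OF l, of i] by (simp add: first_def diff_def)
      moreover have "index (circ c i (c - l)) \<le> K" using circ_index_le[of i "c - l"] i Inv by simp
      ultimately show ?thesis using K_lt_w by linarith
    qed
  qed
qed

text \<open>The bound counts three steps for the test of register 8 and for reading the letter, one
  for the test of its sign, three to set registers, and \<open>c\<close> for the unrolled additions.
  Registers 0 and 19 end with values that do not matter, hence \<open>x\<close> and
  \<open>y\<close>.\<close>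

lemma wp_decode_prog:
  assumes j: "j < m" "k < rl j"
    and s: "base s" "reg s 8 = int (length (r j))"
      "reg s 7 = int (ptr j + 1 + (if r j = [] then 0 else k))"
    and Q: "\<And>t s' x y. t \<le> c + 7 \<Longrightarrow> mem s' = mem s \<Longrightarrow> tape s' = tape s \<Longrightarrow>
      reg s' = (reg s)(0 := x, 7 := int (ptr j + 1 + (if r j = [] then 0 else Suc k)),
        12 := first j k, 13 := diff j k, 19 := y) \<Longrightarrow> Q t s'"
  shows "wp w (decode_prog c) Q s"
proof (cases "r j = []")
  case True
  have "wp w (decode_prog c) (\<lambda>t s'. t = 3 \<and> mem s' = mem s \<and> tape s' = tape s \<and>
     reg s' = (reg s)(12 := 0, 13 := 0)) s"
    using s True w_ge_3 by (simp add: decode_prog_def)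
  then show ?thesis
  proof (rule wp_mono, elim conjE)
    fix t :: nat and s' :: ram
    assume as: "t = 3" "mem s' = mem s" "tape s' = tape s" "reg s' = (reg s)(12 := 0, 13 := 0)"
    then have "reg s' = (reg s)(0 := reg s 0, 7 := int (ptr j + 1 + (if r j = [] then 0 else Suc k)),
        12 := first j k, 13 := diff j k, 19 := reg s 19)"
      using s True by (auto simp: first_def diff_def fun_eq_iff)
    from Q[OF _ as(2,3) this] as(1) show "Q t s'" by simp
  qed
next
  case False
  have k: "k < length (r j)" using letter_bounds(2)[OF j False] .
  define i where "i = gen_of (r j ! k)"
  have i: "i < n" using letter_bound[OF j(1) k] by (simp add: i_def)
  have "Suc i * (c - 1) \<le> K" unfolding K_def using i by (intro mult_le_mono1) simp
  have K: "int i * int (c - 1) + int (c - 1) < w"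
  proof -
    have "int i * int (c - 1) + int (c - 1) = int (Suc i * (c - 1))" by (simp only: mult_Suc of_nat_add of_nat_mult add.commute)
    then show ?thesis using \<open>Suc i * (c - 1) \<le> K\<close> K_lt_w by linarith
  qed
  have c1: "int c - 1 = int (c - 1)" using c_ge_3 by simp
  have ptr_w: "int (ptr j) + int (length (r j)) + 1 \<le> w"
    using ptr_le_w[of "Suc j" "ptr (Suc j)"] j by (simp add: ptr_Suc)
  have g: "mem s (reg s 7) = letter_code (r j ! k)"
  proof -
    have "reg s 7 = int (ptr j + 1 + k)" using s(3) False by simp
    then show ?thesis using M_letter[OF j(1) k] s(1) unfolding base_def by metis
  qed
  have i_w: "int i + 1 \<le> w" using i n_le_w by linarith
  define R where "R s' \<longleftrightarrow> mem s' = mem s \<and> tape s' = tape s \<and>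
      (\<exists>x y. reg s' = (reg s)(0 := x, 7 := int (ptr j + 1 + Suc k), 12 := first j k, 13 := diff j k, 19 := y))" for s' :: ram
  define pos where "pos = blk [blk [Sub 0 0 2, Const 12 1, Const 13 1], unroll (\<lambda>_. Add 12 12 0) (c - 1)]"
  define neg where "neg = blk [blk [Add 0 0 2, Const 12 (int c - 1), Const 13 (-1)], unroll (\<lambda>_. Sub 12 12 0) (c - 1)]"
  \<comment> \<open>Fetching the letter is the same for both signs; only the conditional on the sign
    is left to \<open>branch\<close>.\<close>
  have prefix: "wp w (decode_prog c) (\<lambda>t s'. t \<le> c + 7 \<and> R s') s"
    if branch: "\<And>s'. mem s' = mem s \<Longrightarrow> tape s' = tape s \<Longrightarrow>
      reg s' = (reg s)(0 := letter_code (r j ! k), 7 := int (ptr j + 1 + Suc k)) \<Longrightarrow>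
      wp w (IfPos 0 pos neg) (\<lambda>t s'. t \<le> c + 4 \<and> R s') s'"
  proof -
    have "\<bar>letter_code (r j ! k)\<bar> = int i + 1" by (cases "r j ! k") (auto simp: i_def)
    then have g_w: "\<bar>letter_code (r j ! k)\<bar> \<le> w" using i_w by simp
    have "wp w (blk [Load 0 7, Add 7 7 2, IfPos 0 pos neg]) (\<lambda>t s'. t + 1 \<le> c + 7 \<and> R s') s"
    proof (rule wp_blk_Cons, subst wp_Load, intro conjI wp_blk_Cons, goal_cases)
      case 1
      then show ?case using s False g g_w by (simp add: base_def)
    next
      case 2
      show ?case
      proof (subst wp_Add, intro conjI wp_blk_single, goal_cases)
        case 1
        then show ?case using s False ptr_w k by (simp add: base_def)
      next
        case 2
        show ?case
          by (rule wp_mono[OF branch]) (use s False g in \<open>auto simp: base_def\<close>)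
      qed
    qed
    then show ?thesis using s(2) False
      by (simp only: decode_prog_def pos_def neg_def wp_IfPos) simp
  qed
  have "wp w (decode_prog c) (\<lambda>t s'. t \<le> c + 7 \<and> R s') s"
  proof (rule prefix)
    fix s' :: ram assume s': "mem s' = mem s" "tape s' = tape s"
      "reg s' = (reg s)(0 := letter_code (r j ! k), 7 := int (ptr j + 1 + Suc k))"
    have mul: "0 \<le> int l * int i" "int l * int i \<le> int i * int (c - 1)" if "l \<le> c - 1" for l
      using that mult_right_mono[of "int l" "int (c - 1)" "int i"] by (auto simp: mult.commute)
    have mulS: "int (Suc l) * int i = int l * int i + int i" for l
      by (simp add: algebra_simps)
    show "wp w (IfPos 0 pos neg) (\<lambda>t s'. t \<le> c + 4 \<and> R s') s'"
    proof (cases "r j ! k")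
      case (Gen i')
      then have e: "r j ! k = Gen i" by (simp add: i_def)
      define I where "I l s' \<longleftrightarrow> mem s' = mem s \<and> tape s' = tape s \<and>
        (\<exists>y. reg s' = (reg s)(0 := int i, 7 := int (ptr j + 1 + Suc k), 12 := 1 + int l * int i, 13 := 1, 19 := y))" for l and s' :: ram
      have add: "wp w (Add 12 12 0) (\<lambda>t s'. t \<le> 1 \<and> I (Suc l) s') s'" if l: "l < c - 1" and I: "I l s'" for l s'
      proof -
        have "\<bar>1 + int l * int i + int i\<bar> \<le> w"
          using mul[of "Suc l"] mul[of l] mulS[of l] l K c_ge_3 by linarith
        then show ?thesis using I mulS[of l] unfolding I_def by (auto simp: fun_eq_iff)
      qed
      have "wp w pos (\<lambda>t s'. t + 1 \<le> c + 4 \<and> I (c - 1) s') s'"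
        unfolding pos_def
      proof (rule wp_blk_Cons, rule wp_mono[of _ _ "\<lambda>t s'. t = 3 \<and> I 0 (set_reg 19 0 s')"], goal_cases)
        case 1
        show ?case using s' s(1) e w_ge_3 i_w by (auto simp: I_def base_def fun_eq_iff)
      next
        case (2 t s')
        show ?case
          by (rule wp_blk_single, rule wp_unroll[where I = I and T = 1]) (use 2 add w_ge_3 c_ge_3 in auto)
      qed
      moreover have "R s''" if I: "I (c - 1) s''" for s''
      proof -
        have "first j k = 1 + int (c - 1) * int i" "diff j k = 1"
          using e False by (simp_all add: first_def diff_def mult.commute)
        then show ?thesis using I unfolding I_def R_def by metis
      qed
      ultimately show ?thesis using s' e by (auto elim!: wp_mono)
    next
      case (Inv i')
      then have e: "r j ! k = Inv i" by (simp add: i_def)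
      define I where "I l s' \<longleftrightarrow> mem s' = mem s \<and> tape s' = tape s \<and>
        (\<exists>y. reg s' = (reg s)(0 := - int i, 7 := int (ptr j + 1 + Suc k), 12 := int (c - 1) + int l * int i, 13 := - 1, 19 := y))" for l and s' :: ram
      have add: "wp w (Sub 12 12 0) (\<lambda>t s'. t \<le> 1 \<and> I (Suc l) s') s'" if l: "l < c - 1" and I: "I l s'" for l s'
      proof -
        have "\<bar>int (c - 1) + int l * int i + int i\<bar> \<le> w"
          using mul[of "Suc l"] mul[of l] mulS[of l] l K by linarith
        then show ?thesis using I mulS[of l] unfolding I_def by (auto simp: fun_eq_iff)
      qed
      have "wp w neg (\<lambda>t s'. t + 1 \<le> c + 4 \<and> I (c - 1) s') s'"
        unfolding neg_def
      proof (rule wp_blk_Cons, rule wp_mono[of _ _ "\<lambda>t s'. t = 3 \<and> I 0 (set_reg 19 0 s')"], goal_cases)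
        case 1
        show ?case using s' s(1) e w_ge_3 i_w w_c unfolding c1 by (auto simp: I_def base_def fun_eq_iff)
      next
        case (2 t s')
        show ?case
          by (rule wp_blk_single, rule wp_unroll[where I = I and T = 1]) (use 2 add w_ge_3 c_ge_3 in auto)
      qed
      moreover have "R s''" if I: "I (c - 1) s''" for s''
      proof -
        have "first j k = int (c - 1) + int (c - 1) * int i" "diff j k = - 1"
          using e False by (simp_all add: first_def diff_def mult.commute)
        then show ?thesis using I unfolding I_def R_def by metis
      qed
      ultimately show ?thesis using s' e by (auto elim!: wp_mono)
    qed
  qed
  then show ?thesis
    by (rule wp_mono) (use False in \<open>auto simp: R_def intro!: Q\<close>)
qed

text \<open>The time 85 is 2 for \<open>advance\<close>, 3 for the next upper vertex, at most 27 for
  the conditional triangle and 53 for the other two triangles and the increment.\<close>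

lemma wp_rectangle_prog:
  assumes j: "j < m" "k < rl j" and l: "l < c"
    and s: "base s" "reg s 8 = int (length (r j))" "reg s 16 = int (a j)"
      "reg s 12 = first j k" "reg s 13 = diff j k" "reg s 11 = int (lower j (c * k + l))"
      "reg s 14 = int (a j + 1 + (c * k + l))" "reg s 17 = int (N j) - int (c * k + l)"
      "tape s = X"
    and Q: "\<And>t s'. t \<le> 85 \<Longrightarrow> mem s' = mem s \<Longrightarrow> tape s' = X @ cells (rectangle j (c * k + l)) \<Longrightarrow>
      (\<And>x. x \<notin> {0, 10, 11, 14, 15, 17, 19} \<Longrightarrow> reg s' x = reg s x) \<Longrightarrow>
      reg s' 11 = int (lower j (Suc (c * k + l))) \<Longrightarrow>
      reg s' 14 = int (a j + 1 + Suc (c * k + l)) \<Longrightarrow> reg s' 17 = int (N j) - int (Suc (c * k + l)) \<Longrightarrow> Q t s'"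
  shows "wp w (rectangle_prog c l) Q s"
proof -
  define q where "q = c * k + l"
  have "c * k + l < c * Suc k" using l by simp
  also have "\<dots> \<le> N j" unfolding N_def using j(2) by (intro mult_le_mono2) simp
  finally have qN: "q < N j" by (simp add: q_def)
  have a_w: "int (a j) + int (N j) + 1 \<le> w"
    using a_le_w[of "Suc j" "a (Suc j)"] j by (simp add: a_Suc)
  have w0: "walk (first j k) (diff j k) l = int (lower j q)"
    using walk_lower[OF j(2), of l] l by (simp add: q_def)
  have w1: "walk (first j k) (diff j k) (Suc l) = int (lower j (Suc q))"
    using walk_lower[OF j(2), of "Suc l"] l by (simp add: q_def)
  have up0: "upper j q = a j + 1 + q" using qN by (simp add: upper_def)
  \<comment> \<open>After its decrement, register 17 holds \<open>N j - q - 1\<close>, which is 0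
    exactly at the last rectangle, where the cycle returns to \<open>a j + 1\<close>.\<close>
  have up1: "int (upper j (Suc q)) = (if int (N j) - int q - 1 > 0 then int (a j) + 1 + int q + 1 else int (a j) + 1)"
  proof (cases "Suc q = N j")
    case False
    with qN have "Suc q < N j" by simp
    then show ?thesis by (simp add: upper_def)
  qed (use qN in \<open>simp add: upper_def\<close>)
  have b: "\<bar>int (lower j q)\<bar> \<le> w" "\<bar>int (lower j (Suc q))\<bar> \<le> w"
    using letter_bounds(1)[OF j, of l] letter_bounds(1)[OF j, of "Suc l"] l w0 w1 by auto
  have up0_w: "int (upper j q) + 1 \<le> w" and up0_Suc: "int (a j + 1 + Suc q) = int (upper j q) + 1"
    using a_w qN unfolding up0 by linarith+
  define I where "I s1 \<longleftrightarrow> mem s1 = mem s \<and> (\<forall>x. x \<notin> {0, 10, 11, 14, 15, 17, 19} \<longrightarrow> reg s1 x = reg s x) \<and>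
    reg s1 10 = int (lower j q) \<and> reg s1 11 = int (lower j (Suc q)) \<and> reg s1 14 = int (upper j q) \<and>
    reg s1 17 = int (N j) - int (Suc q)" for s1 :: ram
  have adv: "wp w (advance c l) (\<lambda>t s1. t = 2 \<and> reg s1 = (reg s)(10 := int (lower j q), 11 := int (lower j (Suc q))) \<and>
      mem s1 = mem s \<and> tape s1 = tape s) s"
    using s l w0 w1 b by (intro wp_advance) (auto simp: base_def q_def)
  have start: "wp w (blk [Sub 17 17 2, IfPos 17 (Add 15 14 2) (Add 15 16 2)])
    (\<lambda>t s2. t = 3 \<and> I s2 \<and> reg s2 15 = int (upper j (Suc q)) \<and> tape s2 = X) s1"
    if "reg s1 = (reg s)(10 := int (lower j q), 11 := int (lower j (Suc q)))"
      "mem s1 = mem s" "tape s1 = tape s" for s1 :: ram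
    using that s a_w qN up0 up1 w_ge_3 unfolding I_def
    by (auto simp: base_def q_def[symmetric])
  have tri1: "wp w (IfPos 8 (emit [10, 11, 14]) (Const 19 0)) (\<lambda>t s2. t \<le> 27 \<and> I s2 \<and> reg s2 15 = int (upper j (Suc q)) \<and>
      tape s2 = X @ cells (if r j = [] then [] else [[lower j q, lower j (Suc q), upper j q]])) s1"
    if "I s1" "reg s1 15 = int (upper j (Suc q))" "tape s1 = X" for s1 :: ram
    using that s w_ge_3 unfolding I_def
    by (auto simp: cells_code_nat intro!: wp_emit3)
  have tri2: "wp w (blk [emit [11, 14, 15], emit [14, 15, 16], Add 14 14 2]) (\<lambda>t s2. t = 53 \<and>
      mem s2 = mem s \<and> (\<forall>x. x \<notin> {0, 10, 11, 14, 15, 17, 19} \<longrightarrow> reg s2 x = reg s x) \<and>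
      reg s2 11 = int (lower j (Suc q)) \<and> reg s2 14 = int (a j + 1 + Suc q) \<and> reg s2 17 = int (N j) - int (Suc q) \<and>
      tape s2 = Y @ cells [[lower j (Suc q), upper j q, upper j (Suc q)], [upper j q, upper j (Suc q), a j]]) s1"
    if "I s1" "reg s1 15 = int (upper j (Suc q))" "tape s1 = Y" for s1 Y
    using that s w_ge_3 up0_w up0_Suc unfolding I_def
    by (intro wp_blk_Cons wp_blk_single wp_emit3)
      (auto simp: base_def cells_code_nat cells_append[of "[_]" "[_]", simplified])
  have "wp w (rectangle_prog c l) (\<lambda>t s'. t \<le> 85 \<and> mem s' = mem s \<and>
      (\<forall>x. x \<notin> {0, 10, 11, 14, 15, 17, 19} \<longrightarrow> reg s' x = reg s x) \<and>
      reg s' 11 = int (lower j (Suc q)) \<and> reg s' 14 = int (a j + 1 + Suc q) \<and> reg s' 17 = int (N j) - int (Suc q) \<and>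
      tape s' = X @ cells (rectangle j q)) s"
    unfolding rectangle_prog_def
  proof (rule wp_blk_Cons, rule wp_mono[OF adv], rule wp_blk_Cons, elim conjE,
      rule wp_mono[OF start], assumption, assumption, assumption, elim conjE, rule wp_blk_Cons,
      rule wp_mono[OF tri1], assumption, assumption, assumption, elim conjE, rule wp_blk_single,
      rule wp_mono[OF tri2], assumption, assumption, assumption, elim conjE, goal_cases)
    case 1
    then show ?case by (simp add: rectangle_def cells_append)
  qed
  then show ?thesis by (rule wp_mono) (auto simp: q_def intro!: Q)
qed

lemma wp_letter_prog:
  assumes j: "j < m" "k < rl j"
    and s: "base s" "reg s 8 = int (length (r j))" "reg s 16 = int (a j)"
      "reg s 7 = int (ptr j + 1 + (if r j = [] then 0 else k))"
      "reg s 11 = 0" "reg s 14 = int (a j + 1 + c * k)" "reg s 17 = int (N j) - int (c * k)"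
      "reg s 9 = int (rl j) - int k" "reg s 6 = y" "tape s = X @ cells (relation_cells j (c * k))"
    and Q: "\<And>t s'. t \<le> 86 * c + 9 \<Longrightarrow> base s' \<Longrightarrow> reg s' 8 = int (length (r j)) \<Longrightarrow> reg s' 16 = int (a j) \<Longrightarrow>
      reg s' 7 = int (ptr j + 1 + (if r j = [] then 0 else Suc k)) \<Longrightarrow>
      reg s' 11 = 0 \<Longrightarrow> reg s' 14 = int (a j + 1 + c * Suc k) \<Longrightarrow> reg s' 17 = int (N j) - int (c * Suc k) \<Longrightarrow>
      reg s' 9 = int (rl j) - int (Suc k) \<Longrightarrow> reg s' 6 = y \<Longrightarrow>
      tape s' = X @ cells (relation_cells j (c * Suc k)) \<Longrightarrow> Q t s'"
  shows "wp w (letter_prog c) Q s"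
  unfolding letter_prog_def
proof (rule wp_blk_Cons, rule wp_decode_prog[OF j s(1,2,4)])
  fix t :: nat and s' :: ram and x z
  assume t: "t \<le> c + 7" and s': "mem s' = mem s" "tape s' = tape s"
    "reg s' = (reg s)(0 := x, 7 := int (ptr j + 1 + (if r j = [] then 0 else Suc k)),
        12 := first j k, 13 := diff j k, 19 := z)"
  define I where "I l s1 \<longleftrightarrow> base s1 \<and> reg s1 8 = int (length (r j)) \<and> reg s1 16 = int (a j) \<and>
      reg s1 7 = int (ptr j + 1 + (if r j = [] then 0 else Suc k)) \<and>
      reg s1 12 = first j k \<and> reg s1 13 = diff j k \<and> reg s1 11 = int (lower j (c * k + l)) \<and>
      reg s1 14 = int (a j + 1 + (c * k + l)) \<and> reg s1 17 = int (N j) - int (c * k + l) \<and>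
      reg s1 9 = int (rl j) - int k \<and> reg s1 6 = y \<and> tape s1 = X @ cells (relation_cells j (c * k + l))"
    for l and s1 :: ram
  \<comment> \<open>Both ends of a letter are at the wedge point, so register 11 is 0 between
    letters.\<close>
  have lower0: "lower j (c * k) = 0" "lower j (c * k + c) = 0"
    using walk_lower[OF j(2), of 0] walk_lower[OF j(2), of c] by (simp_all add: walk_def)
  have rl_w: "int (rl j) \<le> w"
    using rl_le_N[of j] N_lt_a[OF j(1)] w_a by linarith
  show "wp w (blk [unroll (rectangle_prog c) c, Sub 9 9 2]) (\<lambda>t'. Q (t + t')) s'"
  proof (rule wp_blk_Cons, rule wp_unroll[where I = I and T = 85], goal_cases)
    case 2
    show ?case using s s' lower0 by (auto simp: I_def base_def)
  next
    case (3 l s1)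
    have step: "relation_cells j (Suc q) = relation_cells j q @ rectangle j q" for q by simp
    from 3 show ?case
      by (intro wp_rectangle_prog[OF j, of l s1 "X @ cells (relation_cells j (c * k + l))"])
        (auto simp: I_def base_def cells_append)
  next
    case (4 t' s1)
    have "c * Suc k = c * k + c" by simp
    with 4 t show ?case
      unfolding I_def
      by (intro wp_blk_single) (use lower0 j(2) rl_w in \<open>auto simp: base_def add.commute[of "c * k" c] intro!: Q\<close>)
  qed (use w_ge_3 in auto)
qed

lemma wp_relation_prog:
  assumes j: "j < m" and s: "base s" "reg s 16 = int (a j)" "reg s 7 = int (ptr j)"
      "reg s 6 = int m - int j" "tape s = X"
    and Q: "\<And>t s'. t \<le> c + rl j * (86 * c + 10) + 12 \<Longrightarrow> base s' \<Longrightarrow> reg s' 16 = int (a (Suc j)) \<Longrightarrow>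
      reg s' 7 = int (ptr (Suc j)) \<Longrightarrow> reg s' 6 = int m - int (Suc j) \<Longrightarrow>
      tape s' = X @ cells (relation_cells j (N j)) \<Longrightarrow> Q t s'"
  shows "wp w (relation_prog c) Q s"
  unfolding relation_prog_def
proof (rule wp_blk_Cons)
  have a_w: "int (a j) + int (N j) + 1 \<le> w"
    using a_le_w[of "Suc j" "a (Suc j)"] j by (simp add: a_Suc)
  have ptr_w: "int (ptr j) + int (length (r j)) + 1 \<le> w"
    using ptr_le_w[of "Suc j" "ptr (Suc j)"] j by (simp add: ptr_Suc)
  have rl_w: "int (rl j) \<le> w" using a_w rl_le_N[of j] by linarith
  have rl: "int (rl j) = (if 0 < length (r j) then int (length (r j)) else 1)"
    by (cases "r j") (simp_all add: rl_def rel_length_def)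
  define inv where "inv s1 \<longleftrightarrow> base s1 \<and> reg s1 8 = int (length (r j)) \<and> reg s1 16 = int (a j) \<and>
    reg s1 6 = int m - int j" for s1 :: ram
  define J where "J l s1 \<longleftrightarrow> inv s1 \<and> reg s1 7 = int (ptr j + 1) \<and> reg s1 9 = int (rl j) \<and>
    reg s1 17 = int (l * rl j) \<and> tape s1 = X" for l and s1 :: ram
  define I where "I k s1 \<longleftrightarrow> inv s1 \<and> reg s1 7 = int (ptr j + 1 + (if r j = [] then 0 else k)) \<and>
    reg s1 11 = 0 \<and> reg s1 14 = int (a j + 1 + c * k) \<and> reg s1 17 = int (N j) - int (c * k) \<and>
    reg s1 9 = int (rl j) - int k \<and> tape s1 = X @ cells (relation_cells j (c * k))" for k and s1 :: ram
  have start: "wp w (blk [Load 8 7, Add 7 7 2, IfPos 8 (Add 9 8 1) (Add 9 2 1), Const 17 0])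
    (\<lambda>t s1. t \<le> 5 \<and> J 0 (set_reg 19 0 s1)) s"
    using s w_ge_3 ptr_w M_length[OF j] by (auto simp: J_def inv_def base_def rl)
  have mult: "wp w (Add 17 17 9) (\<lambda>t s1. t \<le> 1 \<and> J (Suc l) s1) s1" if l: "l < c" and J: "J l s1" for l s1
  proof -
    have "Suc l * rl j \<le> N j" using l unfolding N_def by (intro mult_le_mono1) simp
    then have "int (Suc l * rl j) \<le> w" using a_w by linarith
    moreover have "int (Suc l * rl j) = int (l * rl j) + int (rl j)" by (simp add: algebra_simps)
    moreover have "reg s1 17 = int (l * rl j)" "reg s1 9 = int (rl j)" using J by (simp_all add: J_def)
    ultimately have "\<bar>reg s1 17 + reg s1 9\<bar> \<le> w" by linarith
    then show ?thesis using J by (simp add: J_def inv_def base_def algebra_simps)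
  qed
  have mid: "wp w (blk [Add 14 16 2, Const 11 0]) (\<lambda>t s1. t = 2 \<and> I 0 s1) s1" if "J c s1" for s1
  proof -
    have "int (a j) + 1 \<le> w" using a_w by linarith
    then show ?thesis using that w_ge_3 by (simp add: J_def I_def inv_def base_def N_def)
  qed
  have last: "wp w (blk [Add 16 14 1, Sub 6 6 2]) (\<lambda>t s1. t = 2 \<and> base s1 \<and> reg s1 16 = int (a (Suc j)) \<and>
      reg s1 7 = int (ptr (Suc j)) \<and> reg s1 6 = int m - int (Suc j) \<and>
      tape s1 = X @ cells (relation_cells j (N j))) s1" if I: "I (rl j) s1" for s1
  proof -
    \<comment> \<open>An empty relation counts as one round but occupies no letter cell, so only its
      length entry has been passed.\<close>
    have e: "int (ptr j + 1 + (if r j = [] then 0 else rl j)) = int (ptr (Suc j))"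
      using rl by (auto simp: ptr_Suc)
    have "int (a j + 1 + c * rl j) = int (a (Suc j))" by (simp add: a_Suc N_def)
    moreover have "int (a (Suc j)) \<le> w" using a_w by (simp add: a_Suc)
    ultimately show ?thesis
      using I j m_le_w unfolding I_def inv_def e by (simp add: base_def N_def[symmetric])
  qed
  show "wp w (blk [Load 8 7, Add 7 7 2, IfPos 8 (Add 9 8 1) (Add 9 2 1), Const 17 0])
    (\<lambda>t s. wp w (blk [unroll (\<lambda>_. Add 17 17 9) c, blk [Add 14 16 2, Const 11 0],
     WhilePos 9 (letter_prog c), blk [Add 16 14 1, Sub 6 6 2]]) (\<lambda>t'. Q (t + t')) s) s"
  proof (rule wp_mono[OF start], rule wp_blk_Cons, elim conjE, rule wp_unroll[where I = J and T = 1], goal_cases)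
    case (3 t s l s')
    then show ?case using mult by blast
  next
    case t: (4 t s t' s')
    show ?case
    proof (rule wp_blk_Cons, rule wp_mono[OF mid[OF t(4)]], rule wp_blk_Cons, elim conjE,
        rule wp_WhilePos[where I = I and k = "rl j" and T = "\<lambda>_. 86 * c + 9"], goal_cases)
      case (2 t s k s')
      then show ?case by (auto simp: I_def inv_def intro!: wp_letter_prog[OF j, of k])
    next
      case (3 t s s')
      then show ?case by (simp add: I_def)
    next
      case (4 t2 s2 t3 s3)
      show ?case
        by (rule wp_blk_single, rule wp_mono[OF last[OF 4(4)]], elim conjE, rule Q) (use 4 t in \<open>auto simp: algebra_simps\<close>)
    qed
  qed (use w_ge_3 in auto)
qed

lemma wp_complex_prog:
  "wp w (complex_prog c) (\<lambda>t s. t \<le> 30 + c + 8 * K + (\<Sum>j<m. c + 8 * N j + 21) + n * (13 * c + 11) +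
      (\<Sum>j<m. c + rl j * (86 * c + 10) + 13) \<and>
    tape s = points_code (a m) @ cells (complex_cells m)) (initial_ram (presentation_code P))"
  unfolding complex_prog_def
proof (rule wp_blk_Cons, rule wp_points_prog, rule wp_blk_Cons, rule wp_wedge_prog, assumption, assumption)
  fix t t' :: nat and s s' :: ram
  assume t: "t \<le> 14 + c + 8 * K + (\<Sum>j<m. c + 8 * N j + 20 + 1)" "t' \<le> 8 + n * (13 * c + 11)"
    and s: "base s'" "reg s' 5 = int K" "tape s' = points_code (a m) @ cells (wedge_cells n)"
  define I where "I j s \<longleftrightarrow> base s \<and> reg s 16 = int (a j) \<and> reg s 7 = int (ptr j) \<and>
      reg s 6 = int m - int j \<and> tape s = points_code (a m) @ cells (complex_cells j)" for j and s :: ram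
  have cells_Suc: "cells (complex_cells (Suc j)) = cells (complex_cells j) @ cells (relation_cells j (N j))" for j
    by (simp add: complex_cells_def cells_append)
  have start: "wp w (blk [Add 16 5 2, Const 7 2, Add 6 4 1]) (\<lambda>t s. t = 3 \<and> I 0 s) s'"
    using s w_ge_3 m_le_w K_lt_w by (simp add: I_def base_def a_0 D_def ptr_0 complex_cells_def)
  show "wp w (blk [blk [Add 16 5 2, Const 7 2, Add 6 4 1], WhilePos 6 (relation_prog c)])
     (\<lambda>t'' s. t + (t' + t'') \<le> 30 + c + 8 * K + (\<Sum>j<m. c + 8 * N j + 21) + n * (13 * c + 11) +
      (\<Sum>j<m. c + rl j * (86 * c + 10) + 13) \<and>
    tape s = points_code (a m) @ cells (complex_cells m)) s'"
  proof (rule wp_blk_Cons, rule wp_mono[OF start], rule wp_blk_single, elim conjE,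
      rule wp_WhilePos[where I = I and T = "\<lambda>j. c + rl j * (86 * c + 10) + 12" and k = m], goal_cases)
    case (2 t s j s')
    then show ?case by (auto simp: I_def cells_Suc intro!: wp_relation_prog)
  next
    case (4 t3 s t4 s')
    have "(\<Sum>j<m. c + 8 * N j + 20 + 1) = (\<Sum>j<m. c + 8 * N j + 21)"
      "(\<Sum>j<m. c + rl j * (86 * c + 10) + 12 + 1) = (\<Sum>j<m. c + rl j * (86 * c + 10) + 13)"
      by (intro sum.cong; simp)+
    with 4 t have "t + (t' + (t3 + t4)) \<le> 30 + c + 8 * K + (\<Sum>j<m. c + 8 * N j + 21) + n * (13 * c + 11) +
        (\<Sum>j<m. c + rl j * (86 * c + 10) + 13)" by linarith
    then show ?case using 4(4) unfolding I_def by blast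
  qed (auto simp: I_def)
qed

end

section \<open>The output realizes the model complex\<close>

text \<open>Generators are compared up to containment, not equality, because the degenerate
  triangles of an empty relation occur in the output only as faces of other cells.\<close>

lemma generated_complex_mono:
  assumes "\<And>\<tau>. \<tau> \<in> F \<Longrightarrow> \<exists>\<tau>'\<in>G. \<tau> \<subseteq> \<tau>'"
  shows "generated_complex F \<subseteq> generated_complex G"
proof
  fix \<sigma> assume "\<sigma> \<in> generated_complex F"
  then obtain \<tau> where \<tau>: "\<sigma> \<noteq> {}" "\<tau> \<in> F" "\<sigma> \<subseteq> \<tau>" by (auto simp: generated_complex_def)
  from assms[OF \<tau>(2)] obtain \<tau>' where "\<tau>' \<in> G" "\<tau> \<subseteq> \<tau>'" ..
  moreover from this have "\<sigma> \<subseteq> \<tau>'" using \<tau>(3) by simp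
  ultimately show "\<sigma> \<in> generated_complex G" using \<tau>(1) by (auto simp: generated_complex_def)
qed

lemma image_generated_complex:
  "(`) f ` generated_complex F = generated_complex ((`) f ` F)"
proof (intro equalityI subsetI)
  fix \<sigma> assume "\<sigma> \<in> generated_complex ((`) f ` F)"
  then obtain \<tau> where \<tau>: "\<sigma> \<noteq> {}" "\<tau> \<in> F" "\<sigma> \<subseteq> f ` \<tau>" by (auto simp: generated_complex_def)
  \<comment> \<open>A face of an image is the image of the part of the simplex that maps into
    it.\<close>
  have "f ` (\<tau> \<inter> f -` \<sigma>) = \<sigma>" using \<tau>(3) by blast
  moreover from this have "\<tau> \<inter> f -` \<sigma> \<in> generated_complex F"
    using \<tau>(1,2) by (auto simp: generated_complex_def)
  ultimately show "\<sigma> \<in> (`) f ` generated_complex F" by (metis imageI)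
qed (auto simp: generated_complex_def)

lemma Union_generated_complex: "\<Union>(generated_complex F) = \<Union>F"
  by (auto simp: generated_complex_def)

lemma set_faces: "set ` set (faces xs) = {\<sigma>. \<sigma> \<noteq> {} \<and> \<sigma> \<subseteq> set xs}"
proof -
  have "set ` set (faces xs) = set ` set (subseqs xs) - {{}}"
    by (auto simp: faces_def)
  then show ?thesis by (auto simp: subseqs_powset)
qed

lemma set_faces_concat:
  "set ` set (concat (map faces gs)) = generated_complex (set ` set gs)"
proof -
  have "set ` set (concat (map faces gs)) = (\<Union>g\<in>set gs. set ` set (faces g))" by auto
  then show ?thesis by (auto simp: set_faces generated_complex_def)
qed

lemma faces_map: "faces (map f xs) = map (map f) (faces xs)"
proof -
  have "subseqs (map f xs) = map (map f) (subseqs xs)"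
    by (induction xs) (simp_all add: Let_def)
  then show ?thesis by (simp add: faces_def filter_map comp_def)
qed

lemma distinct_faces: "distinct xs \<Longrightarrow> ys \<in> set (faces xs) \<Longrightarrow> distinct ys"
  using subseqs_distinctD by (auto simp: faces_def)

lemma length_faces: "length xs \<le> 3 \<Longrightarrow> length (faces xs) \<le> 8"
proof -
  assume "length xs \<le> 3"
  then have "(2::nat) ^ length xs \<le> 2 ^ 3" by (intro power_increasing) auto
  then show ?thesis
    using length_filter_le[of "\<lambda>ys. ys \<noteq> []" "subseqs xs"] by (simp add: faces_def length_subseqs)
qed

text \<open>Hence shapes need to be checked only for the cells passed to
  \<open>faces\<close>.\<close>

lemma (in layout) simplex_shape_subset:
  assumes "simplex_shape \<sigma>" "\<tau> \<subseteq> \<sigma>"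
  shows "simplex_shape \<tau>"
  using assms
proof (cases rule: simplex_shape.cases)
  case (wedge k)
  then show ?thesis using assms(2) by (intro simplex_shape.wedge[of _ k]) auto
next
  case (path k j q)
  then show ?thesis using assms(2) by (intro simplex_shape.path[of _ k j q]) auto
next
  case (closing j)
  then show ?thesis using assms(2) by (intro simplex_shape.closing[of j]) auto
next
  case (disk j q)
  then show ?thesis using assms(2) by (intro simplex_shape.disk[of j q]) auto
next
  case (closing_disk j)
  then show ?thesis using assms(2) by (intro simplex_shape.closing_disk[of j]) auto
qed

lemma (in layout) interval_cover:
  "D \<le> v \<Longrightarrow> v < a k \<Longrightarrow> \<exists>j<k. a j \<le> v \<and> v \<le> a j + N j"
proof (induction k)
  case (Suc k)
  show ?case
  proof (cases "v < a k")
    case True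
    then show ?thesis using Suc less_SucI by blast
  next
    case False
    then show ?thesis using Suc.prems by (intro exI[of _ k]) (simp add: a_Suc)
  qed
qed (simp add: a_0)

context pres_layout
begin

definition vertices :: "vertex set" where
  "vertices = {Base} \<union> {Circ i l | i l. i < n \<and> 0 < l \<and> l < c} \<union>
     {Apex j | j. j < m} \<union> {Upper j l | j l. j < m \<and> l < N j}"

definition generators :: "vertex set set" where
  "generators = {{Base}} \<union> (\<Union>i<n. \<Union>l<c. {{circ c i l, circ c i (l + 1)}}) \<union>
     (\<Union>j<m. relation_triangles c j (r j))"

lemma model_complex_eq: "model_complex c P = generated_complex generators"
  by (simp add: model_complex_def generators_def n_def m_def r_def)

lemma circ_eq: "l \<le> c \<Longrightarrow> circ c i l = (if l = 0 \<or> l = c then Base else Circ i l)"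
  using c_ge_3 by (cases "l = c") (auto simp: circ_def)

lemma index_Circ_bounds: "i < n \<Longrightarrow> l < c \<Longrightarrow> i * (c - 1) + l < D"
proof -
  assume il: "i < n" "l < c"
  then have "i * (c - 1) + l \<le> Suc i * (c - 1)" by simp
  also have "\<dots> \<le> n * (c - 1)" using il by (intro mult_le_mono1) simp
  finally show ?thesis by (simp add: D_def K_def)
qed

text \<open>As \<open>l\<close> runs from 1 to \<open>c - 1\<close>, lowering it by one turns it
  into a remainder modulo \<open>c - 1\<close>, and division recovers both parts.\<close>

lemma index_Circ_inj:
  assumes "i * (c - 1) + l = i' * (c - 1) + l'" "0 < l" "l < c" "0 < l'" "l' < c"
  shows "i = i' \<and> l = l'"
proof -
  have *: "(i * (c - 1) + l - 1) div (c - 1) = i \<and> (i * (c - 1) + l - 1) mod (c - 1) = l - 1"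
    if "0 < l" "l < c" for i l
  proof -
    have "i * (c - 1) + l - 1 = (l - 1) + i * (c - 1)" using that by simp
    moreover have "l - 1 < c - 1" using that by simp
    ultimately show ?thesis by simp
  qed
  have "i = i'" "l - 1 = l' - 1" using *[of l i] *[of l' i'] assms by auto
  then show ?thesis using assms by simp
qed

lemma inj_on_index: "inj_on index vertices"
proof (rule inj_onI)
  fix u v assume uv: "u \<in> vertices" "v \<in> vertices" "index u = index v"
  have D0: "0 < a j" "D \<le> a j" for j using D_le_a[of j] D_pos by auto
  have aj: "i = j" if "a i + x = a j + y" "x \<le> N i" "y \<le> N j" for i j x y
    using interval_unique[of i "a i + x" j] that by auto
  show "u = v"
  proof (cases u; cases v)
    fix i l i' l' assume "u = Circ i l" "v = Circ i' l'"
    then show ?thesis using uv index_Circ_inj[of i l i' l'] by (auto simp: vertices_def)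
  next
    fix j l j' l' assume e: "u = Upper j l" "v = Upper j' l'"
    then show ?thesis using uv aj[of j "1 + l" j' "1 + l'"] by (auto simp: vertices_def)
  next
    fix j l j' assume e: "u = Upper j l" "v = Apex j'"
    then show ?thesis using uv aj[of j "1 + l" j' 0] by (auto simp: vertices_def)
  next
    fix j l j' assume e: "u = Apex j'" "v = Upper j l"
    then show ?thesis using uv aj[of j "1 + l" j' 0] by (auto simp: vertices_def)
  next
    fix j j' assume e: "u = Apex j" "v = Apex j'"
    then show ?thesis using uv aj[of j 0 j' 0] by (auto simp: vertices_def)
  next
    fix i l j assume "u = Circ i l" "v = Apex j"
    then show ?thesis using uv index_Circ_bounds[of i l] D0[of j] by (auto simp: vertices_def)
  next
    fix i l j assume "v = Circ i l" "u = Apex j"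
    then show ?thesis using uv index_Circ_bounds[of i l] D0[of j] by (auto simp: vertices_def)
  next
    fix i l j k assume "u = Circ i l" "v = Upper j k"
    then show ?thesis using uv index_Circ_bounds[of i l] D0[of j] by (auto simp: vertices_def)
  next
    fix i l j k assume "v = Circ i l" "u = Upper j k"
    then show ?thesis using uv index_Circ_bounds[of i l] D0[of j] by (auto simp: vertices_def)
  next
    fix j assume "v = Base" "u = Apex j"
    then show ?thesis using uv D0[of j] by auto
  next
    fix j assume "u = Base" "v = Apex j"
    then show ?thesis using uv D0[of j] by auto
  qed (use uv in \<open>auto simp: vertices_def\<close>)
qed

lemma index_image: "index ` vertices = {..<a m}"
proof (intro equalityI subsetI)
  fix v assume "v \<in> index ` vertices"
  then obtain u where u: "u \<in> vertices" "v = index u" by auto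
  show "v \<in> {..<a m}"
  proof (cases u)
    case Base
    then show ?thesis using u D_le_a[of m] D_pos by simp
  next
    case (Circ i l)
    then show ?thesis using u index_Circ_bounds[of i l] D_le_a[of m] by (auto simp: vertices_def)
  next
    case (Upper j l)
    then show ?thesis using u a_less[of j m] by (auto simp: vertices_def)
  next
    case (Apex j)
    then show ?thesis using u a_less[of j m] by (auto simp: vertices_def)
  qed
next
  fix v assume v: "v \<in> {..<a m}"
  consider "v = 0" | "0 < v" "v < D" | "D \<le> v" by linarith
  then show "v \<in> index ` vertices"
  proof cases
    case 1
    then show ?thesis by (intro image_eqI[of _ _ Base]) (auto simp: vertices_def)
  next
    case 2
    define i l where "i = (v - 1) div (c - 1)" and "l = (v - 1) mod (c - 1)"
    have e: "v = i * (c - 1) + (l + 1)"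
      using 2(1) div_mult_mod_eq[of "v - 1" "c - 1"] by (simp add: i_def l_def)
    have "l < c - 1" using c_ge_3 by (simp add: l_def)
    moreover have "i < n"
    proof (rule ccontr)
      assume "\<not> i < n"
      then have "n * (c - 1) \<le> i * (c - 1)" by (intro mult_le_mono1) simp
      then show False using e 2(2) unfolding D_def K_def by linarith
    qed
    ultimately show ?thesis using e
      by (intro image_eqI[of _ _ "Circ i (l + 1)"]) (auto simp: vertices_def)
  next
    case 3
    then obtain j where j: "j < m" "a j \<le> v" "v \<le> a j + N j"
      using interval_cover[of v m] v by auto
    show ?thesis
    proof (cases "v = a j")
      case True
      then show ?thesis using j by (intro image_eqI[of _ _ "Apex j"]) (auto simp: vertices_def)
    next
      case False
      then show ?thesis using j
        by (intro image_eqI[of _ _ "Upper j (v - a j - 1)"]) (auto simp: vertices_def)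
    qed
  qed
qed

text \<open>Every step of the attaching path crosses one edge of a circle. At the seams between
  letters \<open>lower_vertex\<close> is the wedge point by definition, and the formulas for the
  adjacent letters agree with it.\<close>

lemma lower_edge:
  assumes j: "j < m" "r j \<noteq> []" and q: "q < N j"
  obtains i p where "i < n" "p < c"
    "{lower_vertex c (r j) q, lower_vertex c (r j) (Suc q)} = {circ c i p, circ c i (Suc p)}"
proof -
  define k l where "k = q div c" and "l = q mod c"
  have e: "q = c * k + l" and l: "l < c" using c_ge_3 by (simp_all add: k_def l_def)
  have rl: "rl j = length (r j)" using j(2) by (cases "r j") (auto simp: rl_def rel_length_def)
  have "k < length (r j)" using q rl c_ge_3 by (simp add: k_def N_def less_mult_imp_div_less mult.commute)
  then have i: "gen_of (r j ! k) < n" by (rule letter_bound[OF j(1)])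
  have kc: "c * k mod c = 0" "c * k div c = k" using c_ge_3 by auto
  have 0: "lower_vertex c (r j) q = letter_vertex c (r j ! k) l"
  proof (cases "l = 0")
    case True
    then have "q mod c = 0" by (simp add: l_def)
    then show ?thesis using True by (cases "r j ! k") (auto simp: lower_vertex_def circ_def)
  qed (use j(2) in \<open>simp add: lower_vertex_def k_def l_def\<close>)
  have 1: "lower_vertex c (r j) (Suc q) = letter_vertex c (r j ! k) (Suc l)"
  proof (cases "Suc l = c")
    case True
    have "Suc q = c * Suc k" using e True by simp
    then have "Suc q mod c = 0" by (metis mod_mult_self1_is_0)
    then show ?thesis using True by (cases "r j ! k") (auto simp: lower_vertex_def circ_def)
  next
    case False
    then have "Suc l < c" using l by simp
    moreover have "Suc q = c * k + Suc l" using e by simp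
    moreover have "(c * k + x) mod c = x" "(c * k + x) div c = k" if "x < c" for x using that by auto
    ultimately have "Suc q mod c = Suc l" "Suc q div c = k" by metis+
    then show ?thesis using j(2) by (simp add: lower_vertex_def)
  qed
  show thesis
  proof (cases "r j ! k")
    case (Gen i)
    then show thesis using that[of i l] 0 1 l \<open>gen_of (r j ! k) < n\<close> by simp
  next
    case (Inv i)
    \<comment> \<open>An inverse letter crosses the edge from \<open>c - l\<close> down to
      \<open>c - Suc l\<close>, so the lower end names the edge.\<close>
    have "c - l = Suc (c - Suc l)" using l by simp
    then show thesis using that[of i "c - Suc l"] 0 1 l Inv \<open>gen_of (r j ! k) < n\<close> by auto
  qed
qed

lemma N_mod: "N j mod c = 0"
  by (simp add: N_def)

lemma circ_vertex: "i < n \<Longrightarrow> circ c i l \<in> vertices" if "l \<le> c"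
  using that by (auto simp: circ_eq vertices_def)

text \<open>Leaving out the label 0 is what makes the labels consecutive: an edge at the base point
  keeps one label, and any other edge joins neighbours on its circle.\<close>

lemma circ_edge:
  assumes "i < n" "p < c"
  shows "circ c i p \<noteq> circ c i (Suc p)"
    and "\<exists>k. {index (circ c i p), index (circ c i (Suc p))} \<inter> {0<..<D} \<subseteq> {k, k + 1}"
    and "{index (circ c i p), index (circ c i (Suc p))} \<subseteq> {..<D}"
proof -
  show "circ c i p \<noteq> circ c i (Suc p)" using assms c_ge_3 by (auto simp: circ_eq)
  show "\<exists>k. {index (circ c i p), index (circ c i (Suc p))} \<inter> {0<..<D} \<subseteq> {k, k + 1}"
    using assms by (intro exI[of _ "i * (c - 1) + p"]) (auto simp: circ_eq)
  have "index (circ c i l) < D" if "l \<le> c" for l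
    using index_Circ_bounds[OF assms(1), of l] D_pos that by (auto simp: circ_eq)
  then show "{index (circ c i p), index (circ c i (Suc p))} \<subseteq> {..<D}" using assms by simp
qed

lemma lower_pair:
  assumes j: "j < m" and q: "q < N j"
  shows "\<exists>k. {lower j q, lower j (Suc q)} \<inter> {0<..<D} \<subseteq> {k, k + 1}"
    and "{lower j q, lower j (Suc q)} \<subseteq> {..<D}"
    and "r j \<noteq> [] \<Longrightarrow> lower j q \<noteq> lower j (Suc q)"
    and "{lower_vertex c (r j) q, lower_vertex c (r j) (Suc q)} \<subseteq> vertices"
proof -
  have "(\<exists>k. {lower j q, lower j (Suc q)} \<inter> {0<..<D} \<subseteq> {k, k + 1}) \<and>
    {lower j q, lower j (Suc q)} \<subseteq> {..<D} \<and> (r j \<noteq> [] \<longrightarrow> lower j q \<noteq> lower j (Suc q)) \<and>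
    {lower_vertex c (r j) q, lower_vertex c (r j) (Suc q)} \<subseteq> vertices"
  proof (cases "r j = []")
    case True
    then show ?thesis using D_pos by (auto simp: lower_def lower_vertex_def vertices_def)
  next
    case False
    obtain i p where ip: "i < n" "p < c"
      and e: "{lower_vertex c (r j) q, lower_vertex c (r j) (Suc q)} = {circ c i p, circ c i (Suc p)}"
      using lower_edge[OF j False q] by blast
    have "{lower j q, lower j (Suc q)} = index ` {lower_vertex c (r j) q, lower_vertex c (r j) (Suc q)}"
      by (simp add: lower_def)
    then have e': "{lower j q, lower j (Suc q)} = {index (circ c i p), index (circ c i (Suc p))}"
      unfolding e by simp
    have v: "{circ c i p, circ c i (Suc p)} \<subseteq> vertices" using circ_vertex ip by simp
    have "index (circ c i p) \<noteq> index (circ c i (Suc p))"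
      using circ_edge(1)[OF ip] inj_on_index v by (auto dest: inj_onD)
    then have "lower j q \<noteq> lower j (Suc q)" using e' by (metis doubleton_eq_iff)
    then show ?thesis unfolding e e' using circ_edge(2,3)[OF ip] v by blast
  qed
  note c = this
  show "\<exists>k. {lower j q, lower j (Suc q)} \<inter> {0<..<D} \<subseteq> {k, k + 1}" by (rule c[THEN conjunct1])
  show "{lower j q, lower j (Suc q)} \<subseteq> {..<D}" by (rule c[THEN conjunct2, THEN conjunct1])
  show "r j \<noteq> [] \<Longrightarrow> lower j q \<noteq> lower j (Suc q)"
    by (rule c[THEN conjunct2, THEN conjunct2, THEN conjunct1, rule_format])
  show "{lower_vertex c (r j) q, lower_vertex c (r j) (Suc q)} \<subseteq> vertices"
    by (rule c[THEN conjunct2, THEN conjunct2, THEN conjunct2])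
qed

lemma relation_triangles_eq:
  "relation_triangles c j (r j) =
    (\<Union>q<N j. {{lower_vertex c (r j) q, lower_vertex c (r j) (Suc q), Upper j q},
       {lower_vertex c (r j) (Suc q), Upper j q, Upper j (Suc q mod N j)},
       {Upper j q, Upper j (Suc q mod N j), Apex j}})"
  by (simp add: relation_triangles_def Let_def N_def rl_def)

lemma disk_triangle_generator:
  assumes "j < m" "q < N j"
  shows "{Upper j q, Upper j (Suc q mod N j), Apex j} \<in> generators"
proof -
  have "{Upper j q, Upper j (Suc q mod N j), Apex j} \<in> relation_triangles c j (r j)"
    unfolding relation_triangles_eq using assms(2) by (intro UN_I[of q]) auto
  then show ?thesis using assms(1) unfolding generators_def by (intro UnI2 UN_I[of j]) auto
qed

lemma Union_generators: "\<Union>generators = vertices"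
proof (intro equalityI subsetI)
  fix v assume "v \<in> \<Union>generators"
  then consider "v = Base" | i l where "i < n" "l < c" "v \<in> {circ c i l, circ c i (Suc l)}"
    | j q where "j < m" "q < N j" "v \<in> {lower_vertex c (r j) q, lower_vertex c (r j) (Suc q),
        Upper j q, Upper j (Suc q mod N j), Apex j}"
    unfolding generators_def relation_triangles_eq by auto
  then show "v \<in> vertices"
  proof cases
    case 2
    then show ?thesis using circ_vertex by auto
  next
    case 3
    have "Suc q mod N j < N j" using N_ge[of j] by simp
    then show ?thesis using 3 lower_pair(4)[OF 3(1,2)] by (auto simp: vertices_def)
  qed (simp add: vertices_def)
next
  fix v assume v: "v \<in> vertices"
  show "v \<in> \<Union>generators"
  proof (cases v)
    case Base
    then show ?thesis by (auto simp: generators_def)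
  next
    case (Circ i l)
    then have "i < n" "l < c" "v = circ c i l" using v by (auto simp: vertices_def circ_eq)
    then show ?thesis unfolding generators_def by blast
  next
    case (Upper j l)
    then have "j < m" "l < N j" using v by (auto simp: vertices_def)
    then show ?thesis using disk_triangle_generator Upper by blast
  next
    case (Apex j)
    then have "j < m" "0 < N j" using v N_ge[of j] by (auto simp: vertices_def)
    then show ?thesis using disk_triangle_generator Apex by blast
  qed
qed

lemma upper_eq: "q < N j \<Longrightarrow> upper j q = a j + 1 + q"
  "q < N j \<Longrightarrow> upper j (Suc q) = (if Suc q = N j then a j + 1 else a j + 1 + Suc q)"
  by (auto simp: upper_def)

lemma upper_bounds: "a j < upper j q" "upper j q \<le> a j + N j" "D \<le> upper j q" "D < upper j q"
proof -
  have "q mod N j < N j" using N_ge[of j] by simp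
  then show "a j < upper j q" "upper j q \<le> a j + N j" "D \<le> upper j q" "D < upper j q"
    using D_le_a[of j] by (auto simp: upper_def)
qed

lemma upper_neq: "q < N j \<Longrightarrow> upper j q \<noteq> upper j (Suc q)"
  using N_ge[of j] by (auto simp: upper_eq)

lemma lower_less: "j < m \<Longrightarrow> q < N j \<Longrightarrow> lower j q < D" "j < m \<Longrightarrow> q < N j \<Longrightarrow> lower j (Suc q) < D"
  using lower_pair(2) by blast+

lemma complex_cells_cases:
  assumes "g \<in> set (complex_cells m)"
  obtains "g = [0]"
  | i p where "i < n" "p < c" "g = [index (circ c i p), index (circ c i (Suc p))]"
  | j q where "j < m" "q < N j" "r j \<noteq> []" "g = [lower j q, lower j (Suc q), upper j q]"
  | j q where "j < m" "q < N j" "g = [lower j (Suc q), upper j q, upper j (Suc q)]"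
  | j q where "j < m" "q < N j" "g = [upper j q, upper j (Suc q), a j]"
  using assms
  by (auto simp: complex_cells_def wedge_cells_def circle_cells_def relation_cells_def rectangle_def
      split: if_splits)

lemma circ_indices_distinct:
  "i < n \<Longrightarrow> p < c \<Longrightarrow> index (circ c i p) \<noteq> index (circ c i (Suc p))"
  using circ_edge(1) circ_vertex inj_onD[OF inj_on_index] Suc_leI less_imp_le by metis

lemma complex_cells_distinct: "g \<in> set (complex_cells m) \<Longrightarrow> distinct g"
proof (erule complex_cells_cases, goal_cases)
  case (2 i p)
  then show ?case using circ_indices_distinct by simp
next
  case (3 j q)
  then show ?case using lower_pair(3)[OF 3(1-3)] lower_less[OF 3(1,2)] upper_bounds(4)[of j q] by auto
next
  case (4 j q)
  then show ?case using upper_neq[OF 4(2)] lower_less[OF 4(1,2)] upper_bounds(4)[of j q] upper_bounds(4)[of j "Suc q"]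
    by auto
next
  case (5 j q)
  then show ?case using upper_neq[OF 5(2)] upper_bounds(1)[of j q] upper_bounds(1)[of j "Suc q"] by auto
qed simp

lemma complex_cells_length: "g \<in> set (complex_cells m) \<Longrightarrow> length g \<le> 3"
  by (erule complex_cells_cases) auto

lemma complex_cells_shape: "g \<in> set (complex_cells m) \<Longrightarrow> simplex_shape (set g)"
proof (erule complex_cells_cases, goal_cases)
  case 1
  then show ?case using D_pos by (intro simplex_shape.wedge[of _ 0]) auto
next
  case (2 i p)
  then obtain k where "set g \<inter> {0<..<D} \<subseteq> {k, k + 1}" using circ_edge(2)[of i p] by auto
  then show ?case using 2 circ_edge(3)[of i p] by (intro simplex_shape.wedge[of _ k]) auto
next
  case (3 j q)
  obtain k where "{lower j q, lower j (Suc q)} \<inter> {0<..<D} \<subseteq> {k, k + 1}"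
    using lower_pair(1)[OF 3(1,2)] by blast
  moreover have "\<not> upper j q < D" using upper_bounds(3)[of j q] by simp
  ultimately have k: "set g \<inter> {0<..<D} \<subseteq> {k, k + 1}" using 3(4) by auto
  have u: "set g \<inter> {D..} \<subseteq> {upper j q}" using 3 lower_less[OF 3(1,2)] by auto
  show ?case
  \<comment> \<open>The only upper vertex must be placed in a pair of consecutive labels inside the
    cycle; the last vertex is paired with its predecessor, every other one with its
    successor.\<close>
  proof (cases "Suc q = N j")
    case True
    then show ?thesis using u 3(1,2) N_ge[of j]
      by (intro simplex_shape.path[OF k 3(1), of "a j + q"]) (auto simp: upper_eq)
  next
    case False
    then show ?thesis using u 3(1,2)
      by (intro simplex_shape.path[OF k 3(1), of "a j + 1 + q"]) (auto simp: upper_eq)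
  qed
next
  case (4 j q)
  show ?case
  proof (cases "Suc q = N j")
    case True
    \<comment> \<open>The annulus closes after a multiple of \<open>c\<close> steps, where the path
      is at the wedge point; this is why the closing triangle contains no wedge vertex but the
      origin.\<close>
    then have "Suc q mod c = 0" using N_mod[of j] by simp
    then have "lower j (Suc q) = 0" by (simp add: lower_def lower_vertex_def)
    moreover have "upper j q = a j + N j" "upper j (Suc q) = a j + 1"
      using True 4(2) by (simp_all add: upper_eq True[symmetric])
    ultimately show ?thesis using 4(1,3) by (intro simplex_shape.closing[of j]) auto
  next
    case False
    obtain k where "{lower j q, lower j (Suc q)} \<inter> {0<..<D} \<subseteq> {k, k + 1}"
      using lower_pair(1)[OF 4(1,2)] by blast
    moreover have "\<not> upper j q < D" "\<not> upper j (Suc q) < D"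
      using upper_bounds(3)[of j q] upper_bounds(3)[of j "Suc q"] by simp_all
    ultimately have k: "set g \<inter> {0<..<D} \<subseteq> {k, k + 1}" using 4(3) by auto
    have "set g \<inter> {D..} \<subseteq> {upper j q, upper j (Suc q)}" using 4 lower_less[OF 4(1,2)] by auto
    then show ?thesis using 4(1,2) False
      by (intro simplex_shape.path[OF k 4(1), of "a j + 1 + q"]) (auto simp: upper_eq)
  qed
next
  case (5 j q)
  show ?case
  proof (cases "Suc q = N j")
    case True
    have "upper j q = a j + N j" "upper j (Suc q) = a j + 1"
      using True 5(2) by (simp_all add: upper_eq True[symmetric])
    then show ?thesis using 5(1,3) by (intro simplex_shape.closing_disk[of j]) auto
  next
    case False
    then show ?thesis using 5 by (intro simplex_shape.disk[of j "a j + 1 + q"]) (auto simp: upper_eq)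
  qed
qed

lemma cells_generate:
  "generated_complex (set ` set (complex_cells m)) = (`) index ` model_complex c P"
  unfolding model_complex_eq image_generated_complex
proof (intro equalityI generated_complex_mono)
  fix \<tau> assume "\<tau> \<in> set ` set (complex_cells m)"
  then obtain g where g: "g \<in> set (complex_cells m)" "\<tau> = set g" by blast
  have circle: "{circ c i p, circ c i (Suc p)} \<in> generators" if "i < n" "p < c" for i p
    using that unfolding generators_def by auto
  have triangle: "\<sigma> \<in> generators" if "j < m" "\<sigma> \<in> relation_triangles c j (r j)" for j \<sigma>
    using that unfolding generators_def by auto
  from g(1) have "\<exists>\<sigma>\<in>generators. \<tau> = index ` \<sigma>"
  proof (cases rule: complex_cells_cases)
    case 1
    then show ?thesis using g(2) by (intro bexI[of _ "{Base}"]) (auto simp: generators_def)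
  next
    case (2 i p)
    then show ?thesis using g(2) circle by (intro bexI[of _ "{circ c i p, circ c i (Suc p)}"]) auto
  next
    case (3 j q)
    then show ?thesis using g(2)
      by (intro bexI[of _ "{lower_vertex c (r j) q, lower_vertex c (r j) (Suc q), Upper j q}"] triangle)
        (auto simp: lower_def upper_def relation_triangles_eq)
  next
    case (4 j q)
    then show ?thesis using g(2)
      by (intro bexI[of _ "{lower_vertex c (r j) (Suc q), Upper j q, Upper j (Suc q mod N j)}"] triangle)
        (auto simp: lower_def upper_def relation_triangles_eq)
  next
    case (5 j q)
    then show ?thesis using g(2)
      by (intro bexI[of _ "{Upper j q, Upper j (Suc q mod N j), Apex j}"] triangle)
        (auto simp: upper_def relation_triangles_eq)
  qed
  then show "\<exists>\<tau>'\<in>(`) index ` generators. \<tau> \<subseteq> \<tau>'" by blast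
next
  fix \<tau> assume "\<tau> \<in> (`) index ` generators"
  then obtain \<sigma> where \<sigma>: "\<sigma> \<in> generators" "\<tau> = index ` \<sigma>" by blast
  have wedge: "g \<in> set (complex_cells m)" if "g \<in> set (wedge_cells n)" for g
    using that by (simp add: complex_cells_def)
  have rect: "g \<in> set (complex_cells m)" if "j < m" "q < N j" "g \<in> set (rectangle j q)" for g j q
    using that by (force simp: complex_cells_def relation_cells_def)
  from \<sigma>(1) consider "\<sigma> = {Base}" | i p where "i < n" "p < c" "\<sigma> = {circ c i p, circ c i (Suc p)}"
    | j q where "j < m" "q < N j" "\<sigma> = {lower_vertex c (r j) q, lower_vertex c (r j) (Suc q), Upper j q}"
    | j q where "j < m" "q < N j" "\<sigma> = {lower_vertex c (r j) (Suc q), Upper j q, Upper j (Suc q mod N j)}"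
    | j q where "j < m" "q < N j" "\<sigma> = {Upper j q, Upper j (Suc q mod N j), Apex j}"
    unfolding generators_def relation_triangles_eq by auto
  then have "\<exists>g\<in>set (complex_cells m). index ` \<sigma> \<subseteq> set g"
  proof cases
    case 1
    then show ?thesis by (intro bexI[of _ "[0]"] wedge) (auto simp: wedge_cells_def)
  next
    case (2 i p)
    have "[index (circ c i p), index (circ c i (Suc p))] \<in> set (circle_cells i c)"
      using 2 by (auto simp: circle_cells_def)
    moreover have "set (circle_cells i c) \<subseteq> set (wedge_cells n)"
      using 2(1) by (auto simp: wedge_cells_def)
    ultimately show ?thesis using 2(3)
      by (intro bexI[of _ "[index (circ c i p), index (circ c i (Suc p))]"] wedge) auto
  next
    case (3 j q)
    show ?thesis
    proof (cases "r j = []")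
      \<comment> \<open>The degenerate triangle is not among the cells; it lies in the second
        triangle of its rectangle.\<close>
      case True
      then show ?thesis using 3
        by (intro bexI[of _ "[lower j (Suc q), upper j q, upper j (Suc q)]"] rect[of j q])
          (auto simp: rectangle_def upper_def lower_def lower_vertex_def)
    next
      case False
      then show ?thesis using 3
        by (intro bexI[of _ "[lower j q, lower j (Suc q), upper j q]"] rect[of j q])
          (auto simp: rectangle_def upper_def lower_def)
    qed
  next
    case (4 j q)
    then show ?thesis
      by (intro bexI[of _ "[lower j (Suc q), upper j q, upper j (Suc q)]"] rect[of j q])
        (auto simp: rectangle_def upper_def lower_def)
  next
    case (5 j q)
    then show ?thesis
      by (intro bexI[of _ "[upper j q, upper j (Suc q), a j]"] rect[of j q])
        (auto simp: rectangle_def upper_def)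
  qed
  then show "\<exists>\<tau>'\<in>set ` set (complex_cells m). \<tau> \<subseteq> \<tau>'" using \<sigma>(2) by blast
qed

section \<open>The output as a realization\<close>

definition out_points where "out_points = map pt [0..<a m]"
definition out_simplices where "out_simplices = concat (map faces (complex_cells m))"

lemma output_code_eq:
  "output_code out_points out_simplices = points_code (a m) @ cells (complex_cells m)"
  by (simp add: output_code_def out_points_def out_simplices_def points_code_def cells_def cells_code_def
      faces_map comp_def map_concat)

lemma out_simplices_complex: "set ` set out_simplices = (`) index ` model_complex c P"
  unfolding out_simplices_def set_faces_concat cells_generate ..

lemma Union_out: "\<Union>(set ` set out_simplices) = {..<a m}"
proof -
  have "\<Union>(set ` set out_simplices) = index ` \<Union>(model_complex c P)"
    unfolding out_simplices_complex by blast
  also have "\<dots> = {..<a m}"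
    unfolding model_complex_eq Union_generated_complex Union_generators index_image ..
  finally show ?thesis .
qed

lemma realizes_out: "realizes out_points out_simplices (model_complex c P)"
proof -
  define L where "L = set ` set out_simplices"
  have L: "L = generated_complex (set ` set (complex_cells m))"
    unfolding L_def out_simplices_def set_faces_concat ..
  have UL: "\<Union>L = {..<a m}" using Union_out by (simp add: L_def)
  have shape: "simplex_shape \<sigma>" if "\<sigma> \<in> L" for \<sigma>
  proof -
    from that obtain g where "g \<in> set (complex_cells m)" "\<sigma> \<subseteq> set g" by (auto simp: L generated_complex_def)
    then show ?thesis using complex_cells_shape simplex_shape_subset by blast
  qed
  have same: "linear_extension L (\<lambda>v. point_vector (out_points ! v)) = linear_extension L (\<lambda>v. point_vector (pt v))"
    unfolding linear_extension_def UL by (intro ext sum.cong) (auto simp: out_points_def)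
  have "linearly_embeds L (\<lambda>v. point_vector (out_points ! v))"
  proof (rule linearly_embedsI)
    show "finite L" by (simp add: L_def)
    show "finite \<sigma>" if "\<sigma> \<in> L" for \<sigma> using that by (auto simp: L_def)
    show "\<tau> \<in> L" if "\<sigma> \<in> L" "\<tau> \<subseteq> \<sigma>" "\<tau> \<noteq> {}" for \<sigma> \<tau>
    proof -
      from that(1) obtain g where "g \<in> set (complex_cells m)" "\<sigma> \<subseteq> set g"
        by (auto simp: L generated_complex_def)
      moreover from this have "\<tau> \<subseteq> set g" using that(2) by simp
      ultimately show ?thesis using that(3) by (auto simp: L generated_complex_def)
    qed
    show "inj_on (linear_extension L (\<lambda>v. point_vector (out_points ! v))) (geom_real L)"
      unfolding same using UL shape by (rule inj_linear_extension)
  qed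
  moreover have "complex_isomorphic (model_complex c P) L"
    unfolding complex_isomorphic_def
  proof (intro exI conjI)
    show "L = (`) index ` model_complex c P" unfolding L_def by (rule out_simplices_complex)
    show "bij_betw index (\<Union>(model_complex c P)) (\<Union>L)"
      unfolding model_complex_eq Union_generated_complex Union_generators UL
      using inj_on_index index_image by (simp add: bij_betw_def)
  qed
  moreover have "\<forall>\<sigma>\<in>set out_simplices. distinct \<sigma>"
    using complex_cells_distinct distinct_faces by (auto simp: out_simplices_def)
  ultimately show ?thesis
    using UL unfolding realizes_def Let_def L_def[symmetric] by (simp add: out_points_def)
qed

section \<open>Linear bounds for numbers, size and time\<close>

lemma a_m_eq: "a m = 1 + K + c * (\<Sum>j<m. rl j) + m"
  unfolding a_def D_def sum.distrib N_def sum_distrib_left[symmetric] by simp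

lemma m_le_sum: "m \<le> (\<Sum>j<m. rl j)"
proof -
  have "(\<Sum>j<m. 1) \<le> (\<Sum>j<m. rl j)" by (intro sum_mono rl_pos)
  then show ?thesis by simp
qed

lemma K_le: "K \<le> c * n"
  by (simp add: K_def mult.commute)

text \<open>Turns bounds with an additive constant into linear ones, also for the presentation
  without generators and relations, whose size is 0.\<close>

lemma affine_le_max: "(x::nat) + y * u \<le> (x + y) * max 1 u"
proof -
  have "x * 1 + y * u \<le> x * max 1 u + y * max 1 u" by (intro add_mono mult_le_mono) auto
  then show ?thesis by (simp only: add_mult_distrib mult_1_right)
qed

lemma a_m_le: "a m \<le> (c + 2) * max 1 (unary_size P)"
proof -
  have "a m \<le> 1 + (c + 1) * unary_size P"
    using K_le m_le_sum unfolding a_m_eq size_eq by (simp add: algebra_simps)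
  then show ?thesis using affine_le_max[of 1 "c + 1" "unary_size P"] by simp
qed

text \<open>Each generator has \<open>c - 1\<close> vertices of its own, and each relation at least
  as many upper vertices as its length.\<close>

lemma size_le_a_m: "unary_size P \<le> a m"
proof -
  have "n * 1 \<le> n * (c - 1)" using c_ge_3 by (intro mult_le_mono2) simp
  moreover have "1 * (\<Sum>j<m. rl j) \<le> c * (\<Sum>j<m. rl j)" using c_ge_3 by (intro mult_le_mono1) simp
  ultimately show ?thesis unfolding a_m_eq size_eq K_def by linarith
qed

text \<open>A relation occupies one cell more than its number of letters, at most
  \<open>2 * rl j\<close>, because an empty relation counts as length 1.\<close>

lemma ptr_m_le: "ptr m \<le> 4 * max 1 (unary_size P)"
proof -
  have "(\<Sum>j<m. length (r j) + 1) \<le> (\<Sum>j<m. 2 * rl j)"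
    by (intro sum_mono) (auto simp: rl_def rel_length_def)
  then have "ptr m \<le> 2 + 2 * (\<Sum>j<m. rl j)"
    unfolding ptr_def sum_distrib_left[symmetric] by (rule add_left_mono)
  also have "\<dots> \<le> 2 + 2 * unary_size P" unfolding size_eq by simp
  finally show ?thesis by linarith
qed

lemma card_model_complex: "card (model_complex c P) = card (set ` set out_simplices)"
proof -
  have "inj_on ((`) index) (Pow (\<Union>(model_complex c P)))"
    using inj_on_index unfolding model_complex_eq Union_generated_complex Union_generators
    by (rule inj_on_image_Pow)
  then have "inj_on ((`) index) (model_complex c P)" by (rule inj_on_subset) blast
  then show ?thesis unfolding out_simplices_complex by (simp add: card_image)
qed

text \<open>The vertices alone, as singleton simplices, are numerous enough.\<close>

lemma size_le_card: "unary_size P \<le> card (model_complex c P)"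
proof -
  have "(\<lambda>v. {v}) ` {..<a m} \<subseteq> set ` set out_simplices"
  proof
    fix \<sigma> assume "\<sigma> \<in> (\<lambda>v. {v}) ` {..<a m}"
    then obtain v where v: "\<sigma> = {v}" "v \<in> \<Union>(set ` set out_simplices)" using Union_out by auto
    then show "\<sigma> \<in> set ` set out_simplices"
      unfolding out_simplices_def set_faces_concat by (auto simp: generated_complex_def)
  qed
  then have "card ((\<lambda>v. {v}) ` {..<a m}) \<le> card (set ` set out_simplices)" by (intro card_mono) auto
  then show ?thesis using size_le_a_m by (simp add: card_model_complex card_image)
qed

text \<open>Counting the output with repetitions suffices: one cell for the wedge point,
  \<open>c\<close> edges per generator, at most three triangles per rectangle, and at most 8 faces
  of each cell.\<close>

lemma card_le: "card (model_complex c P) \<le> (24 * c + 8) * max 1 (unary_size P)"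
proof -
  have "length (concat (map faces gs)) \<le> 8 * length gs" if "\<And>g. g \<in> set gs \<Longrightarrow> length g \<le> 3" for gs :: "nat list list"
    using that
  proof (induction gs)
    case (Cons g gs)
    then show ?case using length_faces[of g] by fastforce
  qed simp
  then have "length out_simplices \<le> 8 * length (complex_cells m)"
    using complex_cells_length by (simp add: out_simplices_def)
  moreover have "length (complex_cells m) \<le> 1 + 3 * c * unary_size P"
  proof -
    have rc: "length (relation_cells j v) \<le> 3 * v" for j v
      by (induction v) (auto simp: rectangle_def)
    have "length (concat (map (\<lambda>j. relation_cells j (N j)) [0..<k])) \<le> (\<Sum>j<k. 3 * N j)" for k
      using rc by (induction k) (auto intro: add_mono)
    moreover have "length (wedge_cells k) = 1 + k * c" for k
      by (induction k) (auto simp: wedge_cells_def circle_cells_def)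
    ultimately have "length (complex_cells m) \<le> 1 + n * c + (\<Sum>j<m. 3 * N j)"
      unfolding complex_cells_def by simp
    also have "(\<Sum>j<m. 3 * N j) = 3 * c * (\<Sum>j<m. rl j)"
      unfolding N_def sum_distrib_left by (simp add: mult.assoc)
    also have "1 + n * c + 3 * c * (\<Sum>j<m. rl j) \<le> 1 + 3 * c * unary_size P"
      unfolding size_eq by (simp add: algebra_simps)
    finally show ?thesis .
  qed
  moreover have "card (model_complex c P) \<le> length out_simplices"
    unfolding card_model_complex using card_image_le[of "set out_simplices" set] card_length[of out_simplices]
    by simp
  ultimately have "card (model_complex c P) \<le> 8 + 24 * (c * unary_size P)" by linarith
  then show ?thesis using affine_le_max[of 8 "24 * c" "unary_size P"] by (simp add: add.commute mult.assoc)
qed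

text \<open>The fixed cost of a relation is charged to its length, which is at least 1. This leaves
  \<open>96 * c + 44\<close> per unit of size besides \<open>30 + c\<close>; the stated constant is
  a generous rounding.\<close>

lemma time_le:
  "30 + c + 8 * K + (\<Sum>j<m. c + 8 * N j + 21) + n * (13 * c + 11) +
      (\<Sum>j<m. c + rl j * (86 * c + 10) + 13) \<le> (200 * c + 200) * max 1 (unary_size P)"
proof -
  have "c + 8 * N j + 21 \<le> rl j * (9 * c + 21)" "c + rl j * (86 * c + 10) + 13 \<le> rl j * (87 * c + 23)" for j
    using mult_le_mono1[OF rl_pos[of j], of "c + 21"] mult_le_mono1[OF rl_pos[of j], of "c + 13"]
    by (simp_all add: N_def algebra_simps)
  then have "(\<Sum>j<m. c + 8 * N j + 21) \<le> (\<Sum>j<m. rl j) * (9 * c + 21)"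
    "(\<Sum>j<m. c + rl j * (86 * c + 10) + 13) \<le> (\<Sum>j<m. rl j) * (87 * c + 23)"
    unfolding sum_distrib_right by (auto intro: sum_mono)
  moreover have "8 * K \<le> n * (8 * c)" using K_le by (simp add: mult.commute)
  ultimately have "30 + c + 8 * K + (\<Sum>j<m. c + 8 * N j + 21) + n * (13 * c + 11) +
      (\<Sum>j<m. c + rl j * (86 * c + 10) + 13) \<le>
      30 + c + unary_size P * (96 * c + 44)"
    unfolding size_eq by (simp add: algebra_simps)
  also have "\<dots> \<le> (30 + c + (96 * c + 44)) * max 1 (unary_size P)"
    using affine_le_max[of "30 + c" "96 * c + 44" "unary_size P"] by (simp only: mult.commute)
  also have "\<dots> \<le> (200 * c + 200) * max 1 (unary_size P)"
    by (intro mult_le_mono1) simp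
  finally show ?thesis .
qed

end

section \<open>The algorithm and its linear bounds\<close>

theorem theorem1:
  fixes c :: nat
  assumes "c \<ge> 3"
  shows "\<exists>(A::prog) (B::nat) (C::nat). \<forall>P. presentation P \<longrightarrow>
    (\<exists>t s ps ss.
       exec (int (B * max 1 (unary_size P))) A (initial_ram (presentation_code P)) t s \<and>
       tape s = output_code ps ss \<and>
       realizes ps ss (model_complex c P) \<and>
       t \<le> C * max 1 (unary_size P) \<and> unary_size P \<le> C * t \<and>
       card (model_complex c P) \<le> C * max 1 (unary_size P) \<and>
       unary_size P \<le> C * card (model_complex c P))"
proof (rule exI[of _ "complex_prog c"], rule exI[of _ "c + 4"], rule exI[of _ "200 * c + 200"], intro allI impI)
  fix P assume P: "presentation P"
  let ?S = "max 1 (unary_size P)"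
  let ?w = "int ((c + 4) * ?S)"
  interpret pres_layout c P using assms P by unfold_locales
  interpret machine c P ?w
  proof
    \<comment> \<open>The factor \<open>c + 4\<close> dominates \<open>c + 2\<close> for vertex
      labels, 4 for input addresses and \<open>c + 3\<close> for constants.\<close>
    have "(c + 2) * ?S \<le> (c + 4) * ?S" "4 * ?S \<le> (c + 4) * ?S" "(c + 3) * 1 \<le> (c + 4) * ?S"
      by (intro mult_le_mono; simp)+
    note le = this
    have "a m \<le> (c + 4) * ?S" "ptr m \<le> (c + 4) * ?S" "c + 3 \<le> (c + 4) * ?S"
      by (rule order_trans[OF a_m_le le(1)], rule order_trans[OF ptr_m_le le(2)],
          rule le(3)[unfolded mult_1_right])
    then have "int (a m) \<le> ?w" "int (ptr m) \<le> ?w" "int (c + 3) \<le> ?w"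
      unfolding of_nat_le_iff .
    then show "int (a m) \<le> ?w" "int (ptr m) \<le> ?w" "int c + 3 \<le> ?w"
      by (simp_all only: of_nat_add of_nat_numeral)
  qed
  obtain t s where e: "exec ?w (complex_prog c) (initial_ram (presentation_code P)) t s"
    and t: "t \<le> (200 * c + 200) * ?S" and tape: "tape s = output_code out_points out_simplices"
    using wp_complex_prog time_le unfolding wp_def output_code_eq by (meson le_trans)
  \<comment> \<open>Each of the \<open>a m\<close> points contributes five numbers to the tape, and
    each number costs a step, so the time is at least the number of vertices and thus at least the
    size.\<close>
  have "a m \<le> length (points_code (a m))"
  proof -
    have "length (points_code v) = 5 * v" for v
      by (induction v) (auto simp: points_code_def split: prod.splits)
    then show ?thesis by simp
  qed
  also have "\<dots> \<le> t"
    using tape_length_le_time[OF e] unfolding tape output_code_eq by (simp add: initial_ram_def)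
  finally have "unary_size P \<le> t" using size_le_a_m by linarith
  have scale: "x \<le> (200 * c + 200) * y" if "x \<le> y" for x y :: nat
  proof -
    have "1 * y \<le> (200 * c + 200) * y" by (intro mult_le_mono1) simp
    then show ?thesis using that by linarith
  qed
  from \<open>unary_size P \<le> t\<close> have "unary_size P \<le> (200 * c + 200) * t" by (rule scale)
  moreover have "card (model_complex c P) \<le> (200 * c + 200) * ?S"
    using card_le by (rule order_trans) (intro mult_le_mono1, simp)
  moreover have "unary_size P \<le> (200 * c + 200) * card (model_complex c P)"
    using size_le_card by (rule scale)
  ultimately show "\<exists>t s ps ss.
       exec (int ((c + 4) * max 1 (unary_size P))) (complex_prog c) (initial_ram (presentation_code P)) t s \<and>
       tape s = output_code ps ss \<and>
       realizes ps ss (model_complex c P) \<and>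
       t \<le> (200 * c + 200) * max 1 (unary_size P) \<and> unary_size P \<le> (200 * c + 200) * t \<and>
       card (model_complex c P) \<le> (200 * c + 200) * max 1 (unary_size P) \<and>
       unary_size P \<le> (200 * c + 200) * card (model_complex c P)"
    using e t tape realizes_out by (intro exI conjI)
qed

end
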